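(* Assume the ABC conjecture. (a) If $a_0$ is a nonnegative integer with a prime factor $p$, and $a_1,\dots,a_d\in[N]$ are such that $H(a_0;a_1,\dots,a_d)\subseteq[N]\cap\operatorname{PP}$, then $d\ll p+\frac{(\log\log N)^2}{\log\log\log N}$. In particular, if $H(0;a_1,\dots,a_d)\subseteq[N]\cap\operatorname{PP}$, then $d\ll\frac{(\log\log N)^2}{\log\log\log N}$. (b) If $a_0$ is a nonnegative integer and $a_1,\dots,a_d$ positive integers with $H(a_0;a_1,\dots,a_d)\subseteq[N]\cap\operatorname{PP}$, then $d\ll\frac{(\log\log N)^3}{\log\log\log N}$. If furthermore one assumes Conjecture LPS (below), then $d\ll\frac{(\log\log N)^2}{\log\log\log N}$.
   Context: $\operatorname{PP}$ is the set of perfect powers (integers $x^m$ with $x,m$ positive integers, $m\ge2$). $[N]=\{1,\dots,N\}$. For $a_0>0$, $H(a_0;a_1,\dots,a_d)=a_0+\{0,a_1\}+\cdots+\{0,a_d\}$; $H(0;a_1,\dots,a_d)$ is the set of nonempty subsums $\{\sum_i\varepsilon_ia_i:\varepsilon_i\in\{0,1\},\sum\varepsilon_i>0\}$. The ABC conjecture: for each $\varepsilon>0$ there is $K_\varepsilon$ such that whenever $a,b,c$ are nonzero integers with $\gcd(a,b,c)=1$ and $a+b=c$, $\max\{|a|,|b|,|c|\}\le K_\varepsilon\operatorname{rad}(abc)^{1+\varepsilon}$, $\operatorname{rad}(n)=\prod_{p\mid n}p$. Conjecture LPS (special case of the Lander–Parkin–Selfridge conjecture): there is $k_0$ such that for every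 integer $k\ge k_0$ there are no positive integers $a_1,a_2,b_1,b_2$ with $a_1^k+a_2^k=b_1^k+b_2^k$ and $\{a_1,a_2\}\ne\{b_1,b_2\}$. $\ll$ is up to an absolute constant. *)

theory Defs
  imports Complex_Main "HOL-Library.Set_Algebras" "HOL-Computational_Algebra.Primes"
begin

definition perfect_powers :: "nat set" where
  "perfect_powers = {x ^ m | x m. x > 0 \<and> m \<ge> 2}"

(* The generators are a 1, ..., a d and may repeat. The sums in the first branch are Minkowski
   sums (Set_Algebras). For a0 = 0 the empty subsum is excluded. *)
definition hilbert_cube :: "nat \<Rightarrow> nat \<Rightarrow> (nat \<Rightarrow> nat) \<Rightarrow> nat set" where
  "hilbert_cube a0 d a =
     (if a0 > 0 then {a0} + (\<Sum>i=1..d. {0, a i})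
      else {\<Sum>i=1..d. \<epsilon> i * a i | \<epsilon> :: nat \<Rightarrow> nat.
              (\<forall>i\<in>{1..d}. \<epsilon> i \<in> {0, 1}) \<and> (\<Sum>i=1..d. \<epsilon> i) > 0})"

definition rad :: "int \<Rightarrow> int" where
  "rad n = \<Prod>(prime_factors n)"

definition ABC_conjecture :: bool where
  "ABC_conjecture \<longleftrightarrow>
     (\<forall>\<epsilon>::real. \<epsilon> > 0 \<longrightarrow> (\<exists>K::real. \<forall>a b c :: int.
        a \<noteq> 0 \<and> b \<noteq> 0 \<and> c \<noteq> 0 \<and> gcd a (gcd b c) = 1 \<and> a + b = c \<longrightarrow>
        real_of_int (max \<bar>a\<bar> (max \<bar>b\<bar> \<bar>c\<bar>)) \<le> K * real_of_int (rad (a * b * c)) powr (1 + \<epsilon>)))"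

definition LPS_conjecture :: bool where
  "LPS_conjecture \<longleftrightarrow>
     (\<exists>k0::nat. \<forall>k\<ge>k0. \<not> (\<exists>a1 a2 b1 b2 :: nat.
        a1 > 0 \<and> a2 > 0 \<and> b1 > 0 \<and> b2 > 0 \<and>
        a1 ^ k + a2 ^ k = b1 ^ k + b2 ^ k \<and> {a1, a2} \<noteq> {b1, b2}))"

end

theory Submission
  imports Defs "HOL-Complex_Analysis.Complex_Analysis" "HOL-Real_Asymp.Real_Asymp"
    "HOL-Number_Theory.Cong"
begin

text \<open>
  Write \<open>L = ln ln N\<close>. All four bounds follow from \<open>d \<lesssim> L\<^sup>2 / ln L\<close> for translated cubes, which combines
  two facts.

  Under ABC an arithmetic progression of perfect powers in \<open>[N]\<close> has length \<open>\<lesssim> L / ln L\<close>. After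
  removing the common gcd \<open>g\<close> of the terms and the common difference, at least about half of the terms
  have the same valuation \<open>\<beta>\<close> at a prime dividing \<open>g\<close>, so their exponents are prime factors of
  \<open>\<beta> \<le> 2 ln N\<close>, of which there are \<open>\<lesssim> L / ln L\<close>. ABC for the linear relation between three terms
  shows that a large exponent is rarely used. Small exponents are excluded by applying ABC to the identity
  \<open>A - B = u\<^sup>4 C\<close> where \<open>A\<close> and \<open>B\<close> are products of powers of five terms \<open>t + i u\<close> chosen so that
  \<open>A / B\<close> agrees with \<open>1\<close> to fourth order in \<open>u\<close>.

  Unconditionally, \<open>A + B \<subseteq> [N]\<close> consisting of perfect powers with \<open>|A| = |B|\<close> forces \<open>|A|\<close> to be
  at most a power of \<open>ln N\<close>. Some exponent \<open>q\<close> occurs with density at least \<open>1 / q\<^sup>2\<close>, so there are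
  \<open>s\<close> elements of \<open>A\<close>, with \<open>q ^ s\<close> a power of \<open>ln N\<close>, all of whose sums with many \<open>b\<close> are \<open>q\<close>-th powers.
  The functions \<open>\<Prod>(b + a) powr (e a / q)\<close> then take integer values at these \<open>b\<close>; Thue's method yields an
  integral combination vanishing at all of them, and it has few zeros as it divides a polynomial of
  controlled degree.

  As the progressions in a cube are short, each generator enlarges the cube by a factor
  \<open>1 + c ln L / L\<close>, and splitting the cube into two halves as \<open>A + B\<close> bounds \<open>d\<close>.
\<close>

section \<open>Integral linear systems and functions with many zeros\<close>

text \<open>Why five terms: with r terms \<open>t + i u\<close> the exponents can be balanced so
  that u^(r - 1) divides A - B. If H bounds the terms and D is the degree, ABC compares H^D with a
  radical of size H^(r/2) for the terms, H for u and H^(D - r + 1) for the cofactor, in total H^(D +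
  2 - r/2). This is a saving only from r = 5 on; the square-root saving per term is all that
  exponent 2 offers.

  For the sumset bound the number m = q^s of available functions must exceed a multiple of (ln N)^2,
  so that 3^(m/2) beats the size of the values, while the loss (4 q^2)^s in the choice of s common
  shifts must stay polynomial in m. Both hold for the least suitable s, and since q \<le> 2 ln N the
  excess of m is harmless. The degree in ln N is irrelevant: its logarithm is O(L), and L times the
  progression length L / ln L is the final bound.

  The functions branch at the points -a, so estimates by zeros are made on intervals short compared
  with their distance from these points; O(ln N) intervals suffice.\<close>

lemma siegel_lemma:
  fixes M :: "'i \<Rightarrow> 'j \<Rightarrow> int" and H G :: nat
  assumes I: "finite I" and J: "finite J"
    and G: "\<And>i j. i \<in> I \<Longrightarrow> j \<in> J \<Longrightarrow> \<bar>M i j\<bar> \<le> int G"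
    and H: "(2 * card J * H * G + 1) ^ card I < (H + 1) ^ card J"
  shows "\<exists>c :: 'j \<Rightarrow> int. (\<exists>j\<in>J. c j \<noteq> 0) \<and> (\<forall>j\<in>J. \<bar>c j\<bar> \<le> int H) \<and> (\<forall>i\<in>I. (\<Sum>j\<in>J. M i j * c j) = 0)"
proof -
  define X where "X = int (card J * H * G)"
  \<comment> \<open>Pigeonhole: \<open>\<phi>\<close> maps the box \<open>U\<close> into the box
    \<open>V\<close>, which by \<open>H\<close> has fewer points. The solution is the difference of
    two colliding vectors; entries of \<open>U\<close> are nonnegative, so the difference stays
    within \<open>H\<close>.\<close>
  define U where "U = PiE J (\<lambda>_. {0..int H})"
  define V where "V = PiE I (\<lambda>_. {-X..X})"
  define \<phi> where "\<phi> c = (\<lambda>i\<in>I. \<Sum>j\<in>J. M i j * c j)" for c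
  have sub: "\<phi> ` U \<subseteq> V"
  proof
    fix v assume "v \<in> \<phi> ` U"
    then obtain c where c: "c \<in> U" "v = \<phi> c" by auto
    have "\<bar>\<Sum>j\<in>J. M i j * c j\<bar> \<le> X" if i: "i \<in> I" for i
    proof -
      have "\<bar>\<Sum>j\<in>J. M i j * c j\<bar> \<le> (\<Sum>j\<in>J. \<bar>M i j * c j\<bar>)" by (rule sum_abs)
      also have "\<dots> \<le> (\<Sum>j\<in>J. int G * int H)"
      proof (rule sum_mono)
        fix j assume j: "j \<in> J"
        have "c j \<in> {0..int H}" using c(1) j by (auto simp: U_def)
        then have "\<bar>c j\<bar> \<le> int H" by auto
        then show "\<bar>M i j * c j\<bar> \<le> int G * int H"
          unfolding abs_mult by (intro mult_mono G i j) auto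
      qed
      also have "\<dots> = X" by (simp add: X_def)
      finally show ?thesis .
    qed
    then show "v \<in> V" unfolding c(2) V_def \<phi>_def by (auto simp: abs_le_iff) (smt (verit))
  qed
  have cU: "card U = (H + 1) ^ card J" by (simp add: U_def card_PiE J nat_add_distrib)
  have cV: "card V = (2 * card J * H * G + 1) ^ card I"
  proof -
    have "card V = (\<Prod>i\<in>I. card {-X..X})" unfolding V_def using I by (rule card_PiE)
    also have "card {-X..X} = nat (X + 1 + X)" by simp
    also have "X + 1 + X = int (2 * card J * H * G + 1)" by (simp add: X_def algebra_simps)
    finally show ?thesis by (simp only: nat_int prod_constant)
  qed
  have "finite V" by (simp add: V_def finite_PiE I)
  then have "card (\<phi> ` U) < card U"
    using card_mono[OF _ sub] cU cV H by linarith
  then have "\<not> inj_on \<phi> U" using card_image by fastforce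
  then obtain c d where cd: "c \<in> U" "d \<in> U" "\<phi> c = \<phi> d" "c \<noteq> d" unfolding inj_on_def by blast
  show ?thesis
  proof (intro exI[of _ "\<lambda>j. c j - d j"] conjI ballI)
    show "\<exists>j\<in>J. c j - d j \<noteq> 0"
      using cd PiE_ext[of c J "\<lambda>_. {0..int H}" d] unfolding U_def by auto
  next
    fix j assume "j \<in> J"
    then have "c j \<in> {0..int H}" "d j \<in> {0..int H}" using cd unfolding U_def by auto
    then show "\<bar>c j - d j\<bar> \<le> int H" by auto
  next
    fix i assume i: "i \<in> I"
    have "\<phi> c i = \<phi> d i" using cd by simp
    then show "(\<Sum>j\<in>J. M i j * (c j - d j)) = 0"
      using i by (simp add: \<phi>_def right_diff_distrib sum_subtractf)
  qed
qed

section \<open>A Schwarz lemma for functions with prescribed zeros\<close>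

lemma holomorphic_divide_zeros:
  fixes f :: "complex \<Rightarrow> complex"
  assumes "finite Z" "open S" "Z \<subseteq> S" "f holomorphic_on S" "\<And>z. z \<in> Z \<Longrightarrow> f z = 0"
  shows "\<exists>h. h holomorphic_on S \<and> (\<forall>z\<in>S. f z = (\<Prod>b\<in>Z. z - b) * h z)"
  using assms
proof (induction Z rule: finite_induct)
  case empty
  then show ?case by (intro exI[of _ f]) auto
next
  case (insert a Z)
  then obtain h where h: "h holomorphic_on S" "\<forall>z\<in>S. f z = (\<Prod>b\<in>Z. z - b) * h z" by auto
  have "f a = 0" "a \<in> S" using insert by auto
  moreover have "(\<Prod>b\<in>Z. a - b) \<noteq> 0" using insert by auto
  ultimately have ha: "h a = 0" using h(2) by auto
  \<comment> \<open>The singularity at \<open>a\<close> is removable because \<open>h a = 0\<close>;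
    the value there is the limit of the quotient.\<close>
  define k where "k z = (if z = a then deriv h a else h z / (z - a))" for z
  have "k holomorphic_on S"
    by (rule pole_theorem_open_0[OF h(1) insert(4), of a]) (auto simp: k_def ha)
  moreover have "f z = (\<Prod>b\<in>insert a Z. z - b) * k z" if "z \<in> S" for z
  proof (cases "z = a")
    case True then show ?thesis using insert \<open>f a = 0\<close> by simp
  next
    case False then show ?thesis using h(2) that insert(1,2) by (simp add: k_def)
  qed
  ultimately show ?case by blast
qed

text \<open>Dividing by the product over \<open>Z\<close> costs at least \<rho> - r per zero on the
  sphere, the maximum modulus principle carries the bound of the quotient inside, and multiplying
  back at \<open>w\<close> contributes at most 2 r per zero.\<close>

lemma schwarz_many_zeros:
  fixes f :: "complex \<Rightarrow> complex"
  assumes "finite Z" "open S" "cball z0 \<rho> \<subseteq> S" "f holomorphic_on S" "0 < r" "r < \<rho>"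
    and Z: "Z \<subseteq> cball z0 r" "\<And>z. z \<in> Z \<Longrightarrow> f z = 0"
    and M: "\<And>z. z \<in> sphere z0 \<rho> \<Longrightarrow> norm (f z) \<le> M" and w: "w \<in> cball z0 r"
  shows "norm (f w) \<le> M * (2 * r / (\<rho> - r)) ^ card Z"
proof -
  have "Z \<subseteq> S" using Z(1) assms by (force simp: subset_iff)
  then obtain h where h: "h holomorphic_on S" "\<forall>z\<in>S. f z = (\<Prod>b\<in>Z. z - b) * h z"
    using holomorphic_divide_zeros[OF assms(1,2) _ assms(4) Z(2)] by auto
  have bd: "norm (h z) \<le> M / (\<rho> - r) ^ card Z" if z: "z \<in> sphere z0 \<rho>" for z
  proof -
    have "(\<rho> - r) ^ card Z = (\<Prod>b\<in>Z. \<rho> - r)" by simp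
    also have "\<dots> \<le> (\<Prod>b\<in>Z. norm (z - b))"
    proof (rule prod_mono)
      fix b assume "b \<in> Z"
      then have "dist z0 b \<le> r" using Z by auto
      moreover have "dist z0 z = \<rho>" using z by auto
      ultimately have "\<rho> - r \<le> dist z b" using dist_triangle[of z0 z b] by (simp add: dist_commute)
      then show "0 \<le> \<rho> - r \<and> \<rho> - r \<le> norm (z - b)" using assms by (simp add: dist_norm)
    qed
    finally have 1: "(\<rho> - r) ^ card Z \<le> norm (\<Prod>b\<in>Z. z - b)" by (simp add: prod_norm)
    have "z \<in> S" using z assms(3) by auto
    then have "norm (\<Prod>b\<in>Z. z - b) * norm (h z) \<le> M" using h(2) M[OF z] by (simp add: norm_mult)
    moreover have "(\<rho> - r) ^ card Z * norm (h z) \<le> norm (\<Prod>b\<in>Z. z - b) * norm (h z)"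
      using 1 by (intro mult_right_mono) auto
    ultimately have "norm (h z) * (\<rho> - r) ^ card Z \<le> M" by (simp add: mult.commute)
    then show ?thesis using assms by (simp add: pos_le_divide_eq)
  qed
  have hw: "norm (h w) \<le> M / (\<rho> - r) ^ card Z"
  proof (rule maximum_modulus_frontier[of h "cball z0 \<rho>"])
    show "h holomorphic_on interior (cball z0 \<rho>)"
      using h(1) assms(3) holomorphic_on_subset interior_subset by (metis order_trans)
    show "continuous_on (closure (cball z0 \<rho>)) h"
      using h(1) assms(3) holomorphic_on_imp_continuous_on holomorphic_on_subset by auto
    show "norm (h z) \<le> M / (\<rho> - r) ^ card Z" if "z \<in> frontier (cball z0 \<rho>)" for z
      using that bd by (auto simp: frontier_cball)
    show "w \<in> cball z0 \<rho>" using w assms by auto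
  qed auto
  have "w \<in> S" using w assms by (auto simp: subset_iff)
  then have "norm (f w) = (\<Prod>b\<in>Z. norm (w - b)) * norm (h w)" using h(2) by (simp add: norm_mult prod_norm)
  also have "\<dots> \<le> (\<Prod>b\<in>Z. 2 * r) * (M / (\<rho> - r) ^ card Z)"
  proof (intro mult_mono hw prod_mono)
    fix b assume "b \<in> Z"
    then have "dist z0 b \<le> r" "dist z0 w \<le> r" using Z w by auto
    then have "dist w b \<le> 2 * r" using dist_triangle[of w b z0] by (simp add: dist_commute)
    then show "0 \<le> norm (w - b) \<and> norm (w - b) \<le> 2 * r" by (simp add: dist_norm)
  qed (use assms in \<open>auto intro: prod_nonneg\<close>)
  also have "\<dots> = M * (2 * r / (\<rho> - r)) ^ card Z" by (simp add: power_divide)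
  finally show ?thesis .
qed

section \<open>Independence of products of fractional powers\<close>

text \<open>With the principal branch this is holomorphic to the right of all points -a. If every
  \<open>b + a\<close> is a q-th power of a positive integer x_a, the value at b is the product of
  the x_a ^ e a, an integer; Thue's method rests on this.\<close>

definition rootprod :: "nat \<Rightarrow> nat set \<Rightarrow> (nat \<Rightarrow> nat) \<Rightarrow> complex \<Rightarrow> complex" where
  "rootprod q S e z = (\<Prod>a\<in>S. (z + of_nat a) powr (of_nat (e a) / of_nat q))"

abbreviation residue_exps :: "nat \<Rightarrow> nat set \<Rightarrow> (nat \<Rightarrow> nat) set" where
  "residue_exps q S \<equiv> PiE S (\<lambda>_. {..<q})"

lemma rootprod_holomorphic:
  assumes "\<And>a. a \<in> S \<Longrightarrow> c \<le> real a"
  shows "rootprod q S e holomorphic_on {z. Re z > - c}"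
  unfolding rootprod_def
proof (intro holomorphic_intros)
  fix z a assume "z \<in> {z. - c < Re z}" "a \<in> S"
  then have "Re (z + of_nat a) > 0" using assms[of a] by auto
  then show "z + of_nat a \<notin> \<real>\<^sub>\<le>\<^sub>0" using complex_nonpos_Reals_iff by force
qed

text \<open>The identity theorem, with the midpoint of the interval as limit point. It transports
  vanishing along the real axis from far right to the neighbourhood of a branch point, and
  back.\<close>

lemma vanish_halfplane:
  fixes f :: "complex \<Rightarrow> complex"
  assumes f: "f holomorphic_on {z. Re z > c}" and uv: "c \<le> u" "u < v"
    and 0: "\<And>x. u < x \<Longrightarrow> x < v \<Longrightarrow> f (of_real x) = 0" and z: "Re z > c"
  shows "f z = 0"
proof -
  define \<xi> where "\<xi> = complex_of_real ((u + v) / 2)"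
  define U where "U = complex_of_real ` {u<..<v}"
  have "\<exists>z\<in>U. z \<noteq> \<xi> \<and> dist z \<xi> < e" if "e > 0" for e :: real
  proof -
    define \<delta> where "\<delta> = min (e / 2) ((v - u) / 4)"
    have \<delta>: "0 < \<delta>" "\<delta> < e" "\<delta> < (v - u) / 2" using that uv by (auto simp: \<delta>_def min_def)
    have "(u + v) / 2 + \<delta> \<in> {u<..<v}" using \<delta> uv by (auto simp: field_simps)
    then have "of_real ((u + v) / 2 + \<delta>) \<in> U" unfolding U_def by (rule imageI)
    moreover have "of_real ((u + v) / 2 + \<delta>) \<noteq> \<xi>" using \<delta>(1) unfolding \<xi>_def of_real_eq_iff by linarith
    moreover have "dist (of_real ((u + v) / 2 + \<delta>)) \<xi> < e"
      using \<delta> unfolding \<xi>_def dist_of_real by (simp add: dist_real_def)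
    ultimately show ?thesis by blast
  qed
  then have "\<xi> islimpt U" by (auto simp: islimpt_approachable)
  moreover have "open {z. Re z > c}" by (rule open_halfspace_Re_gt)
  moreover have "connected {z. Re z > c}" by (intro convex_connected convex_halfspace_Re_gt)
  ultimately show ?thesis
    using analytic_continuation[OF f, of U \<xi> z] uv 0 z by (force simp: U_def \<xi>_def)
qed

text \<open>A polynomial of degree below q with q roots is zero. This separates the q branches at a
  branch point.\<close>

lemma vanish_at_roots_of_unity:
  fixes v :: "nat \<Rightarrow> complex"
  assumes q: "q > 0" and 0: "\<And>w. w ^ q = 1 \<Longrightarrow> (\<Sum>f<q. v f * w ^ f) = 0" and k: "k < q"
  shows "v k = 0"
proof -
  define P where "P = (\<Sum>f<q. monom (v f) f)"
  have coeff: "coeff P k = v k" using k by (simp add: P_def coeff_sum coeff_monom sum.delta)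
  have "P = 0"
  proof (rule ccontr)
    assume P: "P \<noteq> 0"
    have "degree P \<le> q - 1" unfolding P_def
      by (intro degree_sum_le) (auto intro: order.trans[OF degree_monom_le])
    moreover have "{w. w ^ q = 1} \<subseteq> {w. poly P w = 0}"
      using 0 by (auto simp: P_def poly_sum poly_monom)
    then have "card {w::complex. w ^ q = 1} \<le> card {w. poly P w = 0}"
      by (intro card_mono poly_roots_finite P)
    moreover have "card {w. poly P w = 0} \<le> degree P" using P by (rule card_poly_roots_bound)
    ultimately show False using q card_roots_unity_eq[of q] by simp
  qed
  with coeff show ?thesis by simp
qed

lemma sum_residue_exps_insert:
  assumes "finite S" "a \<notin> S"
  shows "(\<Sum>e\<in>residue_exps q (insert a S). F e) = (\<Sum>f<q. \<Sum>e\<in>residue_exps q S. F (e(a := f)))"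
proof -
  have "(\<Sum>e\<in>residue_exps q (insert a S). F e)
      = (\<Sum>(f, e)\<in>{..<q} \<times> residue_exps q S. F (e(a := f)))"
    unfolding PiE_insert_eq
    by (subst sum.reindex[OF inj_combinator[OF assms(2)]]) (simp add: case_prod_unfold comp_def)
  then show ?thesis by (simp add: sum.cartesian_product)
qed

text \<open>Monodromy at the rightmost branch point. The induction inserts the smallest element
  \<open>a\<close>, so the remaining factors stay holomorphic down to real part -a - 1. Turning
  around -a multiplies the part \<open>G f\<close> by the f-th power of a root of unity, so every
  \<open>G f\<close> vanishes separately and falls under the induction hypothesis.\<close>

theorem rootprod_independent:
  fixes p :: "(nat \<Rightarrow> nat) \<Rightarrow> complex poly"
  assumes "finite S" "q > 0"
    and "\<And>x::real. x > R \<Longrightarrow>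
      (\<Sum>e\<in>residue_exps q S. poly (p e) (of_real x) * rootprod q S e (of_real x)) = 0"
    and "e \<in> residue_exps q S"
  shows "p e = 0"
  using assms(1,3,4)
proof (induction S arbitrary: p e R rule: finite_linorder_min_induct)
  case empty
  have *: "poly (p e) (of_real x) = 0" if "x > R" for x using empty that by (simp add: rootprod_def)
  show ?case
  proof (rule ccontr)
    assume "p e \<noteq> 0"
    then have "finite {z. poly (p e) z = 0}" by (rule poly_roots_finite)
    moreover have "complex_of_real ` {R<..} \<subseteq> {z. poly (p e) z = 0}" using * by auto
    ultimately have "finite (complex_of_real ` {R<..})" by (rule finite_subset[rotated])
    then have "finite {R<..}" by (simp add: finite_image_iff inj_on_def)
    then show False using infinite_Ioi by blast
  qed
next
  case (insert a S)
  have aS: "a \<notin> S" using insert by auto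
  define G where "G f z = (\<Sum>e\<in>residue_exps q S. poly (p (e(a := f))) z * rootprod q S e z)" for f z
  have G_hol: "G f holomorphic_on {z. Re z > - (real a + 1)}" for f
    unfolding G_def using insert(2) by (intro holomorphic_intros rootprod_holomorphic) force
  define F where "F z = (\<Sum>f<q. (z + of_nat a) powr (of_nat f / of_nat q) * G f z)" for z
  have F_eq: "F z = (\<Sum>e\<in>residue_exps q (insert a S). poly (p e) z * rootprod q (insert a S) e z)" for z
  proof -
    have "rootprod q (insert a S) (e(a := f)) z = (z + of_nat a) powr (of_nat f / of_nat q) * rootprod q S e z"
      for e f using aS insert(1) by (auto simp: rootprod_def intro!: prod.cong)
    then show ?thesis
      unfolding sum_residue_exps_insert[OF insert(1) aS] F_def G_def
      by (simp add: sum_distrib_left mult_ac)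
  qed
  have F_hol: "F holomorphic_on {z. Re z > - real a}"
    unfolding F_def
  proof (intro holomorphic_intros)
    show "G f holomorphic_on {z. Re z > - real a}" for f
      by (rule holomorphic_on_subset[OF G_hol]) auto
    fix z assume "z \<in> {z. - real a < Re z}"
    then have "Re (z + of_nat a) > 0" by auto
    then show "z + of_nat a \<notin> \<real>\<^sub>\<le>\<^sub>0" using complex_nonpos_Reals_iff by force
  qed
  have F0: "F z = 0" if "Re z > - real a" for z
    by (rule vanish_halfplane[OF F_hol, of "max R (- real a)" "max R (- real a) + 1"])
      (use insert.prems(1) that in \<open>auto simp: F_eq\<close>)
  \<comment> \<open>Uniformization at -a: under z = y^q - a the fractional powers of z + a become
    y^f, so \<open>h\<close> is holomorphic across y = 0, where \<open>F\<close> has its branch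
    point.\<close>
  define h where "h y = (\<Sum>f<q. y ^ f * G f (y ^ q - of_nat a))" for y
  have ball: "Re (y ^ q - of_nat a) > - (real a + 1)" if "y \<in> ball 0 1" for y :: complex
  proof -
    have "norm y ^ q < 1" using that \<open>q > 0\<close> by (intro power_Suc_less_one[THEN less_le_trans] power_less_one_iff[THEN iffD2]) auto
    then have "\<bar>Re (y ^ q)\<bar> < 1" using abs_Re_le_cmod[of "y ^ q"] by (simp add: norm_power)
    then show ?thesis by auto
  qed
  have h_hol: "h holomorphic_on ball 0 1"
    unfolding h_def
  proof (intro holomorphic_intros)
    fix f
    have "(G f \<circ> (\<lambda>y. y ^ q - of_nat a)) holomorphic_on ball 0 1"
      by (rule holomorphic_on_compose_gen[OF _ G_hol]) (use ball in \<open>auto intro!: holomorphic_intros\<close>)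
    then show "(\<lambda>y. G f (y ^ q - of_nat a)) holomorphic_on ball 0 1" by (simp add: comp_def)
  qed
  have h_real: "h (of_real y) = 0" if y: "0 < y" "y < 1" for y
  proof -
    have "(of_real (y ^ q)) powr (of_nat f / of_nat q) = (of_real y :: complex) ^ f" for f
    proof -
      have "(of_real (y ^ q)) powr (of_real (real f / real q)) = complex_of_real ((y ^ q) powr (real f / real q))"
        using y by (intro powr_of_real) auto
      also have "(y ^ q) powr (real f / real q) = y ^ f"
        using y \<open>q > 0\<close> by (simp add: powr_realpow[symmetric] powr_powr)
      finally show ?thesis by simp
    qed
    then have "h (of_real y) = F (of_real (y ^ q) - of_nat a)" by (simp add: h_def F_def)
    also have "\<dots> = 0" using y by (intro F0) simp
    finally show ?thesis .
  qed
  have h0: "h y = 0" if "y \<in> ball 0 1" for y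
  proof -
    have "\<exists>z\<in>complex_of_real ` {0<..<1}. z \<noteq> 0 \<and> dist z 0 < e" if "e > 0" for e :: real
      by (intro bexI[of _ "of_real (min (e/2) (1/2))"]) (use that in \<open>auto simp: min_def\<close>)
    then have "0 islimpt complex_of_real ` {0<..<1}" by (auto simp: islimpt_approachable)
    then show ?thesis
      using analytic_continuation[OF h_hol, of "complex_of_real ` {0<..<1}" 0 y] h_real that by force
  qed
  have G0: "G f (of_real x) = 0" if f: "f < q" and x: "- real a < x" "x < - real a + 1" for f x
  proof -
    define y where "y = (x + real a) powr (1 / real q)"
    have y0: "0 < y" "y ^ q = x + real a"
      using x \<open>q > 0\<close> by (auto simp: y_def powr_realpow[symmetric] powr_powr)
    have y: "0 < y" "y < 1" "y ^ q = x + real a"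
      using y0 x one_le_power[of y q] by (auto simp: not_le[symmetric])
    \<comment> \<open>Replacing y by w y with w^q = 1 leaves y^q fixed and multiplies the f-th
      summand by w^f.\<close>
    have "complex_of_real y ^ f * G f (of_real y ^ q - of_nat a) = 0"
    proof (rule vanish_at_roots_of_unity[OF \<open>q > 0\<close> _ f])
      fix w :: complex assume w: "w ^ q = 1"
      then have "norm w ^ q = 1" by (metis norm_one norm_power)
      then have "norm w = 1" using \<open>q > 0\<close> by (metis norm_ge_zero power_eq_imp_eq_base power_one zero_le_one)
      then have "h (w * of_real y) = 0" using y by (intro h0) (auto simp: norm_mult)
      then show "(\<Sum>f<q. complex_of_real y ^ f * G f (of_real y ^ q - of_nat a) * w ^ f) = 0"
        by (simp add: h_def power_mult_distrib w mult_ac)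
    qed
    then show ?thesis using y by (simp flip: of_real_power)
  qed
  have G_all: "G f (of_real x) = 0" if "f < q" "x > - real a" for f x
    by (rule vanish_halfplane[OF G_hol, of "- real a" "- real a + 1"]) (use G0 that in auto)
  obtain f e' where e: "e = e'(a := f)" "f < q" "e' \<in> residue_exps q S"
    using insert.prems(2) unfolding PiE_insert_eq by auto
  show ?case
    unfolding e(1)
    by (rule insert.IH[where R="- real a" and p="\<lambda>e. p (e(a := f))", OF _ e(3)])
      (use G_all[OF e(2)] in \<open>simp add: G_def\<close>)
qed

text \<open>Gaussian elimination by cross-multiplication with the pivot \<open>M i0 j0\<close>. No
  division occurs, so the solution stays in the ring, and the lemma serves both for complex and for
  integer systems.\<close>

lemma homogeneous_system_kernel:
  fixes M :: "'i \<Rightarrow> 'j \<Rightarrow> 'a::idom"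
  assumes "finite I" "finite J" "card I < card J"
  shows "\<exists>c. (\<exists>j\<in>J. c j \<noteq> 0) \<and> (\<forall>i\<in>I. (\<Sum>j\<in>J. M i j * c j) = 0)"
  using assms
proof (induction I arbitrary: J M rule: finite_induct)
  case empty
  then have "J \<noteq> {}" by auto
  then show ?case by (intro exI[of _ "\<lambda>_. 1"]) auto
next
  case (insert i0 I)
  show ?case
  proof (cases "\<forall>j\<in>J. M i0 j = 0")
    case True
    have "card I < card J" using insert by simp
    from insert.IH[OF insert.prems(1) this, of M] obtain c where
      c: "\<exists>j\<in>J. c j \<noteq> 0" "\<forall>i\<in>I. (\<Sum>j\<in>J. M i j * c j) = 0" by blast
    moreover have "(\<Sum>j\<in>J. M i0 j * c j) = 0" using True by (intro sum.neutral) auto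
    ultimately show ?thesis by (intro exI[of _ c]) blast
  next
    case False
    then obtain j0 where j0: "j0 \<in> J" "M i0 j0 \<noteq> 0" by blast
    define K where "K = J - {j0}"
    define M' where "M' i j = M i0 j0 * M i j - M i j0 * M i0 j" for i j
    have "card I < card K" using insert j0 by (simp add: K_def)
    moreover have "finite K" using insert by (simp add: K_def)
    ultimately obtain d where d: "\<exists>j\<in>K. d j \<noteq> 0" "\<forall>i\<in>I. (\<Sum>j\<in>K. M' i j * d j) = 0"
      using insert.IH by blast
    define c where "c j = (if j = j0 then - (\<Sum>j\<in>K. M i0 j * d j) else M i0 j0 * d j)" for j
    have sum: "(\<Sum>j\<in>J. M i j * c j) = (\<Sum>j\<in>K. M' i j * d j)" for i
    proof -
      have "(\<Sum>j\<in>J. M i j * c j) = M i j0 * c j0 + (\<Sum>j\<in>K. M i j * c j)"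
        using insert.prems(1) j0 by (simp add: K_def sum.remove)
      also have "(\<Sum>j\<in>K. M i j * c j) = (\<Sum>j\<in>K. M i j * (M i0 j0 * d j))"
        by (intro sum.cong) (auto simp: c_def K_def)
      also have "M i j0 * c j0 = (\<Sum>j\<in>K. - (M i j0 * (M i0 j * d j)))"
        by (simp add: c_def sum_distrib_left sum_negf)
      also have "\<dots> + (\<Sum>j\<in>K. M i j * (M i0 j0 * d j)) = (\<Sum>j\<in>K. M' i j * d j)"
        by (simp add: M'_def sum.distrib[symmetric] algebra_simps)
      finally show ?thesis .
    qed
    have "\<exists>j\<in>J. c j \<noteq> 0" using d(1) j0 by (auto simp: c_def K_def)
    moreover have "\<forall>i\<in>insert i0 I. (\<Sum>j\<in>J. M i j * c j) = 0"
      using d(2) by (auto simp: sum) (simp add: M'_def mult.commute)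
    ultimately show ?thesis by blast
  qed
qed

text \<open>Exponents add modulo q, and each carry releases a full linear factor. Combinations of
  the \<open>rootprod\<close> with polynomial coefficients are therefore closed under
  multiplication.\<close>

lemma rootprod_mult:
  assumes "q > 0" and e: "e \<in> residue_exps q S" and f: "f \<in> residue_exps q S"
    and z: "\<And>a. a \<in> S \<Longrightarrow> z + of_nat a \<noteq> 0"
  shows "rootprod q S e z * rootprod q S f z =
    (\<Prod>a\<in>S. if e a + f a < q then 1 else z + of_nat a) * rootprod q S (\<lambda>a\<in>S. (e a + f a) mod q) z"
  unfolding rootprod_def prod.distrib[symmetric]
proof (rule prod.cong)
  fix a assume a: "a \<in> S"
  define w where "w = z + of_nat a"
  have w: "w \<noteq> 0" using z[OF a] by (simp add: w_def)
  have lt: "e a < q" "f a < q" using e f a by (auto simp: PiE_def Pi_def)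
  have "w powr (of_nat (e a) / of_nat q) * w powr (of_nat (f a) / of_nat q)
      = w powr (of_nat (e a + f a) / of_nat q)"
    by (simp add: powr_add[symmetric] add_divide_distrib)
  also have "\<dots> = (if e a + f a < q then 1 else w) * w powr (of_nat ((e a + f a) mod q) / of_nat q)"
  proof (cases "e a + f a < q")
    case False
    then have "(e a + f a) mod q = e a + f a - q" using lt by (simp add: mod_if)
    then have "of_nat (e a + f a) / of_nat q = (1::complex) + of_nat ((e a + f a) mod q) / of_nat q"
      using False \<open>q > 0\<close> by (simp add: field_simps of_nat_diff)
    then have "w powr (of_nat (e a + f a) / of_nat q)
        = w powr 1 * w powr (of_nat ((e a + f a) mod q) / of_nat q)"
      by (simp only: powr_add)
    then show ?thesis using w False by simp
  qed simp
  finally show "(z + of_nat a) powr (of_nat (e a) / of_nat q) * (z + of_nat a) powr (of_nat (f a) / of_nat q) =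
         (if e a + f a < q then 1 else z + of_nat a) *
         (z + of_nat a) powr (of_nat ((\<lambda>a\<in>S. (e a + f a) mod q) a) / of_nat q)"
    using a by (simp add: w_def)
qed simp

text \<open>The sum \<open>F\<close> is multiplied by a combination \<open>\<Lambda>\<close> with
  polynomial coefficients chosen so that the product is a polynomial, whose roots include the zeros
  of \<open>F\<close>. Killing all components of the product with nonzero exponent vector is a
  linear system for the coefficients of \<open>\<Lambda>\<close>.\<close>

theorem rootprod_zeros_bound:
  fixes c :: "(nat \<Rightarrow> nat) \<Rightarrow> complex" and \<gamma> :: real
  assumes S: "finite S" and q: "q > 0" and \<gamma>: "\<And>a. a \<in> S \<Longrightarrow> \<gamma> \<le> real a"
    and c: "\<exists>e\<in>residue_exps q S. c e \<noteq> 0"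
    and Z: "\<And>x. x \<in> Z \<Longrightarrow> x > - \<gamma>"
      "\<And>x. x \<in> Z \<Longrightarrow> (\<Sum>e\<in>residue_exps q S. c e * rootprod q S e (of_real x)) = 0"
  shows "finite Z \<and> card Z \<le> card S * q ^ card S + card S"
proof -
  define E where "E = residue_exps q S"
  define s where "s = card S"
  define m where "m = q ^ s"
  have finE: "finite E" by (simp add: E_def finite_PiE S)
  have cardE: "card E = m" by (simp add: E_def card_PiE S m_def s_def)
  \<comment> \<open>Degree bound for the coefficients of \<open>\<Lambda>\<close>. There are m (J +
    1) unknowns and (m - 1) (J + s + 1) equations, since carries raise degrees by at most s; J = s m
    leaves more unknowns than equations.\<close>
  define J where "J = s * m"
  define e0 :: "nat \<Rightarrow> nat" where "e0 = (\<lambda>a\<in>S. 0)"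
  have e0: "e0 \<in> E" using q by (auto simp: E_def e0_def)
  define add where "add e f = (\<lambda>a\<in>S. (e a + f a) mod q)" for e f :: "nat \<Rightarrow> nat"
  have add: "add e f \<in> E" for e f using q by (auto simp: E_def add_def)
  define \<kappa> :: "(nat \<Rightarrow> nat) \<Rightarrow> (nat \<Rightarrow> nat) \<Rightarrow> complex poly" where
    "\<kappa> e f = (\<Prod>a\<in>S. if e a + f a < q then 1 else [:of_nat a, 1:])" for e f
  have deg\<kappa>: "degree (\<kappa> e f) \<le> s" for e f
  proof -
    have "degree (\<kappa> e f) \<le> (\<Sum>a\<in>S. degree (if e a + f a < q then 1 else [:of_nat a, 1:] :: complex poly))"
      unfolding \<kappa>_def using degree_prod_sum_le[OF S] by (simp add: comp_def)
    also have "\<dots> \<le> (\<Sum>a\<in>S. 1)" by (intro sum_mono) auto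
    finally show ?thesis by (simp add: s_def)
  qed
  define M where "M hk fj = (\<Sum>e | e \<in> E \<and> add e (fst fj) = fst hk.
      c e * coeff (monom 1 (snd fj) * \<kappa> e (fst fj)) (snd hk))" for hk fj :: "(nat \<Rightarrow> nat) \<times> nat"
  have "card ((E - {e0}) \<times> {..J + s}) < card (E \<times> {..J})"
  proof -
    have "m \<ge> 1" using q by (simp add: m_def)
    then obtain m' where m': "m = Suc m'" by (cases m) auto
    show ?thesis using e0 finE by (simp add: card_cartesian_product cardE J_def m' algebra_simps)
  qed
  then obtain \<mu> where \<mu>: "\<exists>fj\<in>E \<times> {..J}. \<mu> fj \<noteq> 0"
      "\<forall>hk\<in>(E - {e0}) \<times> {..J + s}. (\<Sum>fj\<in>E \<times> {..J}. M hk fj * \<mu> fj) = 0"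
    using homogeneous_system_kernel[of "(E - {e0}) \<times> {..J + s}" "E \<times> {..J}" M] finE by auto
  define F where "F z = (\<Sum>e\<in>E. c e * rootprod q S e z)" for z
  define \<Lambda> where "\<Lambda> z = (\<Sum>f\<in>E. poly (\<Sum>j\<le>J. monom (\<mu> (f, j)) j) z * rootprod q S f z)" for z
  define Q where "Q h = (\<Sum>fj\<in>E \<times> {..J}. \<Sum>e | e \<in> E \<and> add e (fst fj) = h.
      smult (c e * \<mu> fj) (monom 1 (snd fj) * \<kappa> e (fst fj)))" for h
  have Qcoeff: "coeff (Q h) k = (\<Sum>fj\<in>E \<times> {..J}. M (h, k) fj * \<mu> fj)" for h k
    unfolding Q_def M_def coeff_sum by (simp add: sum_distrib_left sum_distrib_right mult_ac)
  have degQ: "degree (Q h) \<le> J + s" for h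
    unfolding Q_def
  proof (intro degree_sum_le finite_cartesian_product finE)
    fix fj e assume fj: "fj \<in> E \<times> {..J}"
    have "degree (smult (c e * \<mu> fj) (monom 1 (snd fj) * \<kappa> e (fst fj)))
        \<le> degree (monom 1 (snd fj) * \<kappa> e (fst fj) :: complex poly)" by (rule degree_smult_le)
    also have "\<dots> \<le> degree (monom (1::complex) (snd fj)) + degree (\<kappa> e (fst fj))" by (rule degree_mult_le)
    also have "\<dots> \<le> J + s" using fj deg\<kappa>[of e "fst fj"] by (intro add_mono) (auto simp: degree_monom_eq)
    finally show "degree (smult (c e * \<mu> fj) (monom 1 (snd fj) * \<kappa> e (fst fj))) \<le> J + s" .
  qed (use finE in auto)
  have Q0: "Q h = 0" if "h \<in> E" "h \<noteq> e0" for h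
  proof (rule poly_eqI)
    fix k show "coeff (Q h) k = coeff 0 k"
    proof (cases "k \<le> J + s")
      case True then show ?thesis using \<mu>(2) that by (simp add: Qcoeff)
    next
      case False then show ?thesis using degQ[of h] by (simp add: coeff_eq_0)
    qed
  qed
  have prod_eq: "F z * \<Lambda> z = poly (Q e0) z" if z: "Re z > - \<gamma>" for z
  proof -
    have nz: "z + of_nat a \<noteq> 0" if "a \<in> S" for a
    proof -
      have "Re (z + of_nat a) > 0" using z \<gamma>[OF that] by simp
      then show ?thesis by force
    qed
    have mult: "rootprod q S e z * rootprod q S f z = poly (\<kappa> e f) z * rootprod q S (add e f) z"
      if "e \<in> E" "f \<in> E" for e f
    proof -
      have "poly (\<kappa> e f) z = (\<Prod>a\<in>S. if e a + f a < q then 1 else z + of_nat a)"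
        unfolding \<kappa>_def poly_prod by (intro prod.cong) (auto simp: add.commute)
      then show ?thesis using rootprod_mult[OF q that[unfolded E_def] nz] by (simp add: add_def)
    qed
    have "\<Lambda> z = (\<Sum>f\<in>E. \<Sum>j\<le>J. \<mu> (f, j) * z ^ j * rootprod q S f z)"
      by (simp add: \<Lambda>_def poly_sum poly_monom sum_distrib_right)
    also have "\<dots> = (\<Sum>fj\<in>E \<times> {..J}. \<mu> fj * z ^ snd fj * rootprod q S (fst fj) z)"
      by (simp add: sum.cartesian_product case_prod_unfold)
    finally have "F z * \<Lambda> z = (\<Sum>fj\<in>E \<times> {..J}. \<Sum>e\<in>E.
        c e * rootprod q S e z * (\<mu> fj * z ^ snd fj * rootprod q S (fst fj) z))"
      by (simp add: F_def sum_distrib_left sum_distrib_right)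
    also have "\<dots> = (\<Sum>fj\<in>E \<times> {..J}. \<Sum>e\<in>E. c e * \<mu> fj * z ^ snd fj * poly (\<kappa> e (fst fj)) z *
        rootprod q S (add e (fst fj)) z)"
    proof (intro sum.cong refl)
      fix fj e assume "fj \<in> E \<times> {..J}" "e \<in> E"
      then have "rootprod q S e z * rootprod q S (fst fj) z =
          poly (\<kappa> e (fst fj)) z * rootprod q S (add e (fst fj)) z" by (intro mult) auto
      then show "c e * rootprod q S e z * (\<mu> fj * z ^ snd fj * rootprod q S (fst fj) z) =
          c e * \<mu> fj * z ^ snd fj * poly (\<kappa> e (fst fj)) z * rootprod q S (add e (fst fj)) z"
        by (simp add: mult_ac)
    qed
    also have "\<dots> = (\<Sum>fj\<in>E \<times> {..J}. \<Sum>h\<in>E. \<Sum>e | e \<in> E \<and> add e (fst fj) = h.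
        c e * \<mu> fj * z ^ snd fj * poly (\<kappa> e (fst fj)) z * rootprod q S (add e (fst fj)) z)"
      by (intro sum.cong refl sum.group[symmetric] finE) (use add in auto)
    also have "\<dots> = (\<Sum>h\<in>E. poly (Q h) z * rootprod q S h z)"
      by (subst sum.swap) (simp add: Q_def poly_sum poly_monom sum_distrib_left sum_distrib_right mult_ac)
    also have "\<dots> = (\<Sum>h\<in>{e0}. poly (Q h) z * rootprod q S h z)"
      using Q0 e0 finE by (intro sum.mono_neutral_right) auto
    also have "\<dots> = poly (Q e0) z"
    proof -
      have "rootprod q S e0 z = 1" using nz by (simp add: rootprod_def e0_def)
      then show ?thesis by simp
    qed
    finally show ?thesis .
  qed
  have F_hol: "F holomorphic_on {z. Re z > - \<gamma>}" and \<Lambda>_hol: "\<Lambda> holomorphic_on {z. Re z > - \<gamma>}"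
    unfolding F_def \<Lambda>_def by (intro holomorphic_intros rootprod_holomorphic \<gamma>; assumption)+
  \<comment> \<open>Otherwise \<open>F\<close> times \<open>\<Lambda>\<close> is zero. By
    independence \<open>F\<close> is nonzero at some real point, hence near it, so
    \<open>\<Lambda>\<close> vanishes on an interval, and independence again makes all of
    \<open>\<mu>\<close> zero.\<close>
  have "Q e0 \<noteq> 0"
  proof
    assume "Q e0 = 0"
    then have FL: "F z * \<Lambda> z = 0" if "Re z > - \<gamma>" for z using prod_eq[OF that] by simp
    have "\<exists>x0>- \<gamma>. F (of_real x0) \<noteq> 0"
    proof (rule ccontr)
      assume "\<not> (\<exists>x0>- \<gamma>. F (of_real x0) \<noteq> 0)"
      then have "F (of_real x) = 0" if "x > - \<gamma>" for x using that by blast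
      then have "[:c e:] = 0" if "e \<in> E" for e
        by (intro rootprod_independent[OF S q, of "- \<gamma>" "\<lambda>e. [:c e:]"]) (use that in \<open>auto simp: F_def E_def\<close>)
      then show False using c by (auto simp: E_def)
    qed
    then obtain x0 where x0: "x0 > - \<gamma>" "F (of_real x0) \<noteq> 0" by blast
    have "continuous_on {z. Re z > - \<gamma>} F" using F_hol by (rule holomorphic_on_imp_continuous_on)
    then have "isCont F (of_real x0)"
      using x0(1) by (simp add: continuous_on_eq_continuous_at[OF open_halfspace_Re_gt])
    then have "isCont (\<lambda>x. F (of_real x)) x0"
      by (intro isCont_o2[where f=complex_of_real and g=F]) (auto intro!: continuous_intros)
    then obtain \<delta> where \<delta>: "\<delta> > 0" "\<And>x. dist x x0 < \<delta> \<Longrightarrow> F (of_real x) \<noteq> 0"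
      using x0(2) continuous_at_avoid[of x0 "\<lambda>x. F (of_real x)" 0] by (auto simp: dist_commute)
    have "\<Lambda> (of_real x) = 0" if x: "x > - \<gamma>" for x
    proof (rule vanish_halfplane[OF \<Lambda>_hol, of x0 "x0 + \<delta>"])
      fix y assume "x0 < y" "y < x0 + \<delta>"
      then show "\<Lambda> (of_real y) = 0" using FL[of "of_real y"] \<delta>(2)[of y] x0(1) by (auto simp: dist_real_def)
    qed (use x x0 \<delta> in auto)
    then have 0: "(\<Sum>j\<le>J. monom (\<mu> (f, j)) j) = 0" if "f \<in> E" for f
      by (intro rootprod_independent[OF S q, of "- \<gamma>" "\<lambda>f. \<Sum>j\<le>J. monom (\<mu> (f, j)) j"])
        (use that in \<open>auto simp: \<Lambda>_def E_def\<close>)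
    have "\<mu> (f, j) = 0" if "f \<in> E" "j \<le> J" for f j
    proof -
      have "coeff (\<Sum>j\<le>J. monom (\<mu> (f, j)) j) j = \<mu> (f, j)" using that by (simp add: coeff_sum coeff_monom)
      then show ?thesis using 0[OF that(1)] by simp
    qed
    then show False using \<mu>(1) by auto
  qed
  then have fin: "finite {z. poly (Q e0) z = 0}" by (rule poly_roots_finite)
  have sub: "complex_of_real ` Z \<subseteq> {z. poly (Q e0) z = 0}"
  proof
    fix z assume "z \<in> complex_of_real ` Z"
    then obtain x where x: "x \<in> Z" "z = of_real x" by auto
    have "F z = 0" using Z(2)[OF x(1)] by (simp add: F_def E_def x)
    then show "z \<in> {z. poly (Q e0) z = 0}" using prod_eq[of z] Z(1)[OF x(1)] x by simp
  qed
  have inj: "inj_on complex_of_real Z" by (auto simp: inj_on_def)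
  have "finite Z" using finite_subset[OF sub fin] inj by (simp add: finite_image_iff)
  moreover have "card Z \<le> card {z. poly (Q e0) z = 0}"
    using card_mono[OF fin sub] card_image[OF inj] by simp
  moreover have "\<dots> \<le> degree (Q e0)" using \<open>Q e0 \<noteq> 0\<close> by (rule card_poly_roots_bound)
  moreover have "\<dots> \<le> card S * q ^ card S + card S" using degQ[of e0] by (simp add: J_def m_def s_def)
  ultimately show ?thesis by linarith
qed

section \<open>Sumsets of perfect powers\<close>

text \<open>A combination \<open>F\<close> with small integer coefficients is made to vanish at half
  as many points of \<open>B\<close> as there are functions. These zeros force |F| < 1 at every
  point of \<open>B\<close>, where \<open>F\<close> is an integer; so \<open>F\<close> vanishes on
  all of \<open>B\<close>, and \<open>rootprod_zeros_bound\<close> limits the number of its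
  zeros.\<close>

lemma power_shifts_short_interval:
  fixes S B :: "nat set" and T :: real
  assumes S: "finite S" "S \<noteq> {}" and q: "q > 0"
    and pow: "\<And>a b. a \<in> S \<Longrightarrow> b \<in> B \<Longrightarrow> \<exists>x>0. a + b = x ^ q"
    and N: "\<And>a b. a \<in> S \<Longrightarrow> b \<in> B \<Longrightarrow> a + b \<le> N"
    and T: "T > 0" "\<And>b. b \<in> B \<Longrightarrow> T \<le> real (b + Min S)" "\<And>b. b \<in> B \<Longrightarrow> real (b + Min S) \<le> T + T / 14"
    and big: "2 * real (q ^ card S) ^ 2 * (2 * real N) ^ (2 * card S) < 3 ^ (q ^ card S div 2)"
  shows "card B \<le> card S * q ^ card S + card S"
proof (cases "B = {}")
  case False
  define E where "E = residue_exps q S"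
  define s where "s = card S"
  define m where "m = q ^ s"
  define K where "K = m div 2"
  define \<alpha> where "\<alpha> = Min S"
  have \<alpha>: "\<alpha> \<in> S" "\<And>a. a \<in> S \<Longrightarrow> \<alpha> \<le> a" using S by (auto simp: \<alpha>_def)
  have finB: "finite B"
    using N[OF \<alpha>(1)] by (intro finite_subset[of B "{..N}"]) force+
  have s1: "s \<ge> 1" using S by (simp add: s_def Suc_le_eq card_gt_0_iff)
  have m1: "m \<ge> 1" using q by (simp add: m_def)
  have finE: "finite E" by (simp add: E_def finite_PiE S)
  have cardE: "card E = m" by (simp add: E_def card_PiE S m_def s_def)
  define x where "x a b = (SOME x. x > 0 \<and> a + b = x ^ q)" for a b :: nat
  have x: "x a b > 0 \<and> a + b = x a b ^ q" if "a \<in> S" "b \<in> B" for a b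
    unfolding x_def using pow[OF that] by (rule someI_ex)
  define g where "g e b = (\<Prod>a\<in>S. x a b ^ e a)" for e b
  have g: "rootprod q S e (of_real (real b)) = of_nat (g e b)" if "b \<in> B" for e b
    unfolding rootprod_def g_def of_nat_prod
  proof (rule prod.cong)
    fix a assume a: "a \<in> S"
    have "of_real (real b) + of_nat a = complex_of_real (real (x a b ^ q))"
      using x[OF a that] by (metis add.commute of_nat_add of_real_of_nat_eq)
    also have "\<dots> powr (of_real (real (e a) / real q))
        = complex_of_real (real (x a b ^ q) powr (real (e a) / real q))"
      by (rule powr_of_real) simp
    also have "real (x a b ^ q) powr (real (e a) / real q) = real (x a b ^ e a)"
      using x[OF a that] q by (simp add: powr_realpow[symmetric] powr_powr)
    finally show "(complex_of_real (real b) + of_nat a) powr (of_nat (e a) / of_nat q) = of_nat (x a b ^ e a)"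
      by simp
  qed simp
  have N1: "N \<ge> 1"
  proof -
    obtain b where "b \<in> B" using False by auto
    then have "0 < x \<alpha> b ^ q" "x \<alpha> b ^ q \<le> N"
      using x[OF \<alpha>(1), of b] N[OF \<alpha>(1), of b] by auto
    then show ?thesis by linarith
  qed
  have gN: "g e b \<le> N ^ s" if e: "e \<in> E" and b: "b \<in> B" for e b
  proof -
    have "g e b \<le> (\<Prod>a\<in>S. N)" unfolding g_def
    proof (rule prod_mono)
      fix a assume a: "a \<in> S"
      have "e a \<le> q" using e a by (auto simp: E_def PiE_def Pi_def intro: less_imp_le)
      then have "x a b ^ e a \<le> x a b ^ q" using x[OF a b] by (intro power_increasing) auto
      also have "\<dots> \<le> N" using N[OF a b] x[OF a b] by simp
      finally show "0 \<le> x a b ^ e a \<and> x a b ^ e a \<le> N" by simp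
    qed
    then show ?thesis by (simp add: s_def)
  qed
  show ?thesis
  proof (cases "card B < K")
    case True
    have "K \<le> s * m" using s1 by (simp add: K_def) (metis One_nat_def div_le_dividend le_trans mult_le_mono1 nat_mult_1)
    then show ?thesis using True by (simp add: s_def m_def)
  next
    case False
    then obtain Z where Z: "Z \<subseteq> B" "card Z = K" using obtain_subset_with_card_n[of K B] by auto
    have finZ: "finite Z" using Z finB finite_subset by blast
    define G where "G = N ^ s"
    \<comment> \<open>This choice gives 2 m H G = H^2, so that the pigeonhole condition becomes (H^2
      + 1)^K < (H + 1)^(2 K), with 2 K \<le> m.\<close>
    define H where "H = 2 * m * G"
    have big': "2 * real m ^ 2 * (2 * real N) ^ (2 * s) < 3 ^ K"
      using big by (simp add: m_def s_def K_def)
    have K1: "K \<ge> 1"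
    proof (rule ccontr)
      assume "\<not> K \<ge> 1"
      then have "K = 0" by simp
      then have "2 * real m ^ 2 * (2 * real N) ^ (2 * s) < 1" using big' by (simp only: power_0)
      moreover have "1 \<le> real m ^ 2" "1 \<le> (2 * real N) ^ (2 * s)"
        using m1 N1 by (intro one_le_power; simp)+
      then have "1 \<le> real m ^ 2 * (2 * real N) ^ (2 * s)" using mult_mono[of 1 "real m ^ 2" 1 "(2 * real N) ^ (2 * s)"] by simp
      ultimately show False by linarith
    qed
    have "(2 * m * H * G + 1) ^ K = (H * H + 1) ^ K" by (simp add: H_def mult_ac)
    also have "\<dots> < ((H + 1) * (H + 1)) ^ K"
      using K1 m1 N1 by (intro power_strict_mono) (auto simp: H_def G_def)
    also have "\<dots> = (H + 1) ^ (2 * K)" by (simp only: power_mult_distrib power_add mult_2)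
    also have "\<dots> \<le> (H + 1) ^ m" by (intro power_increasing) (auto simp: K_def)
    finally have pigeon: "(2 * card E * H * G + 1) ^ card Z < (H + 1) ^ card E"
      by (simp only: cardE Z(2))
    have bound: "\<bar>int (g e b)\<bar> \<le> int G" if "b \<in> Z" "e \<in> E" for b e
      using gN[OF that(2)] that Z by (auto simp: G_def simp flip: of_nat_power)
    have "\<exists>c. (\<exists>e\<in>E. c e \<noteq> 0) \<and> (\<forall>e\<in>E. \<bar>c e\<bar> \<le> int H) \<and>
        (\<forall>b\<in>Z. (\<Sum>e\<in>E. int (g e b) * c e) = 0)"
    proof (rule siegel_lemma[where G=G])
      show "\<bar>int (g e b)\<bar> \<le> int G" if "b \<in> Z" "e \<in> E" for b e using that by (rule bound)
      show "(2 * card E * H * G + 1) ^ card Z < (H + 1) ^ card E" by (rule pigeon)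
    qed (fact finZ finE)+
    then obtain c where c': "(\<exists>e\<in>E. c e \<noteq> 0) \<and> (\<forall>e\<in>E. \<bar>c e\<bar> \<le> int H) \<and>
        (\<forall>b\<in>Z. (\<Sum>e\<in>E. int (g e b) * c e) = 0)" by (rule exE)
    note c = c'[THEN conjunct1] c'[THEN conjunct2, THEN conjunct1] c'[THEN conjunct2, THEN conjunct2]
    define F where "F z = (\<Sum>e\<in>E. of_int (c e) * rootprod q S e z)" for z
    have Fint: "F (of_real (real b)) = of_int (\<Sum>e\<in>E. int (g e b) * c e)" if "b \<in> B" for b
      unfolding F_def using g[OF that] by (simp add: mult.commute)
    have F_hol: "F holomorphic_on {z. Re z > - real \<alpha>}"
      unfolding F_def using \<alpha>(2) by (intro holomorphic_intros rootprod_holomorphic) auto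
    \<comment> \<open>The points of \<open>B\<close> lie within T/14 of \<open>z0\<close>, and the
      disc of radius T/2 still avoids every branch point. The factor per zero is then (T/7) / (3
      T/7) = 1/3, whence the power of 3 in \<open>big\<close>.\<close>
    define z0 where "z0 = complex_of_real (T - real \<alpha>)"
    have "card (complex_of_real ` real ` Z) = card (real ` Z)" by (intro card_image) (auto simp: inj_on_def)
    also have "\<dots> = card Z" by (intro card_image) (auto simp: inj_on_def)
    finally have cardZ: "card (complex_of_real ` real ` Z) = K" by (simp only: Z(2))
    have F_small: "norm (F (of_real (real b))) < 1" if b: "b \<in> B" for b
    proof -
      have TN: "T \<le> real N" using T(2)[OF b] N[OF \<alpha>(1) b] by (simp add: \<alpha>_def)
      have "norm (F (of_real (real b))) \<le> (real m * (real H * (2 * real N) ^ s))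
          * (2 * (T / 14) / (T / 2 - T / 14)) ^ card (of_real ` real ` Z :: complex set)"
      proof (rule schwarz_many_zeros[OF _ open_halfspace_Re_gt _ F_hol, where \<rho>="T/2"])
        show "cball z0 (T / 2) \<subseteq> {z. - real \<alpha> < Re z}"
        proof
          fix z assume "z \<in> cball z0 (T / 2)"
          then have "norm (z0 - z) \<le> T / 2" by (simp add: dist_norm)
          then have "Re (z0 - z) \<le> T / 2" using complex_Re_le_cmod[of "z0 - z"] by linarith
          then show "z \<in> {z. - real \<alpha> < Re z}" using T(1) by (simp add: z0_def)
        qed
        have near: "of_real (real b) \<in> cball z0 (T / 14)" if "b \<in> B" for b
        proof -
          have "dist z0 (of_real (real b)) = \<bar>T - real \<alpha> - real b\<bar>"
            unfolding z0_def dist_of_real by (simp add: dist_real_def)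
          then show ?thesis using T(2,3)[OF that] by (simp add: \<alpha>_def abs_le_iff)
        qed
        then show "of_real ` real ` Z \<subseteq> cball z0 (T / 14)" using Z by auto
        show "of_real (real b) \<in> cball z0 (T / 14)" using near b by blast
        show "F z = 0" if z: "z \<in> of_real ` real ` Z" for z
        proof -
          obtain b' where b': "b' \<in> Z" "z = of_real (real b')" using z by auto
          then have "b' \<in> B" using Z by blast
          show ?thesis unfolding b'(2) Fint[OF \<open>b' \<in> B\<close>] bspec[OF c(3) b'(1)] by (rule of_int_0)
        qed
        fix z assume z: "z \<in> sphere z0 (T / 2)"
        have "norm (F z) \<le> (\<Sum>e\<in>E. norm (of_int (c e) * rootprod q S e z))"
          unfolding F_def by (rule norm_sum)
        also have "\<dots> \<le> (\<Sum>e\<in>E. real H * (2 * real N) ^ s)"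
        proof (rule sum_mono)
          fix e assume e: "e \<in> E"
          have "norm (rootprod q S e z) \<le> (\<Prod>a\<in>S. 2 * real N)"
            unfolding rootprod_def prod_norm[symmetric]
          proof (rule prod_mono)
            fix a assume a: "a \<in> S"
            have "e a < q" using e a by (auto simp: E_def)
            have "norm (z + of_nat a) \<le> norm (z - z0) + norm (z0 + of_nat a)"
              using norm_triangle_ineq[of "z - z0" "z0 + of_nat a"] by simp
            also have "norm (z - z0) = T / 2" using z by (simp add: dist_norm norm_minus_commute)
            also have "norm (z0 + of_nat a) = \<bar>T - real \<alpha> + real a\<bar>"
              unfolding z0_def by (metis norm_of_real of_real_add of_real_of_nat_eq)
            also have "\<bar>T - real \<alpha> + real a\<bar> \<le> real N"
              using T(1) T(2)[OF b] N[OF a b] \<alpha>(2)[OF a] by (simp add: \<alpha>_def)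
            also have "T / 2 + real N \<le> 2 * real N" using TN N1 by simp
            finally have le: "norm (z + of_nat a) \<le> 2 * real N" by simp
            have "norm ((z + of_nat a) powr (of_real (real (e a) / real q)))
                = norm (z + of_nat a) powr (real (e a) / real q)"
              by (subst norm_powr_real_powr') auto
            also have "\<dots> \<le> (2 * real N) powr (real (e a) / real q)"
              by (intro powr_mono2) (use le in auto)
            also have "\<dots> \<le> (2 * real N) powr 1"
              using \<open>e a < q\<close> N1 by (intro powr_mono) auto
            finally show "0 \<le> norm ((z + of_nat a) powr (of_nat (e a) / of_nat q)) \<and>
                norm ((z + of_nat a) powr (of_nat (e a) / of_nat q)) \<le> 2 * real N"
              using N1 by simp
          qed
          moreover have "\<bar>real_of_int (c e)\<bar> \<le> real H" using bspec[OF c(2) e] by linarith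
          ultimately show "norm (of_int (c e) * rootprod q S e z) \<le> real H * (2 * real N) ^ s"
            unfolding norm_mult by (intro mult_mono) (auto simp: s_def)
        qed
        also have "\<dots> = real m * (real H * (2 * real N) ^ s)" by (simp add: cardE)
        finally show "norm (F z) \<le> real m * (real H * (2 * real N) ^ s)" .
      qed (use finZ T(1) in auto)
      moreover have ratio: "2 * (T / 14) / (T / 2 - T / 14) = 1 / 3" using T(1) by (simp add: field_simps)
      ultimately have "norm (F (of_real (real b))) \<le> (real m * (real H * (2 * real N) ^ s)) * (1 / 3) ^ K"
        by (simp only: ratio cardZ)
      also have "\<dots> = 2 * real m ^ 2 * (real N ^ s * (2 * real N) ^ s) / 3 ^ K"
      proof -
        have e: "x * ((2 * x * y) * z) * (1 / 3) ^ K = 2 * x ^ 2 * (y * z) / 3 ^ K" for x y z :: real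
          unfolding power_one_over by (simp add: power2_eq_square)
        have H': "real H = 2 * real m * real N ^ s" by (simp add: H_def G_def)
        show ?thesis unfolding H' by (rule e)
      qed
      also have "\<dots> \<le> 2 * real m ^ 2 * (2 * real N) ^ (2 * s) / 3 ^ K"
      proof -
        have "real N ^ s \<le> (2 * real N) ^ s" by (intro power_mono) auto
        then have "real N ^ s * (2 * real N) ^ s \<le> (2 * real N) ^ s * (2 * real N) ^ s"
          by (intro mult_right_mono) auto
        also have "\<dots> = (2 * real N) ^ (2 * s)" by (simp only: mult_2[of s] power_add)
        finally show ?thesis by (intro divide_right_mono mult_left_mono) auto
      qed
      also have "\<dots> < 1" using big' by (simp only: divide_less_eq_1_pos zero_less_power zero_less_numeral)
      finally show ?thesis .
    qed
    have F0: "F (of_real (real b)) = 0" if "b \<in> B" for b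
    proof -
      have "\<bar>real_of_int (\<Sum>e\<in>E. int (g e b) * c e)\<bar> < 1"
        using F_small[OF that] unfolding Fint[OF that] norm_of_int .
      then have "(\<Sum>e\<in>E. int (g e b) * c e) = 0" by linarith
      then show ?thesis unfolding Fint[OF that] by (simp only: of_int_0)
    qed
    have "card (real ` B) \<le> card S * q ^ card S + card S"
    proof (rule rootprod_zeros_bound[THEN conjunct2])
      show "finite S" by fact
      show "q > 0" by fact
      show "\<exists>e\<in>residue_exps q S. complex_of_int (c e) \<noteq> 0" using c(1) by (auto simp: E_def)
      show "real \<alpha> \<le> real a" if "a \<in> S" for a using \<alpha>(2)[OF that] by simp
      fix y assume "y \<in> real ` B"
      then obtain b where b: "b \<in> B" "y = real b" by auto
      show "- real \<alpha> < y" using T(1) T(2)[OF b(1)] b(2) by (simp add: \<alpha>_def)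
      show "(\<Sum>e\<in>residue_exps q S. complex_of_int (c e) * rootprod q S e (complex_of_real y)) = 0"
        using F0[OF b(1)] b(2) by (simp add: F_def E_def)
    qed
    then show ?thesis by (simp add: card_image inj_on_def)
  qed
qed simp

text \<open>The range 1..N is covered by intervals from T to 15 T/14 with T a power of 15/14. As ln
  (15/14) \<ge> 1/15, at most 15 ln N + 1 of them are needed.\<close>

lemma power_shifts_bound:
  fixes S B :: "nat set"
  assumes S: "finite S" "S \<noteq> {}" and q: "q > 0"
    and pow: "\<And>a b. a \<in> S \<Longrightarrow> b \<in> B \<Longrightarrow> \<exists>x>0. a + b = x ^ q"
    and N: "\<And>a b. a \<in> S \<Longrightarrow> b \<in> B \<Longrightarrow> a + b \<le> N"
    and big: "2 * real (q ^ card S) ^ 2 * (2 * real N) ^ (2 * card S) < 3 ^ (q ^ card S div 2)"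
  shows "real (card B) \<le> (15 * ln (real N) + 1) * real (card S * q ^ card S + card S)"
proof (cases "B = {}")
  case False
  define \<alpha> where "\<alpha> = Min S"
  have \<alpha>: "\<alpha> \<in> S" using S by (auto simp: \<alpha>_def)
  have rng: "1 \<le> b + \<alpha>" "b + \<alpha> \<le> N" if b: "b \<in> B" for b
  proof -
    obtain x where "x > 0" "\<alpha> + b = x ^ q" using pow[OF \<alpha> b] by blast
    then have "\<alpha> + b > 0" by simp
    then show "1 \<le> b + \<alpha>" "b + \<alpha> \<le> N" using N[OF \<alpha> b] by linarith+
  qed
  obtain b0 where "b0 \<in> B" using False by auto
  then have N1: "N \<ge> 1" using rng[of b0] by linarith
  define i where "i b = nat \<lfloor>log (15/14) (real (b + \<alpha>))\<rfloor>" for b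
  define n where "n = nat \<lfloor>log (15/14) (real N)\<rfloor>"
  define Z where "Z = card S * q ^ card S + card S"
  have i: "(15/14) ^ i b \<le> real (b + \<alpha>)" "real (b + \<alpha>) \<le> (15/14) ^ i b + (15/14) ^ i b / 14" "i b \<le> n"
    if "b \<in> B" for b
  proof -
    define l where "l = log (15/14) (real (b + \<alpha>))"
    have pos: "real (b + \<alpha>) \<ge> 1" using rng(1)[OF that] by linarith
    have l0: "l \<ge> 0" unfolding l_def using pos by simp
    have e: "real (b + \<alpha>) = (15/14) powr l" unfolding l_def using pos by simp
    have il: "real (i b) \<le> l" "l \<le> real (i b) + 1" using l0 unfolding i_def l_def[symmetric] by linarith+
    have "(15/14::real) ^ i b = (15/14) powr real (i b)" by (simp add: powr_realpow)
    also have "\<dots> \<le> (15/14) powr l" using il by (intro powr_mono) auto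
    finally show "(15/14) ^ i b \<le> real (b + \<alpha>)" by (simp only: e)
    have "(15/14) powr l \<le> (15/14::real) powr (real (i b) + 1)" using il by (intro powr_mono) auto
    also have "\<dots> = (15/14) ^ i b + (15/14) ^ i b / 14" by (simp add: powr_add powr_realpow)
    finally show "real (b + \<alpha>) \<le> (15/14) ^ i b + (15/14) ^ i b / 14" by (simp only: e)
    have "l \<le> log (15/14) (real N)" unfolding l_def using pos rng(2)[OF that] by simp
    then show "i b \<le> n" unfolding i_def n_def l_def[symmetric] by (intro nat_mono floor_mono)
  qed
  have "card {b \<in> B. i b = k} \<le> Z" for k
    unfolding Z_def
    by (rule power_shifts_short_interval[OF S q pow N, where T="(15/14) ^ k"])
      (use big i in \<open>auto simp: \<alpha>_def\<close>)
  moreover have "B = (\<Union>k\<le>n. {b \<in> B. i b = k})" using i by auto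
  then have "card B \<le> (\<Sum>k\<le>n. card {b \<in> B. i b = k})"
    by (metis card_UN_le finite_atMost)
  ultimately have "card B \<le> (\<Sum>k\<le>n. Z)" by (meson order_trans sum_mono)
  then have "card B \<le> (n + 1) * Z" by simp
  then have "real (card B) \<le> real ((n + 1) * Z)" by (rule of_nat_mono)
  also have "\<dots> \<le> (15 * ln (real N) + 1) * real Z"
  proof -
    have "ln (15/14) \<ge> (1/15::real)"
      using ln_le_minus_one[of "14/15::real"] by (simp add: ln_div)
    then have "log (15/14) (real N) \<le> ln (real N) / (1/15)"
      unfolding log_def using N1 by (intro divide_left_mono) auto
    moreover have "real n \<le> log (15/14) (real N)" unfolding n_def using N1 by simp
    ultimately have "real n + 1 \<le> 15 * ln (real N) + 1" by simp
    then show ?thesis by (simp only: of_nat_mult of_nat_add of_nat_1) (intro mult_right_mono, auto)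
  qed
  finally show ?thesis by (simp add: Z_def)
next
  case True
  then show ?thesis by (cases "N = 0") auto
qed

text \<open>Greedy choice: by averaging, some a not yet chosen is related to a proportion \<rho> of
  the surviving b. The surplus \<open>s\<close> in the degree hypothesis makes up for the fewer than
  s elements already chosen.\<close>

lemma common_neighbours:
  fixes R :: "'a \<Rightarrow> 'b \<Rightarrow> bool" and \<rho> :: real
  assumes A: "finite A" "A \<noteq> {}" and W: "finite W" "W \<noteq> {}"
    and deg: "\<And>b. b \<in> W \<Longrightarrow> \<rho> * card A + s \<le> card {a \<in> A. R a b}" and \<rho>: "\<rho> > 0"
  shows "\<exists>S\<subseteq>A. card S = s \<and> \<rho> ^ s * card W \<le> card {b \<in> W. \<forall>a\<in>S. R a b}"
proof -
  have "\<exists>S\<subseteq>A. card S = i \<and> \<rho> ^ i * card W \<le> card {b \<in> W. \<forall>a\<in>S. R a b}" if "i \<le> s" for i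
    using that
  proof (induction i)
    case 0
    then show ?case by (intro exI[of _ "{}"]) auto
  next
    case (Suc i)
    then obtain S where S: "S \<subseteq> A" "card S = i" "\<rho> ^ i * card W \<le> card {b \<in> W. \<forall>a\<in>S. R a b}" by auto
    define V where "V = {b \<in> W. \<forall>a\<in>S. R a b}"
    have finV: "finite V" using W by (simp add: V_def)
    have finS: "finite S" using S A finite_subset by blast
    have "\<exists>a\<in>A - S. \<rho> * card V \<le> card {b \<in> V. R a b}"
    proof (rule ccontr)
      assume "\<not> ?thesis"
      then have less: "real (card {b \<in> V. R a b}) < \<rho> * card V" if "a \<in> A - S" for a using that by force
      have ge: "\<rho> * card A \<le> card {a \<in> A - S. R a b}" if "b \<in> V" for b
      proof -
        have "{a \<in> A. R a b} \<subseteq> {a \<in> A - S. R a b} \<union> S" by auto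
        then have "card {a \<in> A. R a b} \<le> card ({a \<in> A - S. R a b} \<union> S)"
          using A finS by (intro card_mono) auto
        also have "\<dots> \<le> card {a \<in> A - S. R a b} + card S" by (rule card_Un_le)
        finally have "card {a \<in> A. R a b} \<le> card {a \<in> A - S. R a b} + s" using S Suc.prems by simp
        then show ?thesis using deg[of b] that by (simp add: V_def)
      qed
      have swap: "(\<Sum>a\<in>A - S. card {b \<in> V. R a b}) = (\<Sum>b\<in>V. card {a \<in> A - S. R a b})"
        using A finV by (intro sum_multicount_gen) auto
      obtain b0 where "b0 \<in> W" using \<open>W \<noteq> {}\<close> by auto
      have "card S < card A"
      proof -
        have "card {a \<in> A. R a b0} \<le> card A" using A by (intro card_mono) auto
        then have "\<rho> * card A + s \<le> card A" using deg[OF \<open>b0 \<in> W\<close>] by linarith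
        moreover have "\<rho> * card A > 0" using \<rho> A by (simp add: card_gt_0_iff)
        ultimately show ?thesis using S Suc.prems by linarith
      qed
      then have ne: "A - S \<noteq> {}" using S finS by (metis Diff_eq_empty_iff card_mono not_less)
      have "(\<Sum>b\<in>V. \<rho> * card A) \<le> (\<Sum>b\<in>V. real (card {a \<in> A - S. R a b}))" using ge by (intro sum_mono)
      also have "\<dots> = (\<Sum>a\<in>A - S. real (card {b \<in> V. R a b}))" using swap by (metis (no_types) of_nat_sum)
      also have "\<dots> < (\<Sum>a\<in>A - S. \<rho> * card V)" using less ne A by (intro sum_strict_mono) auto
      also have "\<dots> \<le> card A * (\<rho> * card V)"
        using A \<rho> by (auto intro!: mult_right_mono card_mono)
      finally show False by (simp add: mult_ac)
    qed
    then obtain a where a: "a \<in> A - S" "\<rho> * card V \<le> card {b \<in> V. R a b}" by blast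
    have "{b \<in> V. R a b} = {b \<in> W. \<forall>a'\<in>insert a S. R a' b}" by (auto simp: V_def)
    moreover have "\<rho> ^ Suc i * card W \<le> \<rho> * card V" using S(3) \<rho> by (simp add: V_def mult_ac)
    ultimately show ?case
      using a S finS by (intro exI[of _ "insert a S"]) auto
  qed
  then show ?thesis by auto
qed

section \<open>Prime exponents and the size of the auxiliary parameters\<close>

lemma ln2_ge_half: "ln (2::real) \<ge> 1/2"
  using ln_le_minus_one[of "1/2::real"] by (simp add: ln_div)

text \<open>The number 1 is a power with every exponent; fixing 2 for it keeps the exponent bounded
  in terms of N in that case as well.\<close>

lemma perfect_power_prime_exponent:
  assumes "y \<in> perfect_powers"
  obtains q x where "prime (q::nat)" "x > 0" "y = x ^ q" "y = 1 \<Longrightarrow> q = 2"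
proof -
  obtain x m where xm: "y = x ^ m" "x > 0" "m \<ge> 2" using assms by (auto simp: perfect_powers_def)
  show thesis
  proof (cases "y = 1")
    case True
    then show thesis using that[of 2 1] by auto
  next
    case False
    obtain q where q: "prime q" "q dvd m" using prime_factor_nat[of m] xm(3) by auto
    then obtain k where "m = q * k" by blast
    then have "y = (x ^ k) ^ q" using xm by (simp add: power_mult[symmetric] mult.commute)
    then show thesis using that[of q "x ^ k"] q xm False by auto
  qed
qed

lemma perfect_power_exponent_le:
  assumes "y \<in> perfect_powers" "y \<le> N" "N \<ge> 16"
  obtains q x where "prime (q::nat)" "x > 0" "y = x ^ q" "real q \<le> 2 * ln (real N)"
proof -
  obtain q x where qx: "prime q" "x > 0" "y = x ^ q" "y = 1 \<Longrightarrow> q = 2"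
    using perfect_power_prime_exponent[OF assms(1)] by metis
  have N: "ln (real N) > 0" using assms(3) by simp
  have "real q \<le> 2 * ln (real N)"
  proof (cases "y = 1")
    case True
    have "ln (16::real) = 4 * ln 2" using ln_realpow[of 2 4] by simp
    moreover have "ln (16::real) \<le> ln (real N)" using assms(3) by simp
    ultimately have "2 \<le> 2 * ln (real N)" using ln2_ge_half by linarith
    then show ?thesis using qx(4) True by simp
  next
    case False
    then have "x \<ge> 2" using qx(2,3) by (cases "x = 1") auto
    then have "2 ^ q \<le> x ^ q" by (intro power_mono) auto
    also have "\<dots> \<le> N" using qx assms by simp
    finally have "real (2 ^ q) \<le> real N" by (rule of_nat_mono)
    then have "ln (2 ^ q) \<le> ln (real N)" by (subst ln_le_cancel_iff) (use assms in auto)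
    then have "real q * ln 2 \<le> ln (real N)" by (simp add: ln_realpow)
    moreover have "real q * (1/2) \<le> real q * ln 2" using ln2_ge_half by (intro mult_left_mono) auto
    ultimately show ?thesis by simp
  qed
  then show thesis using that qx by blast
qed

lemma sum_inverse_squares_le:
  assumes "1 \<le> y" "y \<le> M"
  shows "(\<Sum>q=y+1..M. 1 / (real q)\<^sup>2) \<le> 1 / real y - 1 / real M"
  using assms(2)
proof (induction M rule: dec_induct)
  case (step M)
  have "1 / (real (Suc M))\<^sup>2 \<le> 1 / (real M * real (Suc M))"
    using step assms by (intro divide_left_mono) (auto simp: power2_eq_square intro!: mult_right_mono)
  also have "\<dots> = 1 / real M - 1 / real (Suc M)" using step assms by (simp add: divide_simps)
  finally show ?case using step by simp
qed simp

text \<open>Supplies \<open>big\<close> of \<open>power_shifts_bound\<close>. As s \<le> 2 ln m, the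
  logarithm of the left side is at most 11 ln N ln m. With r = m^(1/4) one has ln m \<le> 4 r and,
  because 141^2 \<le> 20000, also 141 ln N \<le> r^2; so a multiple of r^3 competes with
  r^4.\<close>

lemma determinant_condition:
  fixes m s N :: nat
  assumes N: "N \<ge> 16" and m: "real m \<ge> 20000 * (ln (real N))\<^sup>2" and s: "2 ^ s \<le> m"
  shows "2 * real m ^ 2 * (2 * real N) ^ (2 * s) < 3 ^ (m div 2)"
proof -
  define l where "l = ln (real N)"
  have "ln (16::real) = 4 * ln 2" using ln_realpow[of 2 4] by simp
  moreover have "ln (16::real) \<le> l" using N by (simp add: l_def)
  ultimately have l: "l \<ge> 2" using ln2_ge_half by linarith
  have l2: "l\<^sup>2 \<ge> 2\<^sup>2" using l by (intro power_mono) auto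
  have mbig: "real m \<ge> 80000" using m l2 by (simp add: l_def)
  define r where "r = real m powr (1/4)"
  have r4: "r ^ 4 = real m" using mbig by (simp add: r_def powr_realpow[symmetric] powr_powr)
  have r1: "r \<ge> 1" using mbig by (simp add: r_def ge_one_powr_ge_zero)
  have lnm: "ln (real m) \<le> 4 * r"
  proof -
    have "ln (real m) = 4 * ln r" using r1 by (simp add: r4[symmetric] ln_realpow)
    then show ?thesis using ln_le_minus_one[of r] r1 by simp
  qed
  have lnm1: "ln (real m) \<ge> 1"
  proof -
    have "ln (16::real) \<le> ln (real m)" using mbig by simp
    then show ?thesis using \<open>ln (16::real) = 4 * ln 2\<close> ln2_ge_half by linarith
  qed
  have lr: "141 * l \<le> r\<^sup>2"
  proof (rule power2_le_imp_le)
    have "(141 * l)\<^sup>2 \<le> 20000 * l\<^sup>2" by (simp add: power_mult_distrib)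
    also have "\<dots> \<le> real m" using m by (simp add: l_def)
    also have "\<dots> = (r\<^sup>2)\<^sup>2" using r4 by simp
    finally show "(141 * l)\<^sup>2 \<le> (r\<^sup>2)\<^sup>2" .
  qed simp
  have sln: "real s \<le> 2 * ln (real m)"
  proof -
    have "real (2 ^ s) \<le> real m" using s by (rule of_nat_mono)
    then have "ln (2 ^ s) \<le> ln (real m)" by (subst ln_le_cancel_iff) (use mbig in auto)
    then have "real s * ln 2 \<le> ln (real m)" by (simp add: ln_realpow)
    moreover have "real s * (1/2) \<le> real s * ln 2" using ln2_ge_half by (intro mult_left_mono) auto
    ultimately show ?thesis by simp
  qed
  have "ln (2 * real m ^ 2 * (2 * real N) ^ (2 * s)) = ln 2 + 2 * ln (real m) + real (2 * s) * ln (2 * real N)"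
  proof -
    have e: "ln (2 * x ^ 2 * y ^ k) = ln 2 + 2 * ln x + real k * ln y" if "x > 0" "y > 0" for x y :: real and k
      using that by (simp add: ln_mult ln_realpow)
    show ?thesis by (rule e) (use mbig N in auto)
  qed
  also have "ln (2 * real N) = ln 2 + l" using N by (simp add: ln_mult l_def)
  also have "ln 2 + 2 * ln (real m) + real (2 * s) * (ln 2 + l) \<le> 1 + 2 * ln (real m) + 2 * (2 * ln (real m)) * (2 * l)"
  proof -
    have ln2: "ln (2::real) \<le> 1" using ln_le_minus_one[of "2::real"] by simp
    have "real (2 * s) * (ln 2 + l) \<le> 2 * (2 * ln (real m)) * (2 * l)"
      using sln ln2 l ln2_ge_half by (intro mult_mono) auto
    then show ?thesis using ln2 by linarith
  qed
  also have "\<dots> \<le> 11 * l * ln (real m)"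
  proof -
    have "1 \<le> ln (real m)" "2 * ln (real m) \<le> l * ln (real m)"
      using lnm1 l by (auto intro: mult_right_mono)
    moreover have "2 * (2 * ln (real m)) * (2 * l) = 8 * (l * ln (real m))"
      "11 * l * ln (real m) = 11 * (l * ln (real m))" by simp_all
    ultimately show ?thesis by linarith
  qed
  also have "\<dots> \<le> 11 * l * (4 * r)" using lnm l by (intro mult_left_mono) auto
  also have "\<dots> \<le> 44 / 141 * r ^ 3"
  proof -
    have "141 * l * r \<le> r\<^sup>2 * r" using lr r1 by (intro mult_right_mono) auto
    then show ?thesis by (simp add: power3_eq_cube power2_eq_square)
  qed
  also have "\<dots> < r ^ 4 / 3"
  proof -
    have "r ^ 3 * 1 \<le> r ^ 3 * r" using r1 by (intro mult_left_mono) auto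
    moreover have "r ^ 3 > 0" using r1 by simp
    moreover have "r ^ 3 * r = r ^ 4" by (simp add: numeral_eq_Suc mult_ac)
    ultimately show ?thesis by linarith
  qed
  also have "\<dots> = real m / 3" by (simp add: r4)
  also have "\<dots> \<le> real (m div 2)"
  proof -
    have "m \<le> 2 * (m div 2) + 1" by simp
    then have "real m \<le> 2 * real (m div 2) + 1" by linarith
    then show ?thesis using mbig by linarith
  qed
  also have "\<dots> \<le> real (m div 2) * ln 3"
  proof -
    have "exp 1 \<le> (3::real)" by (rule exp_le)
    then have "ln (exp 1) \<le> ln (3::real)" by (subst ln_le_cancel_iff) auto
    then have "1 \<le> ln (3::real)" by simp
    then have "real (m div 2) * 1 \<le> real (m div 2) * ln 3" by (intro mult_left_mono) auto
    then show ?thesis by simp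
  qed
  also have "\<dots> = ln (3 ^ (m div 2))" by (simp add: ln_realpow)
  finally have "ln (2 * real m ^ 2 * (2 * real N) ^ (2 * s)) < ln (3 ^ (m div 2))" .
  moreover have "0 < 2 * real m ^ 2 * (2 * real N) ^ (2 * s)" using mbig N by (intro mult_pos_pos zero_less_power) auto
  ultimately show ?thesis by (subst (asm) ln_less_cancel_iff) simp_all
qed

text \<open>With m = q^s every loss is a power of m: q \<le> m, the factor (4 q^2)^s \<le> m^4 from
  the common shifts, and at most 2 m^2 zeros per interval. Together they give 64 l m^8, where l = ln
  N, and m \<le> 40000 l^3 leads to the exponent 25.\<close>

theorem sumset_perfect_powers_bound:
  fixes A B :: "nat set"
  assumes A: "finite A" "A \<noteq> {}" and B: "finite B" "card B = card A" and N: "N \<ge> 16"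
    and sub: "\<And>a b. a \<in> A \<Longrightarrow> b \<in> B \<Longrightarrow> a + b \<in> {1..N} \<inter> perfect_powers"
  shows "real (card A) \<le> 64 * 40000 ^ 8 * ln (real N) ^ 25"
proof -
  define l where "l = ln (real N)"
  have "ln (16::real) = 4 * ln 2" using ln_realpow[of 2 4] by simp
  moreover have "ln (16::real) \<le> l" using N by (simp add: l_def)
  ultimately have l: "l \<ge> 2" using ln2_ge_half by linarith
  define n where "n = card A"
  have n: "n \<ge> 1" using A by (simp add: n_def Suc_le_eq card_gt_0_iff)
  define R where "R q a b \<longleftrightarrow> (\<exists>x>0. a + b = x ^ q)" for q a b :: nat
  define deg where "deg q b = card {a \<in> A. R q a b}" for q b
  define M where "M = nat \<lfloor>2 * l\<rfloor>"
  have M: "M \<ge> 1" using l unfolding M_def by linarith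
  \<comment> \<open>The sum of 1/q^2 over 2..M is below 1, so the n^2 pairs cannot all be covered if
    every exponent falls short of its share n^2 / q^2.\<close>
  have "\<exists>q\<in>{2..M}. real n ^ 2 / real q ^ 2 \<le> (\<Sum>b\<in>B. real (deg q b))"
  proof (rule ccontr)
    assume "\<not> ?thesis"
    then have less: "(\<Sum>b\<in>B. real (deg q b)) \<le> real n ^ 2 * (1 / real q ^ 2)" if "q \<in> {2..M}" for q
      using that by force
    have one: "real n \<le> (\<Sum>q=2..M. real (deg q b))" if b: "b \<in> B" for b
    proof -
      have "A \<subseteq> (\<Union>q\<in>{2..M}. {a \<in> A. R q a b})"
      proof
        fix a assume a: "a \<in> A"
        have "a + b \<in> perfect_powers" "a + b \<le> N" using sub[OF a b] by auto
        then obtain q x where q: "prime q" "x > 0" "a + b = x ^ q" "real q \<le> 2 * ln (real N)"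
          using perfect_power_exponent_le[OF _ _ N] by metis
        have "q \<in> {2..M}" using q(4) prime_ge_2_nat[OF q(1)] by (auto simp: M_def l_def le_nat_floor)
        then show "a \<in> (\<Union>q\<in>{2..M}. {a \<in> A. R q a b})" using a q by (auto simp: R_def)
      qed
      then have "card A \<le> card (\<Union>q\<in>{2..M}. {a \<in> A. R q a b})" using A by (intro card_mono) auto
      also have "\<dots> \<le> (\<Sum>q=2..M. deg q b)" unfolding deg_def by (rule card_UN_le) simp
      finally have "real n \<le> real (\<Sum>q=2..M. deg q b)" unfolding n_def by (rule of_nat_mono)
      then show ?thesis by simp
    qed
    have "real n ^ 2 = (\<Sum>b\<in>B. real n)" using B by (simp add: n_def power2_eq_square)
    also have "\<dots> \<le> (\<Sum>b\<in>B. \<Sum>q=2..M. real (deg q b))" by (intro sum_mono one)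
    also have "\<dots> = (\<Sum>q=2..M. \<Sum>b\<in>B. real (deg q b))" by (rule sum.swap)
    also have "\<dots> \<le> (\<Sum>q=2..M. real n ^ 2 * (1 / real q ^ 2))" by (intro sum_mono less)
    also have "\<dots> = real n ^ 2 * (\<Sum>q=2..M. 1 / real q ^ 2)" by (rule sum_distrib_left[symmetric])
    also have "\<dots> \<le> real n ^ 2 * (1 - 1 / real M)"
      using sum_inverse_squares_le[of 1 M] M by (intro mult_left_mono) (simp_all add: numeral_2_eq_2)
    also have "\<dots> < real n ^ 2 * 1" using n M by (intro mult_strict_left_mono) auto
    finally show False by simp
  qed
  then obtain q where q: "q \<in> {2..M}" "real n ^ 2 / real q ^ 2 \<le> (\<Sum>b\<in>B. real (deg q b))" by blast
  have q2: "q \<ge> 2" and ql: "real q \<le> 2 * l" using q(1) l by (auto simp: M_def le_nat_iff) (linarith)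
  have "\<exists>s. 20000 * l\<^sup>2 \<le> real (q ^ s)"
  proof -
    obtain s where "20000 * l\<^sup>2 < 2 ^ s" using real_arch_pow[of 2 "20000 * l\<^sup>2"] by auto
    moreover have "(2::real) ^ s \<le> real q ^ s" using q2 by (intro power_mono) auto
    ultimately show ?thesis by (intro exI[of _ s]) simp
  qed
  \<comment> \<open>Minimality keeps m within a factor q \<le> 2 l of the threshold 20000
    l^2.\<close>
  define s where "s = (LEAST s. 20000 * l\<^sup>2 \<le> real (q ^ s))"
  define m where "m = q ^ s"
  have m_ge: "20000 * l\<^sup>2 \<le> real m"
    unfolding m_def s_def using \<open>\<exists>s. 20000 * l\<^sup>2 \<le> real (q ^ s)\<close> by (rule LeastI_ex)
  have l4: "l\<^sup>2 \<ge> 4" using power_mono[of 2 l 2] l by simp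
  have s1: "s \<ge> 1"
  proof (rule ccontr)
    assume "\<not> s \<ge> 1"
    then have "m = 1" by (simp add: m_def)
    then show False using m_ge l4 by simp
  qed
  have m_le: "real m \<le> 40000 * l ^ 3"
  proof -
    have "\<not> 20000 * l\<^sup>2 \<le> real (q ^ (s - 1))"
      using not_less_Least[of "s - 1" "\<lambda>s. 20000 * l\<^sup>2 \<le> real (q ^ s)"] s1 unfolding s_def[symmetric] by simp
    then have "real (q ^ (s - 1)) \<le> 20000 * l\<^sup>2" by simp
    moreover have "real m = real q * real (q ^ (s - 1))" using s1 by (cases s) (auto simp: m_def)
    ultimately have "real m \<le> (2 * l) * (20000 * l\<^sup>2)" using ql l by (simp only: \<open>real m = _\<close>) (intro mult_mono, auto)
    then show ?thesis by (simp add: power3_eq_cube power2_eq_square)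
  qed
  have qm: "q \<le> m" using s1 q2 by (auto simp: m_def intro: self_le_power)
  have sm2: "2 ^ s \<le> m" unfolding m_def using q2 by (intro power_mono) auto
  have sm: "s \<le> m" using sm2 less_exp[of s] by linarith
  have m1: "real m \<ge> 1" using m_ge l4 by linarith
  have n_le: "real n \<le> 64 * l * real m ^ 8"
  proof (cases "real n < 4 * real s * real q ^ 2")
    case True
    have "4 * real s * real q ^ 2 \<le> 4 * real m * real m ^ 2"
      using sm qm by (intro mult_mono power_mono) auto
    also have "\<dots> = 4 * real m ^ 3" by (simp add: power3_eq_cube power2_eq_square)
    also have "\<dots> \<le> (64 * l) * real m ^ 8" using m1 l by (intro mult_mono power_increasing) auto
    finally show ?thesis using True by linarith
  next
    case False
    define \<rho> where "\<rho> = 1 / (4 * real q ^ 2)"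
    \<comment> \<open>The b of at least half the average degree n / q^2; there are at least n / (2
      q^2) of them. Half of that degree is given up once more to provide the surplus s, which leaves
      the proportion \<open>\<rho>\<close>.\<close>
    define W where "W = {b \<in> B. real n / (2 * real q ^ 2) \<le> real (deg q b)}"
    have q0: "real q ^ 2 > 0" using q2 by simp
    have finW: "finite W" using B by (simp add: W_def)
    have deg_le: "deg q b \<le> n" for b unfolding deg_def n_def using A by (intro card_mono) auto
    have W_ge: "real n / (2 * real q ^ 2) \<le> real (card W)"
    proof -
      have "real n ^ 2 / real q ^ 2 \<le> (\<Sum>b\<in>B. real (deg q b))" by (rule q(2))
      also have "\<dots> = (\<Sum>b\<in>W. real (deg q b)) + (\<Sum>b\<in>B - W. real (deg q b))"
        using B by (intro sum.subset_diff[THEN trans, OF _ _ add.commute]) (auto simp: W_def)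
      also have "\<dots> \<le> (\<Sum>b\<in>W. real n) + (\<Sum>b\<in>B - W. real n / (2 * real q ^ 2))"
        using deg_le by (intro add_mono sum_mono) (auto simp: W_def)
      also have "\<dots> \<le> real (card W) * real n + real n * (real n / (2 * real q ^ 2))"
      proof -
        have "card (B - W) \<le> n" using B by (simp add: n_def) (metis B(2) card_mono Diff_subset)
        then have "real (card (B - W)) * (real n / (2 * real q ^ 2)) \<le> real n * (real n / (2 * real q ^ 2))"
          by (intro mult_right_mono) auto
        then show ?thesis by simp
      qed
      finally have "real n ^ 2 / real q ^ 2 \<le> real (card W) * real n + real n * (real n / (2 * real q ^ 2))" .
      moreover have "real n ^ 2 / real q ^ 2 = 2 * (real n * (real n / (2 * real q ^ 2)))"
        by (simp add: power2_eq_square)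
      ultimately have "real n * (real n / (2 * real q ^ 2)) \<le> real n * real (card W)"
        unfolding mult.commute[of "real n" "real (card W)"] by linarith
      then show ?thesis by (rule mult_left_le_imp_le) (use n in simp)
    qed
    then have "W \<noteq> {}" using n q0 by (auto simp: divide_le_0_iff)
    have deg_ge: "\<rho> * card A + s \<le> card {a \<in> A. R q a b}" if "b \<in> W" for b
    proof -
      have "real s \<le> real n / (4 * real q ^ 2)" using False q0 by (simp add: field_simps)
      then have "\<rho> * real n + real s \<le> real n / (2 * real q ^ 2)" by (simp add: \<rho>_def field_simps)
      then show ?thesis using that by (simp add: W_def deg_def n_def)
    qed
    obtain S where S: "S \<subseteq> A" "card S = s" "\<rho> ^ s * card W \<le> card {b \<in> W. \<forall>a\<in>S. R q a b}"
      using common_neighbours[OF A finW \<open>W \<noteq> {}\<close>, of \<rho> s "R q"] deg_ge q0 by (auto simp: \<rho>_def)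
    define V where "V = {b \<in> W. \<forall>a\<in>S. R q a b}"
    have finS: "finite S" using S A finite_subset by blast
    have "real (card V) \<le> (15 * ln (real N) + 1) * real (card S * q ^ card S + card S)"
    proof (rule power_shifts_bound)
      show "finite S" "S \<noteq> {}" using finS S(2) s1 by auto
      show "q > 0" using q2 by simp
      show "\<exists>x>0. a + b = x ^ q" if "a \<in> S" "b \<in> V" for a b using that by (auto simp: V_def R_def)
      show "a + b \<le> N" if "a \<in> S" "b \<in> V" for a b
        using that S(1) sub[of a b] by (auto simp: V_def W_def)
      show "2 * real (q ^ card S) ^ 2 * (2 * real N) ^ (2 * card S) < 3 ^ (q ^ card S div 2)"
        unfolding S(2) m_def[symmetric] using N m_ge sm2 by (intro determinant_condition) (auto simp: l_def)
    qed
    also have "\<dots> \<le> (16 * l) * (2 * real m ^ 2)"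
    proof (rule mult_mono)
      show "15 * ln (real N) + 1 \<le> 16 * l" using l by (simp add: l_def)
      have "s * m + s \<le> m * m + m * m" using sm by (intro add_mono mult_mono) (auto intro: order.trans[OF sm])
      then have "real (s * m + s) \<le> real (m * m + m * m)" by (rule of_nat_mono)
      then show "real (card S * q ^ card S + card S) \<le> 2 * real m ^ 2"
        unfolding S(2) m_def[symmetric] by (simp add: power2_eq_square)
    qed (use l in auto)
    finally have V: "real (card V) \<le> 32 * l * real m ^ 2" by simp
    have "real n \<le> 2 * real q ^ 2 * (1 / \<rho>) ^ s * (\<rho> ^ s * (real n / (2 * real q ^ 2)))"
      using q0 by (simp add: \<rho>_def power_divide power_mult_distrib)
    also have "\<dots> \<le> 2 * real q ^ 2 * (1 / \<rho>) ^ s * real (card V)"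
    proof (intro mult_left_mono)
      have "\<rho> ^ s * (real n / (2 * real q ^ 2)) \<le> \<rho> ^ s * real (card W)"
        using W_ge q0 by (intro mult_left_mono) (auto simp: \<rho>_def)
      then show "\<rho> ^ s * (real n / (2 * real q ^ 2)) \<le> real (card V)" using S(3) by (simp add: V_def)
    qed (use q0 in \<open>auto simp: \<rho>_def\<close>)
    also have "\<dots> \<le> 2 * real m ^ 2 * real m ^ 4 * (32 * l * real m ^ 2)"
    proof (intro mult_mono V)
      show "real q ^ 2 \<le> real m ^ 2" using qm by (intro power_mono) auto
      have "(1 / \<rho>) ^ s = (2 ^ s) ^ 2 * real m ^ 2"
      proof -
        have "1 / \<rho> = (2 * real q) ^ 2" by (simp add: \<rho>_def power2_eq_square)
        then have "(1 / \<rho>) ^ s = ((2 * real q) ^ s) ^ 2"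
          by (simp only: power_mult[symmetric] mult.commute[of 2 s])
        then show ?thesis by (simp only: power_mult_distrib m_def of_nat_power)
      qed
      also have "\<dots> \<le> real m ^ 2 * real m ^ 2"
      proof (intro mult_right_mono power_mono)
        have "real (2 ^ s) \<le> real m" using sm2 by (rule of_nat_mono)
        then show "2 ^ s \<le> real m" by simp
      qed auto
      finally show "(1 / \<rho>) ^ s \<le> real m ^ 4" by (simp add: power_add[symmetric])
    qed (use q0 in \<open>auto simp: \<rho>_def\<close>)
    also have "\<dots> = 64 * l * real m ^ 8" by (simp add: power_add[symmetric] mult_ac)
    finally show ?thesis .
  qed
  also have "\<dots> \<le> 64 * l * (40000 * l ^ 3) ^ 8" using m_le l by (intro mult_left_mono power_mono) auto
  also have "\<dots> = 64 * 40000 ^ 8 * l ^ 25"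
    by (simp only: power_mult_distrib power_mult[symmetric]) (simp add: mult_ac flip: power_Suc)
  finally show ?thesis by (simp add: n_def l_def)
qed

section \<open>Consequences of the ABC conjecture\<close>

abbreviation nrad :: "nat \<Rightarrow> real" where "nrad n \<equiv> real_of_int (rad (int n))"

lemma rad_ge_1: "rad n \<ge> 1"
  unfolding rad_def using prime_ge_1_int by (intro prod_ge_1) (auto simp: in_prime_factors_iff)

lemma rad_dvd_mono: "a dvd b \<Longrightarrow> b \<noteq> 0 \<Longrightarrow> rad a \<le> rad b"
  unfolding rad_def using dvd_prime_factors[of b a]
  by (intro prod_mono2) (auto simp: in_prime_factors_iff dest: prime_ge_1_int)

lemma rad_mult_le:
  assumes "a \<noteq> 0" "b \<noteq> 0"
  shows "rad (a * b) \<le> rad a * rad b"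
proof -
  have "rad (a * b) * \<Prod>(prime_factors a \<inter> prime_factors b) = rad a * rad b"
    unfolding rad_def prime_factors_product[OF assms] by (rule prod.union_inter) auto
  moreover have "\<Prod>(prime_factors a \<inter> prime_factors b) \<ge> 1"
    using prime_ge_1_int by (intro prod_ge_1) (auto simp: in_prime_factors_iff)
  then have "rad (a * b) * 1 \<le> rad (a * b) * \<Prod>(prime_factors a \<inter> prime_factors b)"
    using rad_ge_1[of "a * b"] by (intro mult_left_mono) auto
  ultimately show ?thesis by simp
qed

lemma rad_power: "q > 0 \<Longrightarrow> rad (a ^ q) = rad a"
proof -
  assume "q > 0"
  then have "prime_factors (a ^ q) = prime_factors a" by (auto simp: in_prime_factors_iff prime_dvd_power_iff)
  then show ?thesis by (simp add: rad_def)
qed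

lemma rad_le: 
  assumes "a > 0"
  shows "rad a \<le> a"
proof -
  have "rad a \<le> (\<Prod>p\<in>prime_factors a. p ^ multiplicity p a)"
    unfolding rad_def
  proof (rule prod_mono)
    fix p assume p: "p \<in> prime_factors a"
    then have "p \<ge> 1" "multiplicity p a \<ge> 1"
      by (auto simp: in_prime_factors_iff prime_ge_1_int prime_factors_multiplicity)
    then show "0 \<le> p \<and> p \<le> p ^ multiplicity p a" using self_le_power[of p "multiplicity p a"] by auto
  qed
  also have "\<dots> = a" using assms by (simp add: prod_prime_factors)
  finally show ?thesis .
qed

lemma nrad_mult_le: "a > 0 \<Longrightarrow> b > 0 \<Longrightarrow> nrad (a * b) \<le> nrad a * nrad b"
  using rad_mult_le[of "int a" "int b"] by (simp flip: of_int_mult)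

lemma nrad_le: "a > 0 \<Longrightarrow> nrad a \<le> real a"
  using rad_le[of "int a"] by linarith

lemma nrad_ge_1: "nrad a \<ge> 1"
  using rad_ge_1[of "int a"] by linarith

lemma nrad_power: "q > 0 \<Longrightarrow> nrad (a ^ q) = nrad a"
  by (simp add: rad_power)

lemma nrad_prod_le: "finite I \<Longrightarrow> (\<And>i. i \<in> I \<Longrightarrow> f i > 0) \<Longrightarrow> nrad (\<Prod>i\<in>I. f i) \<le> (\<Prod>i\<in>I. nrad (f i))"
proof (induction I rule: finite_induct)
  case (insert a I)
  have "nrad (\<Prod>i\<in>insert a I. f i) \<le> nrad (f a) * nrad (\<Prod>i\<in>I. f i)"
    using insert nrad_mult_le[of "f a" "\<Prod>i\<in>I. f i"] by (simp add: prod_pos)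
  also have "\<dots> \<le> nrad (f a) * (\<Prod>i\<in>I. nrad (f i))"
    using insert nrad_ge_1[of "f a"] by (intro mult_left_mono) auto
  finally show ?case using insert by simp
qed (simp add: rad_def)

text \<open>Cancelling the gcd can only shrink the radical, so the gcd enters as a mere factor;
  applications need only keep it bounded.\<close>

lemma abc_gcd:
  assumes ABC_conjecture "\<epsilon> > 0"
  obtains K where "K > 0" "\<And>a b c :: nat. a > 0 \<Longrightarrow> b > 0 \<Longrightarrow> a + b = c \<Longrightarrow>
    real c \<le> K * real (gcd a b) * nrad (a * b * c) powr (1 + \<epsilon>)"
proof -
  have "\<epsilon> > 0 \<longrightarrow> (\<exists>K::real. \<forall>a b c :: int. a \<noteq> 0 \<and> b \<noteq> 0 \<and> c \<noteq> 0 \<and> gcd a (gcd b c) = 1 \<and> a + b = c \<longrightarrow>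
        real_of_int (max \<bar>a\<bar> (max \<bar>b\<bar> \<bar>c\<bar>)) \<le> K * real_of_int (rad (a * b * c)) powr (1 + \<epsilon>))"
    using assms(1)[unfolded ABC_conjecture_def] by (rule spec)
  from mp[OF this assms(2)] obtain K where K: "\<And>a b c :: int. a \<noteq> 0 \<and> b \<noteq> 0 \<and> c \<noteq> 0 \<and> gcd a (gcd b c) = 1 \<and> a + b = c \<Longrightarrow>
        real_of_int (max \<bar>a\<bar> (max \<bar>b\<bar> \<bar>c\<bar>)) \<le> K * real_of_int (rad (a * b * c)) powr (1 + \<epsilon>)"
    by blast
  show thesis
  proof (rule that[of "max K 1"])
    fix a b c :: nat
    assume abc: "a > 0" "b > 0" "a + b = c"
    define g where "g = gcd a b"
    have g: "g > 0" using abc by (simp add: g_def)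
    have "\<exists>a' b'. a = a' * gcd a b \<and> b = b' * gcd a b \<and> coprime a' b'"
      by (rule gcd_coprime_exists) (use abc in auto)
    then obtain a' b' where ab': "a = a' * g" "b = b' * g" "coprime a' b'" unfolding g_def by blast
    then have ab: "a = g * a'" "b = g * b'" "coprime a' b'" by (simp_all only: mult.commute)
    define c' where "c' = a' + b'"
    have c: "c = g * c'" using abc(3) ab by (simp add: c'_def algebra_simps)
    have pos: "a' > 0" "b' > 0" "c' > 0" using abc ab by (auto simp: c'_def)
    have "gcd a' (gcd b' c') dvd gcd a' b'" by (meson gcd_dvd1 gcd_dvd2 dvd_trans gcd_greatest)
    then have "gcd a' (gcd b' c') = 1" using ab(3) by simp
    then have "gcd (int a') (gcd (int b') (int c')) = 1" by (simp only: gcd_int_int_eq of_nat_1)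
    then have "real_of_int (max \<bar>int a'\<bar> (max \<bar>int b'\<bar> \<bar>int c'\<bar>)) \<le> K * real_of_int (rad (int a' * int b' * int c')) powr (1 + \<epsilon>)"
      using pos by (intro K) (auto simp: c'_def)
    then have "real c' \<le> K * nrad (a' * b' * c') powr (1 + \<epsilon>)" by simp
    also have "\<dots> \<le> max K 1 * nrad (a * b * c) powr (1 + \<epsilon>)"
    proof (intro mult_mono powr_mono2)
      have "int (a' * b' * c') dvd int (a * b * c)" unfolding ab(1,2) c by (auto simp: dvd_def)
      then show "nrad (a' * b' * c') \<le> nrad (a * b * c)"
        using abc by (simp add: rad_dvd_mono del: of_nat_mult)
      show "0 \<le> nrad (a' * b' * c')" using nrad_ge_1[of "a' * b' * c'"] by linarith
    qed (use assms in auto)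
    finally have "real g * real c' \<le> real g * (max K 1 * nrad (a * b * c) powr (1 + \<epsilon>))"
      by (intro mult_left_mono) auto
    then show "real c \<le> max K 1 * real (gcd a b) * nrad (a * b * c) powr (1 + \<epsilon>)"
      unfolding c g_def[symmetric] by (simp add: mult_ac)
  qed auto
qed

text \<open>After cancelling gcd(x, y, z), the gcd of the terms divides \<open>P\<close> = \<alpha>
  \<beta> (\<alpha> + \<beta>) \<le> m^3, and the radical of their product is at most m^3 V^3 for V
  the larger of Y and Z. ABC with \<epsilon> = 1 yields V^q \<le> K m^9 V^6, and V \<ge> 2 because X
  < Z.\<close>

lemma three_powers_relation:
  assumes ABC_conjecture
  obtains K where "K > 0" "\<And>\<alpha> \<beta> m x y z q :: nat. \<lbrakk>\<alpha> > 0; \<beta> > 0; \<alpha> + \<beta> \<le> m; 0 < x; x < z; q \<ge> 6;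
    \<alpha> * x ^ q + \<beta> * z ^ q = (\<alpha> + \<beta>) * y ^ q\<rbrakk> \<Longrightarrow> 2 ^ (q - 6) \<le> K * real m ^ 9"
proof -
  obtain K where K: "K > 0" "\<And>a b c :: nat. a > 0 \<Longrightarrow> b > 0 \<Longrightarrow> a + b = c \<Longrightarrow>
    real c \<le> K * real (gcd a b) * nrad (a * b * c) powr (1 + 1)"
    using abc_gcd[OF assms, of 1] by auto
  show thesis
  proof (rule that[of K])
    fix \<alpha> \<beta> m x y z q :: nat
    assume \<alpha>\<beta>: "\<alpha> > 0" "\<beta> > 0" "\<alpha> + \<beta> \<le> m" and x: "0 < x" "x < z" and q: "q \<ge> 6"
      and eq: "\<alpha> * x ^ q + \<beta> * z ^ q = (\<alpha> + \<beta>) * y ^ q"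
    have y: "y > 0"
    proof (rule ccontr)
      assume "\<not> y > 0"
      then have "(\<alpha> + \<beta>) * y ^ q = 0" using q by simp
      moreover have "\<alpha> * x ^ q > 0" using \<alpha>\<beta>(1) x by simp
      ultimately show False using eq by linarith
    qed
    define w where "w = gcd x (gcd y z)"
    have w: "w > 0" using x by (simp add: w_def)
    have "w dvd x" "w dvd y" "w dvd z" by (auto simp: w_def intro: dvd_trans)
    then obtain X Y Z where XYZ: "x = w * X" "y = w * Y" "z = w * Z" by (elim dvdE)
    have cop: "gcd X (gcd Y Z) = 1"
    proof -
      have "w = w * gcd X (gcd Y Z)" unfolding gcd_mult_distrib_nat XYZ[symmetric] by (rule w_def)
      then show ?thesis using w by simp
    qed
    have pos: "X > 0" "Y > 0" "Z > 0" using x y XYZ by (auto intro!: Nat.gr0I)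
    have XZ: "X < Z" using x(2) XYZ by simp
    define a b c where "a = \<alpha> * X ^ q" and "b = \<beta> * Z ^ q" and "c = (\<alpha> + \<beta>) * Y ^ q"
    have "w ^ q * (a + b) = w ^ q * c"
      using eq unfolding XYZ a_def b_def c_def by (simp add: power_mult_distrib algebra_simps)
    then have abc: "a + b = c" using w by simp
    have abpos: "a > 0" "b > 0" using pos \<alpha>\<beta> by (auto simp: a_def b_def)
    define W where "W = Z + Y"
    define P where "P = \<alpha> * \<beta> * (\<alpha> + \<beta>)"
    have P: "P > 0" "P \<le> m ^ 3"
    proof -
      have "\<alpha> * \<beta> * (\<alpha> + \<beta>) \<le> m * m * m" using \<alpha>\<beta> by (intro mult_mono) auto
      then show "P \<le> m ^ 3" by (simp add: P_def power3_eq_cube)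
    qed (use \<alpha>\<beta> in \<open>simp add: P_def\<close>)
    have "gcd a b dvd P"
    proof -
      define g where "g = gcd a b"
      have "g dvd a" "g dvd b" "g dvd c" using abc by (auto simp: g_def)
      moreover have "P * X ^ q = \<beta> * (\<alpha> + \<beta>) * a" "P * Z ^ q = \<alpha> * (\<alpha> + \<beta>) * b" "P * Y ^ q = \<alpha> * \<beta> * c"
        by (simp_all only: a_def b_def c_def P_def mult_ac)
      ultimately have "g dvd P * X ^ q" "g dvd P * Y ^ q" "g dvd P * Z ^ q" by (simp_all only: dvd_mult)
      then have "g dvd gcd (P * X ^ q) (gcd (P * Y ^ q) (P * Z ^ q))" by simp
      also have "\<dots> = P * gcd (X ^ q) (gcd (Y ^ q) (Z ^ q))" by (simp only: gcd_mult_distrib_nat)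
      also have "gcd (X ^ q) (gcd (Y ^ q) (Z ^ q)) = 1" by (simp only: gcd_exp cop power_one)
      finally show ?thesis by (simp add: g_def)
    qed
    then have g: "gcd a b \<le> m ^ 3" using P by (meson dvd_imp_le le_trans)
    define V where "V = max Z Y"
    have V2: "V \<ge> 2" using XZ pos by (simp add: V_def)
    have Vq: "V ^ q \<le> c"
    proof -
      have "Z ^ q \<le> b" "Y ^ q \<le> c" using \<alpha>\<beta> by (auto simp: b_def c_def)
      then show ?thesis using abc by (auto simp: V_def max_def)
    qed
    have rad: "nrad (a * b * c) \<le> real m ^ 3 * real V ^ 3"
    proof -
      have e: "a * b * c = P * (X * Z * Y) ^ q" by (simp add: a_def b_def c_def P_def power_mult_distrib mult_ac)
      have "nrad (a * b * c) \<le> nrad P * nrad ((X * Z * Y) ^ q)"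
        unfolding e by (rule nrad_mult_le) (use P pos in auto)
      also have "nrad ((X * Z * Y) ^ q) = nrad (X * Z * Y)" using q by (intro nrad_power) auto
      also have "nrad P * \<dots> \<le> real P * real (X * Z * Y)"
        using nrad_le[of P] nrad_le[of "X * Z * Y"] P pos nrad_ge_1[of "X * Z * Y"] by (intro mult_mono) auto
      also have "\<dots> \<le> real (m ^ 3) * real (V * V * V)"
        using P XZ by (intro mult_mono of_nat_mono) (auto simp: V_def)
      finally show ?thesis by (simp add: power3_eq_cube)
    qed
    have "real V ^ q \<le> real c" using Vq by (metis of_nat_le_iff of_nat_power)
    also have "\<dots> \<le> K * real (gcd a b) * nrad (a * b * c) powr (1 + 1)" by (rule K(2)[OF abpos abc])
    also have "\<dots> = K * real (gcd a b) * nrad (a * b * c) ^ 2"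
      using nrad_ge_1[of "a * b * c"] by (simp add: powr_realpow[of _ 2, simplified])
    also have "\<dots> \<le> K * real m ^ 3 * (real m ^ 3 * real V ^ 3) ^ 2"
    proof (intro mult_mono power_mono rad)
      show "real (gcd a b) \<le> real m ^ 3" using g by (metis of_nat_le_iff of_nat_power)
      show "0 \<le> nrad (a * b * c)" using nrad_ge_1[of "a * b * c"] by linarith
    qed (use K in auto)
    also have "\<dots> = K * real m ^ 9 * real V ^ 6"
      by (simp add: power_mult_distrib power_mult[symmetric] power_add[symmetric])
    also have "real V ^ q = real V ^ (q - 6) * real V ^ 6" using q by (simp add: power_add[symmetric])
    finally have "real V ^ (q - 6) \<le> K * real m ^ 9" using V2 by (simp add: mult_le_cancel_right)
    moreover have "2 ^ (q - 6) \<le> real V ^ (q - 6)" using V2 by (intro power_mono) auto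
    ultimately show "2 ^ (q - 6) \<le> K * real m ^ 9" by linarith
  qed (use K in auto)
qed

lemma three_increasing:
  fixes J :: "nat set"
  assumes "finite J" "card J \<ge> 3"
  obtains i j k where "i \<in> J" "j \<in> J" "k \<in> J" "i < j" "j < k"
proof -
  define i k where "i = Min J" and "k = Max J"
  have "J \<noteq> {}" using assms by auto
  then have ik: "i \<in> J" "k \<in> J" "\<And>x. x \<in> J \<Longrightarrow> i \<le> x \<and> x \<le> k" using assms by (auto simp: i_def k_def)
  have "\<not> J \<subseteq> {i, k}"
  proof
    assume "J \<subseteq> {i, k}"
    then have "card J \<le> card {i, k}" by (intro card_mono) auto
    also have "\<dots> \<le> 2" by (simp add: card_insert_if)
    finally show False using assms by simp
  qed
  then obtain j where "j \<in> J" "j \<noteq> i" "j \<noteq> k" by auto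
  then show thesis using that[of i j k] ik by (metis le_neq_implies_less)
qed

text \<open>Three terms of a progression satisfy a linear relation whose coefficients are index
  differences, here below q^2; \<open>three_powers_relation\<close> fails once 2^(q - 6) outgrows K
  q^18. A window of length q^2 is long enough to make the densities 2 / q^2 summable over q.\<close>

lemma large_exponent_sparse:
  assumes ABC_conjecture
  obtains y where "\<And>q a0 a b. q > y \<Longrightarrow> a > 0 \<Longrightarrow>
    card {j \<in> {b + 1..b + q ^ 2}. \<exists>x>0. a0 + j * a = x ^ q} \<le> (2::nat)"
proof -
  obtain K where K: "K > 0" "\<And>\<alpha> \<beta> m x y z q :: nat. \<lbrakk>\<alpha> > 0; \<beta> > 0; \<alpha> + \<beta> \<le> m; 0 < x; x < z; q \<ge> 6;
    \<alpha> * x ^ q + \<beta> * z ^ q = (\<alpha> + \<beta>) * y ^ q\<rbrakk> \<Longrightarrow> 2 ^ (q - 6) \<le> K * real m ^ 9"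
    using three_powers_relation[OF assms] by blast
  have "eventually (\<lambda>q::nat. K * real (q ^ 2) ^ 9 < 2 ^ q / 64) at_top" by real_asymp
  then obtain y where y: "\<And>q. q \<ge> y \<Longrightarrow> K * real (q ^ 2) ^ 9 < 2 ^ q / 64"
    by (auto simp: eventually_at_top_linorder)
  show thesis
  proof (rule that[of "max y 6"])
    fix q a0 a b :: nat assume q: "q > max y 6" and a: "a > 0"
    define J where "J = {j \<in> {b + 1..b + q ^ 2}. \<exists>x>0. a0 + j * a = x ^ q}"
    show "card {j \<in> {b + 1..b + q ^ 2}. \<exists>x>0. a0 + j * a = x ^ q} \<le> 2"
      unfolding J_def[symmetric]
    proof (rule ccontr)
      assume "\<not> card J \<le> 2"
      moreover have "finite J" by (simp add: J_def)
      ultimately obtain i j k where ijk: "i \<in> J" "j \<in> J" "k \<in> J" "i < j" "j < k"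
        using three_increasing[of J] by auto
      obtain x1 x2 x3 where x: "x1 > 0" "a0 + i * a = x1 ^ q" "x2 > 0" "a0 + j * a = x2 ^ q"
        "x3 > 0" "a0 + k * a = x3 ^ q" using ijk by (auto simp: J_def)
      have "x1 ^ q < x3 ^ q" unfolding x(2,6)[symmetric] using ijk a by simp
      then have "x1 < x3" by (rule power_less_imp_less_base) simp
      define u v where "u = k - j" and "v = j - i"
      have jk: "j = i + v" "k = i + v + u" using ijk by (auto simp: u_def v_def)
      have "u * (a0 + i * a) + v * (a0 + k * a) = (u + v) * (a0 + j * a)"
        unfolding jk by (simp add: algebra_simps)
      then have "(k - j) * x1 ^ q + (j - i) * x3 ^ q = ((k - j) + (j - i)) * x2 ^ q"
        unfolding x(2,4,6) u_def v_def .
      then have "2 ^ (q - 6) \<le> K * real (q ^ 2) ^ 9"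
        by (intro K(2)[of "k - j" "j - i" "q ^ 2" x1 x3 q x2]) (use ijk x \<open>x1 < x3\<close> q in \<open>auto simp: J_def\<close>)
      moreover have "(2::real) ^ q = 2 ^ (q - 6) * 2 ^ 6" using q by (simp only: power_add[symmetric]) simp
      ultimately show False using y[of q] q by simp
    qed
  qed
qed

section \<open>Products of linear forms with equal power sums\<close>

lemma fps_deriv_linear_power:
  fixes c :: int
  defines "R \<equiv> Abs_fps (\<lambda>k. (- c) ^ k)" and "L \<equiv> fps_of_poly [:1, c:]"
  shows "fps_deriv (L ^ n) = L ^ n * (fps_const (int n * c) * R)"
proof -
  have LR: "L * R = 1"
  proof (rule fps_ext)
    fix k show "(L * R) $ k = 1 $ k"
      by (cases k) (simp_all add: L_def R_def fps_of_poly_pCons fps_of_poly_const distrib_right mult.assoc)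
  qed
  have L': "fps_deriv L = fps_const c" by (simp add: L_def fps_of_poly_pCons fps_of_poly_const)
  show ?thesis
  proof (cases n)
    case (Suc k)
    have "fps_deriv (L ^ n) = fps_const (int n) * fps_const c * L ^ k"
      by (simp only: fps_deriv_power L' Suc diff_Suc_1 of_nat_id)
    also have "L ^ k = L ^ k * (L * R)" by (simp only: LR mult_1_right)
    also have "\<dots> = L ^ n * R" by (simp only: Suc power_Suc mult_ac)
    finally show ?thesis by (simp add: mult_ac)
  qed simp
qed

text \<open>The logarithmic derivative of the product is the sum of n_i i / (1 + i X), whose
  coefficients are, up to sign, the weighted power sums.\<close>

lemma fps_deriv_prod_linear_powers:
  fixes n :: "nat \<Rightarrow> nat"
  assumes "finite I"
  shows "fps_deriv (fps_of_poly (\<Prod>i\<in>I. [:1, int i:] ^ n i)) =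
    fps_of_poly (\<Prod>i\<in>I. [:1, int i:] ^ n i) * Abs_fps (\<lambda>k. \<Sum>i\<in>I. int (n i) * int i * (- int i) ^ k)"
  using assms
proof (induction I rule: finite_induct)
  case (insert a I)
  define P where "P = fps_of_poly (\<Prod>i\<in>I. [:1, int i:] ^ n i)"
  define T where "T = Abs_fps (\<lambda>k. \<Sum>i\<in>I. int (n i) * int i * (- int i) ^ k)"
  define L where "L = fps_of_poly [:1, int a:]"
  define S where "S = fps_const (int (n a) * int a) * Abs_fps (\<lambda>k. (- int a) ^ k)"
  have P': "fps_deriv P = P * T" using insert.IH by (simp add: P_def T_def)
  have L': "fps_deriv (L ^ n a) = L ^ n a * S"
    unfolding L_def S_def by (rule fps_deriv_linear_power)
  have e: "fps_of_poly (\<Prod>i\<in>insert a I. [:1, int i:] ^ n i) = L ^ n a * P"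
    using insert(1,2) by (simp add: L_def P_def fps_of_poly_mult fps_of_poly_power)
  have "Abs_fps (\<lambda>k. \<Sum>i\<in>insert a I. int (n i) * int i * (- int i) ^ k) = S + T"
    using insert(1,2) by (intro fps_ext) (simp add: S_def T_def)
  then show ?case unfolding e by (simp add: P' L' algebra_simps)
qed (simp add: fps_eq_iff)

text \<open>Newton's identities in the form P' = P T: the coefficient of index j + 1 is determined,
  up to the cancellable factor j + 1, by the earlier ones and by the power sums in T. All products
  start with constant term 1.\<close>

lemma power_sums_imp_coeffs_eq:
  fixes n n' :: "nat \<Rightarrow> nat"
  assumes I: "finite I" and eq: "\<And>k. k \<le> s \<Longrightarrow> (\<Sum>i\<in>I. n i * i ^ k) = (\<Sum>i\<in>I. n' i * i ^ k)"
    and k: "k \<le> s"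
  shows "coeff (\<Prod>i\<in>I. [:1, int i:] ^ n i) k = coeff (\<Prod>i\<in>I. [:1, int i:] ^ n' i) k"
proof -
  define P where "P n = fps_of_poly (\<Prod>i\<in>I. [:1, int i:] ^ n i)" for n :: "nat \<Rightarrow> nat"
  define T where "T n = Abs_fps (\<lambda>k. \<Sum>i\<in>I. int (n i) * int i * (- int i) ^ k)" for n :: "nat \<Rightarrow> nat"
  have P': "fps_deriv (P n) = P n * T n" for n
    unfolding P_def T_def by (rule fps_deriv_prod_linear_powers[OF I])
  have T_eq: "T n $ k = T n' $ k" if "k < s" for k
  proof -
    have "T m $ k = (- 1) ^ k * int (\<Sum>i\<in>I. m i * i ^ Suc k)" for m
      unfolding T_def by (simp add: sum_distrib_left power_minus[of "int _"] mult_ac)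
    moreover have "(\<Sum>i\<in>I. n i * i ^ Suc k) = (\<Sum>i\<in>I. n' i * i ^ Suc k)" using that by (intro eq) auto
    ultimately show ?thesis by (simp only:)
  qed
  have "P n $ k = P n' $ k" if "k \<le> s" for k
    using that
  proof (induction k rule: less_induct)
    case (less k)
    show ?case
    proof (cases k)
      case 0
      have "P m $ 0 = 1" for m
        unfolding P_def by (simp add: poly_0_coeff_0[symmetric] poly_prod)
      then show ?thesis using 0 by simp
    next
      case (Suc j)
      have *: "int (Suc j) * P m $ Suc j = (\<Sum>i=0..j. P m $ i * T m $ (j - i))" for m
        using arg_cong[OF P'[of m], of "\<lambda>F. F $ j"] by (simp add: fps_mult_nth)
      have "(\<Sum>i=0..j. P n $ i * T n $ (j - i)) = (\<Sum>i=0..j. P n' $ i * T n' $ (j - i))"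
        using less Suc T_eq by (intro sum.cong refl arg_cong2[where f="(*)"]) auto
      then have "int (Suc j) * P n $ Suc j = int (Suc j) * P n' $ Suc j" unfolding * .
      then show ?thesis unfolding Suc by (simp only: mult_cancel_left) simp
    qed
  qed
  from this[OF k] show ?thesis by (simp add: P_def)
qed

text \<open>The sums are the homogenization t^D p(u/t), under which the factor 1 + c X becomes t + c
  u.\<close>

lemma homogenize_linear_mult:
  fixes p :: "'a::comm_ring_1 poly"
  assumes "degree p \<le> D"
  shows "(\<Sum>k\<le>Suc D. coeff ([:1, c:] * p) k * u ^ k * t ^ (Suc D - k)) =
    (t + c * u) * (\<Sum>k\<le>D. coeff p k * u ^ k * t ^ (D - k))"
proof -
  have "coeff p (Suc D) = 0" using assms by (intro coeff_eq_0) auto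
  then have "(\<Sum>k\<le>Suc D. coeff p k * u ^ k * t ^ (Suc D - k)) = t * (\<Sum>k\<le>D. coeff p k * u ^ k * t ^ (D - k))"
    by (simp add: sum_distrib_left Suc_diff_le mult_ac)
  moreover have "(\<Sum>k\<le>Suc D. coeff (pCons 0 (smult c p)) k * u ^ k * t ^ (Suc D - k)) =
      c * u * (\<Sum>k\<le>D. coeff p k * u ^ k * t ^ (D - k))"
    unfolding sum.atMost_Suc_shift by (simp add: sum_distrib_left mult_ac)
  moreover have "[:1, c:] * p = p + pCons 0 (smult c p)" by simp
  ultimately show ?thesis by (simp add: distrib_right sum.distrib del: mult_pCons_left)
qed

lemma homogenize_prod_linear_powers:
  fixes n :: "nat \<Rightarrow> nat" and t u :: int
  assumes "finite I"
  shows "degree (\<Prod>i\<in>I. [:1, int i:] ^ n i) \<le> (\<Sum>i\<in>I. n i) \<and>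
    (\<Sum>k\<le>(\<Sum>i\<in>I. n i). coeff (\<Prod>i\<in>I. [:1, int i:] ^ n i) k * u ^ k * t ^ ((\<Sum>i\<in>I. n i) - k)) =
      (\<Prod>i\<in>I. (t + int i * u) ^ n i)"
  using assms
proof (induction I rule: finite_induct)
  case (insert a I)
  define P where "P = (\<Prod>i\<in>I. [:1, int i:] ^ n i)"
  define D where "D = (\<Sum>i\<in>I. n i)"
  have "degree ([:1, int a:] ^ k * P) \<le> k + D \<and>
    (\<Sum>j\<le>k + D. coeff ([:1, int a:] ^ k * P) j * u ^ j * t ^ (k + D - j)) =
      (t + int a * u) ^ k * (\<Prod>i\<in>I. (t + int i * u) ^ n i)" for k
  proof (induction k)
    case 0
    then show ?case using insert.IH by (simp add: P_def D_def)
  next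
    case (Suc k)
    define Q where "Q = [:1, int a:] ^ k * P"
    have Q: "degree Q \<le> k + D" using Suc by (simp add: Q_def)
    have e: "[:1, int a:] ^ Suc k * P = [:1, int a:] * Q" by (simp only: Q_def power_Suc mult.assoc)
    have "degree ([:1, int a:] * Q) \<le> degree [:1, int a:] + degree Q" by (rule degree_mult_le)
    also have "\<dots> \<le> Suc k + D" using Q by simp
    finally have "degree ([:1, int a:] * Q) \<le> Suc k + D" .
    moreover have "(\<Sum>j\<le>Suc (k + D). coeff ([:1, int a:] * Q) j * u ^ j * t ^ (Suc (k + D) - j)) =
        (t + int a * u) * ((t + int a * u) ^ k * (\<Prod>i\<in>I. (t + int i * u) ^ n i))"
      using homogenize_linear_mult[OF Q, of "int a" u t] Suc by (simp only: Q_def)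
    ultimately show ?case unfolding e by (simp only: add_Suc power_Suc mult.assoc)
  qed
  from this[of "n a"] show ?case using insert(1,2) by (simp add: P_def D_def)
qed simp

lemma gcd_prod_dvd:
  fixes x :: "'i \<Rightarrow> nat"
  assumes "finite I"
  shows "gcd (\<Prod>i\<in>I. x i ^ n i) c dvd (\<Prod>i\<in>I. gcd (x i) c ^ n i)"
proof -
  have mult: "gcd (a * b) c dvd gcd a c * gcd b c" for a b :: nat
  proof -
    have "gcd (a * b) c dvd gcd (b * a) (b * c)" by (intro gcd_greatest) (auto simp: mult.commute intro: dvd_mult)
    then have "gcd (a * b) c dvd gcd a c * b" unfolding gcd_mult_distrib_nat[symmetric] by (simp add: mult.commute)
    moreover have "gcd (a * b) c dvd gcd a c * c" by simp
    ultimately have "gcd (a * b) c dvd gcd (gcd a c * b) (gcd a c * c)" by (rule gcd_greatest)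
    then show ?thesis unfolding gcd_mult_distrib_nat[symmetric] .
  qed
  have pow: "gcd (a ^ k) c dvd gcd a c ^ k" for a k :: nat
  proof (induction k)
    case (Suc k)
    have "gcd (a ^ Suc k) c dvd gcd a c * gcd (a ^ k) c" using mult[of a "a ^ k"] by simp
    also have "\<dots> dvd gcd a c * gcd a c ^ k" using Suc by (intro mult_dvd_mono) auto
    finally show ?case by simp
  qed simp
  show ?thesis using assms
  proof (induction I rule: finite_induct)
    case (insert i I)
    have "gcd (\<Prod>i\<in>insert i I. x i ^ n i) c dvd gcd (x i ^ n i) c * gcd (\<Prod>i\<in>I. x i ^ n i) c"
      using mult[of "x i ^ n i" "\<Prod>i\<in>I. x i ^ n i"] insert by simp
    also have "\<dots> dvd gcd (x i) c ^ n i * (\<Prod>i\<in>I. gcd (x i) c ^ n i)"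
      by (intro mult_dvd_mono pow insert.IH)
    finally show ?case using insert by simp
  qed simp
qed

text \<open>The hypothesis concerns only pairs with positive exponents. In the application
  \<open>n\<close> and \<open>n'\<close> have disjoint supports, so that the gcd of a term with
  itself never enters.\<close>

lemma gcd_prod_prod_dvd:
  fixes x :: "'i \<Rightarrow> nat"
  assumes I: "finite I" and M: "\<And>i j. i \<in> I \<Longrightarrow> j \<in> I \<Longrightarrow> n i > 0 \<Longrightarrow> n' j > 0 \<Longrightarrow> gcd (x i) (x j) dvd M"
  shows "gcd (\<Prod>i\<in>I. x i ^ n i) (\<Prod>i\<in>I. x i ^ n' i) dvd M ^ ((\<Sum>i\<in>I. n' i) * (\<Sum>i\<in>I. n i))"
proof -
  define B where "B = (\<Prod>i\<in>I. x i ^ n' i)"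
  have "gcd (x i) B ^ n i dvd M ^ ((\<Sum>i\<in>I. n' i) * n i)" if i: "i \<in> I" for i
  proof (cases "n i = 0")
    case False
    have "gcd (x i) B dvd (\<Prod>j\<in>I. gcd (x j) (x i) ^ n' j)"
      unfolding B_def gcd.commute[of "x i"] by (rule gcd_prod_dvd[OF I])
    also have "\<dots> dvd (\<Prod>j\<in>I. M ^ n' j)"
    proof (rule prod_dvd_prod)
      fix j assume "j \<in> I"
      then show "gcd (x j) (x i) ^ n' j dvd M ^ n' j"
        using M[OF i, of j] False by (cases "n' j = 0") (auto intro: dvd_power_same simp: gcd.commute)
    qed
    also have "\<dots> = M ^ (\<Sum>i\<in>I. n' i)" by (rule power_sum[symmetric])
    finally show ?thesis unfolding power_mult by (rule dvd_power_same)
  qed simp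
  then have "(\<Prod>i\<in>I. gcd (x i) B ^ n i) dvd (\<Prod>i\<in>I. M ^ ((\<Sum>i\<in>I. n' i) * n i))"
    by (intro prod_dvd_prod) auto
  also have "\<dots> = M ^ ((\<Sum>i\<in>I. n' i) * (\<Sum>i\<in>I. n i))" by (simp add: power_sum[symmetric] sum_distrib_left)
  finally show ?thesis using gcd_prod_dvd[OF I, of x n B] unfolding B_def by (rule dvd_trans[rotated])
qed

text \<open>A common divisor of this gcd and \<open>u\<close> divides \<open>t\<close> too, so the
  gcd is coprime to \<open>u\<close> and divides the index difference. The conditional expresses |i
  - j| in natural numbers.\<close>

lemma gcd_linear_terms_dvd:
  fixes t u i j :: nat
  assumes "coprime t u"
  shows "gcd (t + i * u) (t + j * u) dvd (if i < j then j - i else i - j)"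
proof -
  define g where "g = gcd (t + i * u) (t + j * u)"
  have g: "g dvd t + i * u" "g dvd t + j * u" by (auto simp: g_def)
  have "coprime g u"
  proof (rule coprimeI)
    fix d assume d: "d dvd g" "d dvd u"
    then have "d dvd t + i * u" using g dvd_trans by blast
    then have "d dvd t" using d(2) by (simp add: dvd_add_left_iff)
    then show "is_unit d" using assms d(2) by (meson coprime_common_divisor)
  qed
  have diff: "g dvd (j - i) * u" if "i \<le> j" "g dvd t + i * u" "g dvd t + j * u" for i j
  proof -
    have "(t + j * u) - (t + i * u) = (j - i) * u" using that by (simp add: diff_mult_distrib)
    then show ?thesis using dvd_diff_nat[OF that(3,2)] by simp
  qed
  have "g dvd (if i < j then j - i else i - j) * u" using diff[of i j] diff[of j i] g by auto
  then show ?thesis using \<open>coprime g u\<close> unfolding g_def[symmetric] by (simp add: coprime_dvd_mult_left_iff)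
qed

text \<open>Four equations in five unknowns have a nonzero integer solution; \<open>n\<close> and
  \<open>n'\<close> are its positive and negative parts. The equation for k = 0 gives them equal
  total degree, so neither part is zero.\<close>

lemma balanced_exponents:
  fixes I :: "nat set"
  assumes I: "finite I" "card I = 5"
  shows "\<exists>n n' :: nat \<Rightarrow> nat. (\<forall>k\<le>3. (\<Sum>i\<in>I. n i * i ^ k) = (\<Sum>i\<in>I. n' i * i ^ k)) \<and>
    (\<forall>i. n i = 0 \<or> n' i = 0) \<and> (\<exists>i\<in>I. n i > 0) \<and> (\<exists>i\<in>I. n' i > 0)"
proof -
  have "card {..3::nat} < card I" using I by simp
  then have "\<exists>r :: nat \<Rightarrow> int. (\<exists>i\<in>I. r i \<noteq> 0) \<and> (\<forall>k\<in>{..3}. (\<Sum>i\<in>I. int i ^ k * r i) = 0)"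
    by (intro homogeneous_system_kernel I) auto
  then obtain r :: "nat \<Rightarrow> int" where r': "(\<exists>i\<in>I. r i \<noteq> 0) \<and> (\<forall>k\<in>{..3}. (\<Sum>i\<in>I. int i ^ k * r i) = 0)"
    by (rule exE)
  note r = conjunct1[OF r'] conjunct2[OF r']
  define n n' where "n i = nat (r i)" and "n' i = nat (- r i)" for i
  have eq: "(\<Sum>i\<in>I. n i * i ^ k) = (\<Sum>i\<in>I. n' i * i ^ k)" if "k \<le> 3" for k
  proof -
    have "int (\<Sum>i\<in>I. n i * i ^ k) - int (\<Sum>i\<in>I. n' i * i ^ k) = (\<Sum>i\<in>I. int i ^ k * r i)"
      unfolding of_nat_sum sum_subtractf[symmetric]
      by (intro sum.cong) (auto simp: n_def n'_def algebra_simps nat_0_iff split: nat_diff_split)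
    also have "\<dots> = 0" using bspec[OF r(2), of k] that by simp
    finally show ?thesis by (simp only: right_minus_eq of_nat_eq_iff)
  qed
  have "(\<Sum>i\<in>I. n i) = (\<Sum>i\<in>I. n' i)" using eq[of 0] by simp
  moreover have "(\<exists>i\<in>I. n i > 0) \<or> (\<exists>i\<in>I. n' i > 0)"
  proof -
    obtain i where "i \<in> I" "r i \<noteq> 0" using r(1) by blast
    then show ?thesis unfolding n_def n'_def by (cases "r i > 0") force+
  qed
  ultimately have "\<exists>i\<in>I. n i > 0" "\<exists>i\<in>I. n' i > 0"
    using I(1) by (metis gr0I sum_eq_0_iff)+
  moreover have "\<forall>i. n i = 0 \<or> n' i = 0" by (auto simp: n_def n'_def)
  ultimately show ?thesis using eq by (intro exI[of _ n] exI[of _ n'] conjI allI impI) simp_all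
qed

text \<open>The five terms contribute H^(5/2) to the radical of A B (A - B), the factor u^4 only H,
  and the cofactor \<open>C\<close> at most H^(D - 4) up to constants: together H^(D - 1/2). The
  larger of A and B is at least H^D / m^D, so ABC bounds H and thereby u.\<close>

lemma five_terms_bound_single:
  assumes abc: ABC_conjecture and I: "I \<subseteq> {1..m}" "card I = 5"
  shows "\<exists>h::real. \<forall>t u. t > 0 \<longrightarrow> u > 0 \<longrightarrow> coprime t u \<longrightarrow>
    (\<forall>i\<in>I. nrad (t + i * u) \<le> real m * sqrt (real (t + i * u))) \<longrightarrow> real u \<le> h"
proof -
  have finI: "finite I" using I finite_subset by blast
  obtain n n' :: "nat \<Rightarrow> nat" where nn': "(\<forall>k\<le>3. (\<Sum>i\<in>I. n i * i ^ k) = (\<Sum>i\<in>I. n' i * i ^ k)) \<and>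
    (\<forall>i. n i = 0 \<or> n' i = 0) \<and> (\<exists>i\<in>I. n i > 0) \<and> (\<exists>i\<in>I. n' i > 0)"
    using balanced_exponents[OF finI I(2)] by (elim exE)
  have nn: "\<And>k. k \<le> 3 \<Longrightarrow> (\<Sum>i\<in>I. n i * i ^ k) = (\<Sum>i\<in>I. n' i * i ^ k)"
    "\<And>i. n i = 0 \<or> n' i = 0" "\<exists>i\<in>I. n i > 0" "\<exists>i\<in>I. n' i > 0"
    using nn' by simp_all
  define D where "D = (\<Sum>i\<in>I. n i)"
  have D': "(\<Sum>i\<in>I. n' i) = D" using nn(1)[of 0] by (simp add: D_def)
  obtain i0 where i0: "i0 \<in> I" "n i0 > 0" using nn(3) by blast
  have D1: "D \<ge> 1" using member_le_sum[of i0 I n] i0 finI by (simp add: D_def)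
  \<comment> \<open>Small enough for (D - 1/2) (1 + \<epsilon>) \<le> D - 1/4. What remains is
    H^(1/4) \<le> \<open>K'\<close>, hence the fourth power in \<open>h\<close>.\<close>
  define \<epsilon> where "\<epsilon> = 1 / (4 * real D)"
  have \<epsilon>: "\<epsilon> > 0" using D1 by (simp add: \<epsilon>_def)
  obtain K where K: "K > 0" "\<And>a b c :: nat. a > 0 \<Longrightarrow> b > 0 \<Longrightarrow> a + b = c \<Longrightarrow>
    real c \<le> K * real (gcd a b) * nrad (a * b * c) powr (1 + \<epsilon>)"
    using abc_gcd[OF abc \<epsilon>] by blast
  define \<delta> where "\<delta> k = coeff (\<Prod>i\<in>I. [:1, int i:] ^ n i) k - coeff (\<Prod>i\<in>I. [:1, int i:] ^ n' i) k" for k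
  define G where "G = (fact m :: nat) ^ (D * D)"
  define L where "L = 1 + (\<Sum>k\<in>{4..D}. real_of_int \<bar>\<delta> k\<bar>)"
  have L1: "L \<ge> 1" by (simp add: L_def sum_nonneg)
  define K' where "K' = real m ^ D * (K * real G * (real m ^ 5 * L) powr (1 + \<epsilon>))"
  define h where "h = real G + K' ^ 4"
  have m1: "m \<ge> 1" using I i0 by auto
  have K'0: "K' \<ge> 0" using K L1 by (simp add: K'_def)
  have "real u \<le> h" if t: "t > 0" and u: "u > 0" and cop: "coprime t u"
    and rad: "\<forall>i\<in>I. nrad (t + i * u) \<le> real m * sqrt (real (t + i * u))" for t u
  proof -
    define A B where "A = (\<Prod>i\<in>I. (t + i * u) ^ n i)" and "B = (\<Prod>i\<in>I. (t + i * u) ^ n' i)"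
    have pos: "t + i * u > 0" for i using t by simp
    have AB: "A > 0" "B > 0" unfolding A_def B_def using pos by (auto intro!: prod_pos)
    have gAB: "gcd A B \<le> G"
    proof -
      have "gcd A B dvd (fact m) ^ ((\<Sum>i\<in>I. n' i) * (\<Sum>i\<in>I. n i))"
        unfolding A_def B_def
      proof (rule gcd_prod_prod_dvd[OF finI])
        fix i j assume ij: "i \<in> I" "j \<in> I" "n i > 0" "n' j > 0"
        then have "i \<noteq> j" using nn(2)[of i] by auto
        define e where "e = (if i < j then j - i else i - j)"
        have "gcd (t + i * u) (t + j * u) dvd e" unfolding e_def by (rule gcd_linear_terms_dvd[OF cop])
        moreover have "e dvd fact m" using \<open>i \<noteq> j\<close> ij I by (intro dvd_fact) (auto simp: e_def)
        ultimately show "gcd (t + i * u) (t + j * u) dvd fact m" by (rule dvd_trans)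
      qed
      then have "gcd A B dvd G" by (simp add: G_def D' D_def)
      then show ?thesis by (rule dvd_imp_le) (simp add: G_def)
    qed
    show ?thesis
    proof (cases "A = B")
      \<comment> \<open>ABC cannot be applied to A - B = 0, but then A equals gcd A B \<le> G, while
        A has a factor at least u.\<close>
      case True
      have "(t + i0 * u) ^ n i0 dvd A"
        unfolding A_def using finI i0 by (intro dvd_prodI[where f="\<lambda>i. (t + i * u) ^ n i"]) auto
      then have A_ge: "(t + i0 * u) ^ n i0 \<le> A" using AB by (intro dvd_imp_le)
      have "u \<le> t + i0 * u" using i0 I by (cases i0) auto
      also have "\<dots> \<le> (t + i0 * u) ^ n i0" using i0 pos[of i0] by (intro self_le_power) (auto simp: Suc_le_eq)
      also have "\<dots> \<le> A" by (rule A_ge)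
      also have "A \<le> G" using gAB True by simp
      finally have "real u \<le> real G" by (rule of_nat_mono)
      then show ?thesis using zero_le_power[OF K'0, of 4] unfolding h_def by linarith
    next
      case False
      define H where "H = t + m * u"
      have H: "t \<le> H" "u \<le> H" using m1 by (auto simp: H_def intro: trans_le_add2)
      have H1: "real H \<ge> 1" using H t by linarith
      have le_H: "t + i * u \<le> H" if "i \<in> I" for i using that I by (auto simp: H_def)
      have H_le: "H \<le> m * (t + i * u)" if "i \<in> I" for i
      proof -
        have "i \<ge> 1" using that I by auto
        have "1 * t \<le> m * t" using m1 by (intro mult_right_mono) auto
        moreover have "(m * u) * 1 \<le> (m * u) * i" using \<open>i \<ge> 1\<close> by (intro mult_left_mono) auto
        moreover have "m * (t + i * u) = m * t + (m * u) * i" by (simp add: algebra_simps)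
        ultimately show ?thesis unfolding H_def by linarith
      qed
      define C where "C = (\<Sum>k\<in>{4..D}. \<delta> k * int u ^ (k - 4) * int t ^ (D - k))"
      have diff: "int A - int B = int u ^ 4 * C"
      proof -
        have hom: "(\<Sum>k\<le>D. coeff (\<Prod>i\<in>I. [:1, int i:] ^ n i) k * int u ^ k * int t ^ (D - k)) = int A"
          "(\<Sum>k\<le>D. coeff (\<Prod>i\<in>I. [:1, int i:] ^ n' i) k * int u ^ k * int t ^ (D - k)) = int B"
          using homogenize_prod_linear_powers[OF finI, of n "int u" "int t"]
            homogenize_prod_linear_powers[OF finI, of n' "int u" "int t"]
          unfolding D_def[symmetric] D' by (simp_all add: A_def B_def)
        have "int A - int B = (\<Sum>k\<le>D. \<delta> k * int u ^ k * int t ^ (D - k))"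
          unfolding hom[symmetric] sum_subtractf[symmetric] by (simp add: \<delta>_def algebra_simps)
        also have "\<dots> = (\<Sum>k\<in>{4..D}. \<delta> k * int u ^ k * int t ^ (D - k))"
        proof (rule sum.mono_neutral_right)
          show "\<forall>k\<in>{..D} - {4..D}. \<delta> k * int u ^ k * int t ^ (D - k) = 0"
          proof
            fix k assume "k \<in> {..D} - {4..D}"
            then have "k \<le> 3" by auto
            then have "\<delta> k = 0" using power_sums_imp_coeffs_eq[OF finI nn(1), of 3 k] by (simp add: \<delta>_def)
            then show "\<delta> k * int u ^ k * int t ^ (D - k) = 0" by simp
          qed
        qed auto
        also have "\<dots> = int u ^ 4 * C" unfolding C_def sum_distrib_left
        proof (rule sum.cong)
          fix k assume "k \<in> {4..D}"
          then have "int u ^ k = int u ^ 4 * int u ^ (k - 4)" by (simp add: power_add[symmetric])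
          then show "\<delta> k * int u ^ k * int t ^ (D - k) = int u ^ 4 * (\<delta> k * int u ^ (k - 4) * int t ^ (D - k))"
            by (simp only: mult_ac)
        qed simp
        finally show ?thesis .
      qed
      then have C0: "C \<noteq> 0" using False by auto
      have D4: "D \<ge> 4"
      proof (rule ccontr)
        assume "\<not> D \<ge> 4"
        then have "C = 0" by (simp add: C_def)
        then show False using C0 by simp
      qed
      have C_le: "real (nat \<bar>C\<bar>) \<le> L * real H ^ (D - 4)"
      proof -
        have "real (nat \<bar>C\<bar>) = \<bar>\<Sum>k\<in>{4..D}. real_of_int (\<delta> k) * real u ^ (k - 4) * real t ^ (D - k)\<bar>"
          by (simp add: C_def)
        also have "\<dots> \<le> (\<Sum>k\<in>{4..D}. \<bar>real_of_int (\<delta> k) * real u ^ (k - 4) * real t ^ (D - k)\<bar>)" by (rule sum_abs)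
        also have "\<dots> \<le> (\<Sum>k\<in>{4..D}. real_of_int \<bar>\<delta> k\<bar> * real H ^ (D - 4))"
        proof (rule sum_mono)
          fix k assume k: "k \<in> {4..D}"
          have "real u ^ (k - 4) * real t ^ (D - k) \<le> real H ^ (k - 4) * real H ^ (D - k)"
            using H by (intro mult_mono power_mono) auto
          also have "\<dots> = real H ^ (D - 4)" using k by (simp add: power_add[symmetric])
          finally have "\<bar>real_of_int (\<delta> k)\<bar> * (real u ^ (k - 4) * real t ^ (D - k)) \<le> \<bar>real_of_int (\<delta> k)\<bar> * real H ^ (D - 4)"
            by (intro mult_left_mono) auto
          then show "\<bar>real_of_int (\<delta> k) * real u ^ (k - 4) * real t ^ (D - k)\<bar> \<le> real_of_int \<bar>\<delta> k\<bar> * real H ^ (D - 4)"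
            by (simp add: abs_mult mult.assoc)
        qed
        also have "\<dots> = (\<Sum>k\<in>{4..D}. real_of_int \<bar>\<delta> k\<bar>) * real H ^ (D - 4)" by (rule sum_distrib_right[symmetric])
        also have "\<dots> \<le> L * real H ^ (D - 4)" by (intro mult_right_mono) (auto simp: L_def)
        finally show ?thesis .
      qed
      define e where "e = u ^ 4 * nat \<bar>C\<bar>"
      have e0: "e > 0" using u C0 by (simp add: e_def)
      have int_e: "int e = \<bar>int A - int B\<bar>" unfolding diff e_def by (simp add: abs_mult)
      \<comment> \<open>The smaller of A and B plus their distance \<open>e\<close> is the larger
        one, which gives the sum of positive numbers that \<open>abc_gcd\<close> expects.\<close>
      define a where "a = min A B"
      define c where "c = max A B"
      have ac: "a > 0" "a + e = c" using AB int_e by (auto simp: a_def c_def min_def max_def)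
      have prod: "a * c = A * B" by (auto simp: a_def c_def min_def max_def)
      have gcd: "gcd a e \<le> G"
      proof -
        have "gcd a e dvd a" "gcd a e dvd c" using ac(2) by (auto simp flip: ac(2))
        then have "gcd a e dvd A" "gcd a e dvd B" by (auto simp: a_def c_def min_def max_def split: if_splits)
        then have "gcd a e dvd gcd A B" by simp
        then have "gcd a e \<le> gcd A B" using AB by (intro dvd_imp_le) auto
        then show ?thesis using gAB by simp
      qed
      have rad_le: "nrad (a * e * c) \<le> (real m ^ 5 * L) * real H powr (real D - 1/2)"
      proof -
        have "nrad (a * e * c) = nrad ((A * B) * e)" unfolding prod[symmetric] by (simp add: mult_ac)
        also have "\<dots> \<le> nrad (A * B) * nrad e" using AB e0 by (intro nrad_mult_le) auto
        finally have r0: "nrad (a * e * c) \<le> nrad (A * B) * nrad e" .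
        have r1: "nrad (A * B) \<le> (real m * sqrt (real H)) ^ 5"
        proof -
          have AB_eq: "A * B = (\<Prod>i\<in>I. (t + i * u) ^ (n i + n' i))"
            by (simp add: A_def B_def power_add prod.distrib)
          have "nrad (A * B) \<le> (\<Prod>i\<in>I. nrad ((t + i * u) ^ (n i + n' i)))"
            unfolding AB_eq by (rule nrad_prod_le[OF finI]) (rule zero_less_power[OF pos])
          also have "\<dots> \<le> (\<Prod>i\<in>I. real m * sqrt (real H))"
          proof (rule prod_mono)
            fix i assume i: "i \<in> I"
            have "nrad ((t + i * u) ^ (n i + n' i)) \<le> nrad (t + i * u)"
            proof (cases "n i + n' i = 0")
              case True then show ?thesis using nrad_ge_1[of "t + i * u"] by (simp add: rad_def)
            next
              case False
              then have "nrad ((t + i * u) ^ (n i + n' i)) = nrad (t + i * u)" by (intro nrad_power) simp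
              then show ?thesis by simp
            qed
            also have "\<dots> \<le> real m * sqrt (real (t + i * u))" using rad i by blast
            also have "\<dots> \<le> real m * sqrt (real H)" using le_H[OF i] by (intro mult_left_mono real_sqrt_le_mono of_nat_mono) auto
            finally show "0 \<le> nrad ((t + i * u) ^ (n i + n' i)) \<and> nrad ((t + i * u) ^ (n i + n' i)) \<le> real m * sqrt (real H)"
              using nrad_ge_1[of "(t + i * u) ^ (n i + n' i)"] by linarith
          qed
          finally show ?thesis using I(2) by simp
        qed
        have r2: "nrad e \<le> real H * (L * real H ^ (D - 4))"
        proof -
          have "nrad e \<le> nrad (u ^ 4) * nrad (nat \<bar>C\<bar>)" unfolding e_def using u C0 by (intro nrad_mult_le) auto
          also have "nrad (u ^ 4) = nrad u" by (intro nrad_power) simp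
          also have "nrad u * nrad (nat \<bar>C\<bar>) \<le> real H * (L * real H ^ (D - 4))"
          proof (intro mult_mono)
            show "nrad u \<le> real H" using nrad_le[OF u] H(2) by linarith
            show "nrad (nat \<bar>C\<bar>) \<le> L * real H ^ (D - 4)" using nrad_le[of "nat \<bar>C\<bar>"] C0 C_le by linarith
            show "0 \<le> nrad (nat \<bar>C\<bar>)" using nrad_ge_1[of "nat \<bar>C\<bar>"] by linarith
          qed auto
          finally show ?thesis .
        qed
        note r0
        also have "nrad (A * B) * nrad e \<le> (real m * sqrt (real H)) ^ 5 * (real H * (L * real H ^ (D - 4)))"
          using nrad_ge_1[of e] by (intro mult_mono r1 r2) auto
        also have "(real m * sqrt (real H)) ^ 5 * (real H * (L * real H ^ (D - 4)))
            = (real m ^ 5 * L) * (sqrt (real H) ^ 5 * real H ^ 1 * real H ^ (D - 4))"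
          by (simp add: power_mult_distrib mult_ac)
        also have "sqrt (real H) ^ 5 * real H ^ 1 * real H ^ (D - 4) = real H powr (real D - 1/2)"
        proof -
          have "sqrt (real H) ^ 5 = (real H powr (1/2)) ^ 5" using H1 by (simp add: powr_half_sqrt)
          also have "\<dots> = real H powr (5/2)" using H1 by (simp add: powr_realpow[symmetric] powr_powr)
          finally have "sqrt (real H) ^ 5 * real H ^ 1 * real H ^ (D - 4) = real H powr (5/2) * real H powr 1 * real H powr (real (D - 4))"
            using H1 by (simp add: powr_realpow)
          also have "\<dots> = real H powr (5/2 + 1 + real (D - 4))" by (simp only: powr_add)
          also have "5/2 + 1 + real (D - 4) = real D - 1/2" using D4 by (simp add: of_nat_diff)
          finally show ?thesis .
        qed
        finally show ?thesis .
      qed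
      have "real H ^ D \<le> real m ^ D * real A"
      proof -
        have "H ^ D = (\<Prod>i\<in>I. H ^ n i)" by (simp add: D_def power_sum)
        also have "\<dots> \<le> (\<Prod>i\<in>I. m ^ n i * (t + i * u) ^ n i)"
          using H_le by (intro prod_mono) (auto simp: power_mult_distrib[symmetric] intro!: power_mono)
        also have "\<dots> = m ^ D * A" by (simp add: prod.distrib A_def D_def power_sum)
        finally have "real (H ^ D) \<le> real (m ^ D * A)" by (rule of_nat_mono)
        then show ?thesis by simp
      qed
      also have "\<dots> \<le> real m ^ D * real c" by (intro mult_left_mono) (auto simp: c_def)
      also have "\<dots> \<le> real m ^ D * (K * real G * ((real m ^ 5 * L) * real H powr (real D - 1/2)) powr (1 + \<epsilon>))"
      proof (intro mult_left_mono)
        have "real c \<le> K * real (gcd a e) * nrad (a * e * c) powr (1 + \<epsilon>)" by (rule K(2)[OF ac(1) e0 ac(2)])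
        also have "\<dots> \<le> K * real G * ((real m ^ 5 * L) * real H powr (real D - 1/2)) powr (1 + \<epsilon>)"
          using K gcd rad_le \<epsilon> nrad_ge_1[of "a * e * c"] by (intro mult_mono powr_mono2) auto
        finally show "real c \<le> K * real G * ((real m ^ 5 * L) * real H powr (real D - 1/2)) powr (1 + \<epsilon>)" .
      qed auto
      also have "\<dots> = K' * real H powr ((real D - 1/2) * (1 + \<epsilon>))"
        using L1 by (simp add: K'_def powr_mult powr_powr mult_ac)
      also have "\<dots> \<le> K' * real H powr (real D - 1/4)"
      proof (intro mult_left_mono powr_mono K'0 H1)
        show "(real D - 1/2) * (1 + \<epsilon>) \<le> real D - 1/4" using D1 by (simp add: \<epsilon>_def field_simps)
      qed
      finally have "real H powr (real D - 1/4) * real H powr (1/4) \<le> real H powr (real D - 1/4) * K'"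
        using H1 by (simp add: powr_add[symmetric] powr_realpow mult.commute)
      then have "real H powr (1/4) \<le> K'" using H1 by simp
      then have "(real H powr (1/4)) ^ 4 \<le> K' ^ 4" by (intro power_mono) auto
      moreover have "(real H powr (1/4)) ^ 4 = real H" using H1 by (simp add: powr_realpow[symmetric] powr_powr)
      ultimately show ?thesis using H(2) unfolding h_def by linarith
    qed
  qed
  then show ?thesis by (intro exI[of _ h]) blast
qed

text \<open>Only finitely many \<open>I\<close> lie in {1..m}; summing their bounds gives an
  \<open>h\<close> that depends on \<open>m\<close> alone.\<close>

lemma five_terms_bound:
  assumes ABC_conjecture
  obtains h :: real where "\<And>I t u. \<lbrakk>I \<subseteq> {1..m}; card I = 5; t > 0; u > 0; coprime t u;
    \<forall>i\<in>I. nrad (t + i * u) \<le> real m * sqrt (real (t + i * u))\<rbrakk> \<Longrightarrow> real u \<le> h"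
proof -
  define \<I> where "\<I> = {I. I \<subseteq> {1..m} \<and> card I = 5}"
  have "\<forall>I\<in>\<I>. \<exists>h::real. \<forall>t u. t > 0 \<longrightarrow> u > 0 \<longrightarrow> coprime t u \<longrightarrow>
    (\<forall>i\<in>I. nrad (t + i * u) \<le> real m * sqrt (real (t + i * u))) \<longrightarrow> real u \<le> h"
    using five_terms_bound_single[OF assms] by (auto simp: \<I>_def)
  then obtain h where h: "\<And>I t u. I \<in> \<I> \<Longrightarrow> t > 0 \<Longrightarrow> u > 0 \<Longrightarrow> coprime t u \<Longrightarrow>
    (\<forall>i\<in>I. nrad (t + i * u) \<le> real m * sqrt (real (t + i * u))) \<Longrightarrow> real u \<le> h I"
    by metis
  have fin: "finite \<I>" unfolding \<I>_def by (rule finite_subset[of _ "Pow {1..m}"]) auto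
  show thesis
  proof (rule that[of "\<Sum>I\<in>\<I>. \<bar>h I\<bar>"])
    fix I t u
    assume *: "I \<subseteq> {1..m}" "card I = 5" "t > 0" "u > 0" "coprime t u"
      "\<forall>i\<in>I. nrad (t + i * u) \<le> real m * sqrt (real (t + i * u))"
    then have "real u \<le> h I" by (intro h) (auto simp: \<I>_def)
    also have "h I \<le> \<bar>h I\<bar>" by simp
    also have "\<dots> \<le> (\<Sum>I\<in>\<I>. \<bar>h I\<bar>)" using fin * by (intro member_le_sum) (auto simp: \<I>_def)
    finally show "real u \<le> (\<Sum>I\<in>\<I>. \<bar>h I\<bar>)" .
  qed
qed

section \<open>Progressions of perfect powers\<close>

text \<open>A single term says little, as \<open>g\<close> may be arbitrary. Two terms with the same
  exponent determine \<open>g\<close> up to a small factor: for w = gcd x y one has w^q = g f with f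
  dividing the index difference, so t + i u = f X^q with f \<le> m and q \<ge> 2.\<close>

lemma same_exponent_rad_le:
  fixes t u g x y q i j m :: nat
  assumes g: "g > 0" and t: "t > 0" and cop: "coprime t u" and q: "q \<ge> 2"
    and x: "g * (t + i * u) = x ^ q" and y: "g * (t + j * u) = y ^ q"
    and ij: "i \<noteq> j" "i \<le> m" "j \<le> m"
  shows "nrad (t + i * u) \<le> real m * sqrt (real (t + i * u))"
proof -
  define w where "w = gcd x y"
  define e where "e = (if i < j then j - i else i - j)"
  have e: "e > 0" "e \<le> m" using ij by (auto simp: e_def)
  have "g dvd x ^ q" "g dvd y ^ q" using x y by (metis dvd_triv_left)+
  then have "g dvd w ^ q" unfolding w_def gcd_exp[symmetric] by (rule gcd_greatest)
  then obtain f where f: "w ^ q = g * f" by blast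
  have "w ^ q dvd x ^ q" "w ^ q dvd y ^ q" by (auto simp: w_def intro!: dvd_power_same)
  then have "w ^ q dvd gcd (g * (t + i * u)) (g * (t + j * u))" unfolding x y by (rule gcd_greatest)
  then have "w ^ q dvd g * gcd (t + i * u) (t + j * u)" unfolding gcd_mult_distrib_nat .
  also have "\<dots> dvd g * e"
    unfolding e_def using gcd_linear_terms_dvd[OF cop] by (intro mult_dvd_mono) auto
  finally have "f dvd e" using g unfolding f by simp
  then have fm: "f > 0" "f \<le> m" using e by (auto intro: Nat.gr0I dest: dvd_imp_le)
  obtain X where X: "x = w * X" unfolding w_def by (metis gcd_dvd1 dvdE)
  have "g * (t + i * u) = g * (f * X ^ q)"
    using x unfolding X power_mult_distrib f by (simp add: mult.assoc)
  then have tiu: "t + i * u = f * X ^ q" using g by simp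
  have X0: "X > 0" using tiu t q by (cases X) (auto simp: zero_power)
  have "nrad (t + i * u) \<le> nrad f * nrad (X ^ q)" unfolding tiu using fm X0 by (intro nrad_mult_le) auto
  also have "nrad (X ^ q) = nrad X" using q by (intro nrad_power) simp
  also have "nrad f * nrad X \<le> real m * sqrt (real (t + i * u))"
  proof (intro mult_mono)
    show "nrad f \<le> real m" using nrad_le[OF fm(1)] fm(2) by linarith
    have "X ^ 2 \<le> X ^ q" using X0 q by (intro power_increasing) auto
    also have "\<dots> \<le> t + i * u" unfolding tiu using fm by simp
    finally have "real (X ^ 2) \<le> real (t + i * u)" by (rule of_nat_mono)
    then have "real X \<le> sqrt (real (t + i * u))" by (intro real_le_rsqrt) simp
    then show "nrad X \<le> sqrt (real (t + i * u))" using nrad_le[OF X0] by linarith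
    show "0 \<le> nrad X" using nrad_ge_1[of X] by linarith
  qed auto
  finally show ?thesis .
qed

text \<open>Shifting the window to the origin replaces t by t + b u, which is still coprime to u.
  Among five indices with exponent q each has a partner, so \<open>same_exponent_rad_le\<close>
  provides the radical hypothesis of \<open>h\<close>.\<close>

lemma same_exponent_window:
  fixes t u g q m b :: nat and h :: real
  assumes h: "\<And>I t u. \<lbrakk>I \<subseteq> {1..m}; card I = 5; t > 0; u > 0; coprime t u;
      \<forall>i\<in>I. nrad (t + i * u) \<le> real m * sqrt (real (t + i * u))\<rbrakk> \<Longrightarrow> real u \<le> h"
    and g: "g > 0" and t: "t > 0" "u > 0" and cop: "coprime t u" and q: "q \<ge> 2" and u: "real u > h"
  shows "card {j \<in> {b + 1..b + m}. \<exists>x>0. g * (t + j * u) = x ^ q} \<le> 4"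
proof (rule ccontr)
  define J where "J = {j \<in> {b + 1..b + m}. \<exists>x>0. g * (t + j * u) = x ^ q}"
  assume "\<not> ?thesis"
  then have "card J \<ge> 5" by (simp add: J_def)
  then obtain J' where J': "J' \<subseteq> J" "card J' = 5" using obtain_subset_with_card_n[of 5 J] by auto
  define I where "I = (\<lambda>j. j - b) ` J'"
  have J'b: "j > b" "j \<le> b + m" if "j \<in> J'" for j using that J' by (auto simp: J_def)
  have inj: "inj_on (\<lambda>j. j - b) J'"
  proof (rule inj_onI)
    fix x y assume "x \<in> J'" "y \<in> J'" "x - b = y - b"
    then show "x = y" using J'b(1)[of x] J'b(1)[of y] by linarith
  qed
  have cI: "card I = 5" unfolding I_def using J' inj by (simp add: card_image)
  have Im: "I \<subseteq> {1..m}"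
  proof
    fix i assume "i \<in> I"
    then obtain j where "j \<in> J'" "i = j - b" by (auto simp: I_def)
    then show "i \<in> {1..m}" using J'b[of j] by auto
  qed
  have pow: "\<exists>x. g * ((t + b * u) + i * u) = x ^ q" if i: "i \<in> I" for i
  proof -
    obtain j where j: "j \<in> J'" "i = j - b" using i by (auto simp: I_def)
    have eq: "(t + b * u) + i * u = t + j * u"
      using J'b[OF j(1)] by (simp add: j(2) add.assoc flip: distrib_right)
    obtain x where "g * (t + j * u) = x ^ q" using j(1) J'(1) by (auto simp: J_def)
    then have "g * ((t + b * u) + i * u) = x ^ q" by (simp only: eq)
    then show ?thesis ..
  qed
  have "real u \<le> h"
  proof (rule h[OF Im cI])
    show cop': "coprime (t + b * u) u" using cop gcd_add_mult[of u b t]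
      by (simp only: coprime_iff_gcd_eq_1 gcd.commute[of _ u] add.commute[of t])
    show "\<forall>i\<in>I. nrad ((t + b * u) + i * u) \<le> real m * sqrt (real ((t + b * u) + i * u))"
    proof
      fix i assume i: "i \<in> I"
      have "\<not> I \<subseteq> {i}"
      proof
        assume "I \<subseteq> {i}"
        then have "card I \<le> card {i}" by (intro card_mono) auto
        then show False using cI by simp
      qed
      then obtain j where j: "j \<in> I" "j \<noteq> i" by auto
      obtain x y where xy: "g * ((t + b * u) + i * u) = x ^ q" "g * ((t + b * u) + j * u) = y ^ q"
        using pow i j by blast
      show "nrad ((t + b * u) + i * u) \<le> real m * sqrt (real ((t + b * u) + i * u))"
        by (rule same_exponent_rad_le[OF g _ cop' q xy]) (use t i j Im in auto)
    qed
  qed (use t in auto)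
  then show False using u by simp
qed

lemma card_le_of_windows:
  fixes P :: "nat \<Rightarrow> bool"
  assumes w: "w > 0" and win: "\<And>b. card {j \<in> {b + 1..b + w}. P j} \<le> c"
  shows "real (card {j \<in> {1..l}. P j}) \<le> real c * (real l / real w + 1)"
proof -
  have "{j \<in> {1..l}. P j} \<subseteq> (\<Union>i\<le>l div w. {j \<in> {i * w + 1..i * w + w}. P j})"
  proof
    fix j assume j: "j \<in> {j \<in> {1..l}. P j}"
    define i where "i = (j - 1) div w"
    have "i * w \<le> j - 1" "j - 1 < i * w + w"
      using mod_less_divisor[OF w, of "j - 1"] div_mult_mod_eq[of "j - 1" w] unfolding i_def by linarith+
    moreover have "i \<le> l div w" unfolding i_def using j by (intro div_le_mono) auto
    ultimately show "j \<in> (\<Union>i\<le>l div w. {j \<in> {i * w + 1..i * w + w}. P j})"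
      using j by (intro UN_I[of i]) auto
  qed
  then have "card {j \<in> {1..l}. P j} \<le> card (\<Union>i\<le>l div w. {j \<in> {i * w + 1..i * w + w}. P j})"
    by (intro card_mono) auto
  also have "\<dots> \<le> (\<Sum>i\<le>l div w. card {j \<in> {i * w + 1..i * w + w}. P j})" by (rule card_UN_le) simp
  also have "\<dots> \<le> (\<Sum>i\<le>l div w. c)" by (intro sum_mono win)
  also have "\<dots> = c * (l div w + 1)" by simp
  finally have "real (card {j \<in> {1..l}. P j}) \<le> real (c * (l div w + 1))" by (rule of_nat_mono)
  also have "\<dots> = real c * (real (l div w) + 1)" by (simp add: algebra_simps)
  also have "\<dots> \<le> real c * (real l / real w + 1)" by (intro mult_left_mono add_mono of_nat_div_le_of_nat) auto
  finally show ?thesis .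
qed

lemma dvd_Gcd_power:
  fixes X :: "nat set"
  assumes "finite X" "X \<noteq> {}" "\<And>x. x \<in> X \<Longrightarrow> g dvd x ^ q"
  shows "g dvd Gcd X ^ q"
  using assms
proof (induction X rule: finite_ne_induct)
  case (insert x X)
  then have "g dvd gcd (x ^ q) (Gcd X ^ q)" by (intro gcd_greatest) auto
  then show ?case by simp
qed simp

lemma power_add_ge: "(z::nat) ^ q + d ^ q \<le> (z + d) ^ q" if "q > 0"
  using that
proof (induction q rule: nat_induct_non_zero)
  case (Suc q)
  have "z * z ^ q + d * d ^ q \<le> (z + d) * (z ^ q + d ^ q)" by (simp add: algebra_simps)
  also have "\<dots> \<le> (z + d) * (z + d) ^ q" using Suc by (intro mult_left_mono) auto
  finally show ?case by simp
qed simp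

text \<open>The counterpart of \<open>same_exponent_window\<close> for bounded u. Dividing by the
  gcd of all the roots gives t + j u = f z_j^q with distinct z_j, and (z_j - z_j0)^2 \<le> (j - j0)
  u \<le> h l confines them to an interval of length sqrt (h l).\<close>

lemma same_exponent_count:
  fixes t u g q l :: nat and h :: real
  assumes g: "g > 0" and t: "t > 0" "u > 0" and q: "q \<ge> 2" and u: "real u \<le> h"
  shows "real (card {j \<in> {1..l}. \<exists>x>0. g * (t + j * u) = x ^ q}) \<le> 1 + sqrt (h * real l)"
proof (cases "{j \<in> {1..l}. \<exists>x>0. g * (t + j * u) = x ^ q} = {}")
  case False
  define J where "J = {j \<in> {1..l}. \<exists>x>0. g * (t + j * u) = x ^ q}"
  have finJ: "finite J" and neJ: "J \<noteq> {}" using False by (auto simp: J_def)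
  define x where "x j = (SOME x. x > 0 \<and> g * (t + j * u) = x ^ q)" for j
  have x: "x j > 0 \<and> g * (t + j * u) = x j ^ q" if "j \<in> J" for j
  proof -
    have "\<exists>x>0. g * (t + j * u) = x ^ q" using that by (simp add: J_def)
    then show ?thesis unfolding x_def by (rule someI_ex)
  qed
  define w where "w = Gcd (x ` J)"
  have "g dvd w ^ q" unfolding w_def
  proof (rule dvd_Gcd_power)
    fix y assume "y \<in> x ` J"
    then show "g dvd y ^ q" using x by (metis dvd_triv_left imageE)
  qed (use finJ neJ in auto)
  then obtain f where f: "w ^ q = g * f" by blast
  define z where "z j = x j div w" for j
  have z: "x j = w * z j" if "j \<in> J" for j
  proof -
    have "w dvd x j" unfolding w_def using that by (intro Gcd_dvd) auto
    then show ?thesis by (simp add: z_def)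
  qed
  have fz: "t + j * u = f * z j ^ q" if "j \<in> J" for j
  proof -
    have "g * (t + j * u) = w ^ q * z j ^ q" using x[OF that] z[OF that] by (metis power_mult_distrib)
    then show ?thesis using g unfolding f by simp
  qed
  have f0: "f > 0"
  proof -
    obtain j where "j \<in> J" using neJ by blast
    then show ?thesis using fz[of j] t by (cases f) auto
  qed
  define j0 where "j0 = Min J"
  have j0: "j0 \<in> J" "\<And>j. j \<in> J \<Longrightarrow> j0 \<le> j" using finJ neJ by (auto simp: j0_def)
  define s where "s = nat \<lfloor>sqrt (h * real l)\<rfloor>"
  have zj: "z j \<in> {z j0..z j0 + s}" if j: "j \<in> J" for j
  proof -
    have "f * z j0 ^ q \<le> f * z j ^ q" unfolding fz[OF j, symmetric] fz[OF j0(1), symmetric] using j0(2)[OF j] by simp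
    then have "z j0 ^ q \<le> z j ^ q" using f0 by simp
    then have le: "z j0 \<le> z j" using q by (simp add: power_mono_iff)
    define d where "d = z j - z j0"
    have d: "z j = z j0 + d" using le by (simp add: d_def)
    have "f * z j0 ^ q + d ^ 2 \<le> f * z j ^ q"
    proof -
      have "d ^ 2 \<le> d ^ q" using q by (cases "d = 0") (auto intro: power_increasing)
      also have "\<dots> \<le> f * d ^ q" using f0 by simp
      finally have "f * z j0 ^ q + d ^ 2 \<le> f * (z j0 ^ q + d ^ q)" by (simp add: distrib_left)
      also have "\<dots> \<le> f * z j ^ q" unfolding d using q by (intro mult_left_mono power_add_ge) auto
      finally show ?thesis .
    qed
    then have "j0 * u + d ^ 2 \<le> j * u" unfolding fz[OF j, symmetric] fz[OF j0(1), symmetric] by simp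
    then have "d ^ 2 \<le> j * u" by simp
    also have "\<dots> \<le> l * u" using j by (simp add: J_def)
    finally have "real (d ^ 2) \<le> real (l * u)" by (rule of_nat_mono)
    also have "\<dots> \<le> h * real l" using mult_left_mono[OF u, of "real l"] by (simp add: mult.commute)
    finally have "real d \<le> sqrt (h * real l)" by (intro real_le_rsqrt) simp
    then have "d \<le> s" by (simp add: s_def le_nat_floor)
    then show ?thesis using d by simp
  qed
  have "inj_on z J"
  proof (rule inj_onI)
    fix i j assume ij: "i \<in> J" "j \<in> J" "z i = z j"
    then have "t + i * u = t + j * u" using fz[OF ij(1)] fz[OF ij(2)] by simp
    then show "i = j" using t by simp
  qed
  then have "card J \<le> card {z j0..z j0 + s}" using zj by (intro card_inj_on_le[of z]) auto
  then have "card J \<le> s + 1" by simp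
  then have "real (card J) \<le> real s + 1" by linarith
  also have "real s \<le> sqrt (h * real l)"
  proof -
    have "h \<ge> 0" using u by linarith
    then show ?thesis unfolding s_def by simp
  qed
  finally show ?thesis by (simp add: J_def)
next
  case True
  have "h \<ge> 0" using u by linarith
  then show ?thesis unfolding True by simp
qed

text \<open>As \<open>a\<close> is invertible modulo p^2, some term is congruent to p modulo p^2; p
  divides it exactly once.\<close>

lemma progression_has_nonpower:
  fixes p a a0 :: nat
  assumes p: "prime p" and a: "\<not> p dvd a"
  shows "\<exists>j\<in>{1..p\<^sup>2}. a0 + j * a \<notin> perfect_powers"
proof -
  have p2: "p \<ge> 2" using p by (rule prime_ge_2_nat)
  have "coprime p a" by (rule prime_imp_coprime[OF p a])
  then have "coprime a (p\<^sup>2)" by (simp add: coprime_commute)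
  then obtain b where b: "[a * b = Suc 0] (mod p\<^sup>2)" using cong_solve_coprime_nat by blast
  have lt: "a0 mod p\<^sup>2 < p\<^sup>2" using p2 by simp
  \<comment> \<open>A natural number congruent to p - a0 modulo p^2, free of truncated subtraction.
    In \<open>j\<close> the residue 0 is replaced by p^2, since indices start at 1.\<close>
  define c where "c = p + (p\<^sup>2 - a0 mod p\<^sup>2)"
  define j where "j = (if b * c mod p\<^sup>2 = 0 then p\<^sup>2 else b * c mod p\<^sup>2)"
  have j: "j \<in> {1..p\<^sup>2}" using p2 by (auto simp: j_def intro: less_imp_le)
  have "[j = b * c] (mod p\<^sup>2)" by (auto simp: j_def cong_def)
  then have "[a0 + j * a = a0 + (b * c) * a] (mod p\<^sup>2)" by (intro cong_add cong_mult) auto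
  also have "(b * c) * a = (a * b) * c" by (simp add: mult_ac)
  also have "[a0 + (a * b) * c = a0 + Suc 0 * c] (mod p\<^sup>2)" by (intro cong_add cong_mult b) auto
  also have "[a0 + Suc 0 * c = a0 mod p\<^sup>2 + c] (mod p\<^sup>2)" by (simp add: cong_def mod_add_left_eq)
  also have "a0 mod p\<^sup>2 + c = p + p\<^sup>2" using lt unfolding c_def by linarith
  also have "[p + p\<^sup>2 = p] (mod p\<^sup>2)" by (simp add: cong_def)
  finally have cong: "[a0 + j * a = p] (mod p\<^sup>2)" .
  have "a0 + j * a \<notin> perfect_powers"
  proof
    assume "a0 + j * a \<in> perfect_powers"
    then obtain x m where x: "a0 + j * a = x ^ m" "m \<ge> 2" by (auto simp: perfect_powers_def)
    have "[a0 + j * a = p] (mod p)" using cong by (rule cong_dvd_modulus_nat) (simp add: power2_eq_square)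
    then have "p dvd a0 + j * a" using cong_dvd_iff by (metis dvd_refl)
    then have "p dvd x" using p x by (metis prime_dvd_power)
    then have "p ^ m dvd x ^ m" by (rule dvd_power_same)
    moreover have "p\<^sup>2 dvd p ^ m" using x(2) by (rule le_imp_power_dvd)
    ultimately have "p\<^sup>2 dvd a0 + j * a" using x by (metis dvd_trans)
    then have "p\<^sup>2 dvd p" using cong_dvd_iff[OF cong] by simp
    then have "p\<^sup>2 \<le> p" using p2 by (intro dvd_imp_le) auto
    moreover have "p\<^sup>2 \<ge> 2 * p" using p2 by (simp add: power2_eq_square)
    ultimately show False using p2 by linarith
  qed
  then show ?thesis using j by blast
qed

section \<open>Counting the prime divisors of an exponent\<close>

lemma fact_card_le_prod: "finite A \<Longrightarrow> (\<And>a. a \<in> A \<Longrightarrow> a > 0) \<Longrightarrow> fact (card A) \<le> \<Prod>(A::nat set)"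
proof (induction A rule: finite_linorder_max_induct)
  case (insert b A)
  have "A \<subseteq> {1..<b}" using insert by (force simp: Suc_le_eq)
  then have "card A \<le> card {1..<b}" by (intro card_mono) auto
  then have "Suc (card A) \<le> b" using insert.prems[of b] by simp
  moreover have "b \<notin> A" using insert by auto
  moreover have "fact (card A) \<le> \<Prod>A" using insert by simp
  ultimately have "Suc (card A) * fact (card A) \<le> b * \<Prod>A" by (intro mult_mono) auto
  then show ?case using insert(1) \<open>b \<notin> A\<close> by simp
qed simp

lemma power_le_fact: "(k::nat) ^ d \<le> fact (k + d)"
proof (induction d)
  case (Suc d)
  have "k * k ^ d \<le> Suc (k + d) * fact (k + d)" using Suc by (intro mult_mono) auto
  then show ?case by simp
qed simp

text \<open>The number 16 exceeds e^e, that is, 4 ln 2 > e. From here on N \<ge> 16 ensures that ln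
  L is positive and L / ln L is at least 1.\<close>

lemma ln_ln_gt_1:
  assumes "N \<ge> 16"
  shows "ln (ln (real N)) > 1"
proof -
  have "2 * (1/3) + 2 * (1/3) ^ 3 / 3 \<le> ln (2::real)"
    using ln_approx_bounds[of 2 2] by (simp add: numeral_eq_Suc lessThan_Suc)
  then have "272 / 100 \<le> 4 * ln (2::real)" by (simp add: power3_eq_cube)
  also have "\<dots> = ln 16" using ln_realpow[of 2 4] by simp
  also have "\<dots> \<le> ln (real N)" using assms by simp
  finally have less: "exp 1 < ln (real N)" using e_less_272 by linarith
  then have "ln (exp 1) < ln (ln (real N))" by (intro ln_less_cancel_iff[THEN iffD2]) (auto intro: less_trans[OF exp_gt_zero])
  then show ?thesis by simp
qed

text \<open>A product of r distinct primes is at least r!, so r! \<le> 2 ln N. For k near sqrt L,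
  k^(r - k) \<le> r! and ln k \<ge> (ln L) / 2 yield r - k \<le> 4 L / ln L, while k \<le> sqrt L +
  1 accounts for the other 3 L / ln L.\<close>

lemma prime_factors_count:
  assumes N: "N \<ge> 16" and \<beta>: "\<beta> > 0" "real \<beta> \<le> 2 * ln (real N)"
  defines "L \<equiv> ln (ln (real N))"
  shows "real (card (prime_factors \<beta>)) \<le> 7 * (L / ln L)"
proof -
  define r where "r = card (prime_factors \<beta>)"
  have L: "L > 1" unfolding L_def using N by (rule ln_ln_gt_1)
  have lnN: "ln (real N) > 0" using N by simp
  have lnL: "ln L > 0" "ln L \<le> L" using L ln_le_minus_one[of L] by auto
  have "fact r \<le> \<Prod>(prime_factors \<beta>)"
    unfolding r_def by (rule fact_card_le_prod) (auto simp: in_prime_factors_iff prime_gt_0_nat)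
  also have "\<dots> \<le> (\<Prod>p\<in>prime_factors \<beta>. p ^ multiplicity p \<beta>)"
  proof (rule prod_mono)
    fix p assume "p \<in> prime_factors \<beta>"
    then have "p \<ge> 1" "multiplicity p \<beta> > 0"
      by (auto simp: prime_factors_multiplicity Suc_le_eq prime_gt_0_nat)
    then show "0 \<le> p \<and> p \<le> p ^ multiplicity p \<beta>" by (auto intro: self_le_power)
  qed
  also have "\<dots> = \<beta>" using \<beta> by (simp add: prod_prime_factors)
  finally have fact: "fact r \<le> \<beta>" .
  define k where "k = nat \<lceil>sqrt L\<rceil>"
  have k: "sqrt L \<le> real k" "real k \<le> sqrt L + 1" "k > 0"
  proof -
    have "sqrt L > 0" using L by simp
    then show "sqrt L \<le> real k" "real k \<le> sqrt L + 1" "k > 0" unfolding k_def by linarith+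
  qed
  have sq: "sqrt L \<le> 2 * (L / ln L)"
  proof -
    have "ln L = 2 * ln (sqrt L)" using L by (simp add: ln_sqrt)
    also have "\<dots> \<le> 2 * sqrt L" using L ln_le_minus_one[of "sqrt L"] by simp
    finally have "sqrt L * ln L \<le> sqrt L * (2 * sqrt L)" using L by (intro mult_left_mono) auto
    also have "\<dots> = 2 * L" using L by simp
    finally show ?thesis using lnL by (simp add: field_simps)
  qed
  have one: "1 \<le> L / ln L" using lnL by simp
  have "real r \<le> real k + 4 * (L / ln L)"
  proof (cases "r \<le> k")
    case True
    then show ?thesis using L lnL by (simp add: add_increasing2)
  next
    case False
    then have "k ^ (r - k) \<le> \<beta>" using power_le_fact[of k "r - k"] fact by simp
    then have "real (k ^ (r - k)) \<le> real \<beta>" by (rule of_nat_mono)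
    then have "real k ^ (r - k) \<le> 2 * ln (real N)" using \<beta>(2) unfolding of_nat_power by linarith
    then have "ln (real k ^ (r - k)) \<le> ln (2 * ln (real N))"
      using k(3) lnN by (subst ln_le_cancel_iff) simp_all
    also have "\<dots> = ln 2 + L" using lnN by (simp add: ln_mult L_def)
    also have "\<dots> \<le> 2 * L" using L ln_le_minus_one[of "2::real"] by simp
    finally have "real (r - k) * ln (real k) \<le> 2 * L" using k by (simp add: ln_realpow)
    moreover have "ln L / 2 \<le> ln (real k)"
    proof -
      have "ln (sqrt L) \<le> ln (real k)" using k L by (subst ln_le_cancel_iff) auto
      then show ?thesis using L by (simp add: ln_sqrt)
    qed
    then have "real (r - k) * (ln L / 2) \<le> real (r - k) * ln (real k)" by (intro mult_left_mono) auto
    ultimately have "real (r - k) * (ln L / 2) \<le> 2 * L" by linarith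
    then have "real (r - k) \<le> 4 * (L / ln L)" using lnL by (simp add: field_simps)
    then show ?thesis using False by (simp add: of_nat_diff)
  qed
  then show ?thesis using k sq one unfolding r_def by linarith
qed

text \<open>A prime p dividing \<open>g\<close> cannot divide two consecutive t + j u, since it
  would divide u and then t; this gives the factor 2 and the summand 1. At the other indices the
  p-valuation of the term is that of \<open>g\<close>, and the exponent must divide it.\<close>

lemma valuation_exponents:
  fixes t u g l :: nat
  assumes t: "t > 0" and u: "u > 0" and cop: "coprime t u" and g: "g > 1"
    and pp: "\<And>j. j \<in> {1..l} \<Longrightarrow> g * (t + j * u) \<in> perfect_powers"
  shows "\<exists>\<beta>>0. 2 ^ \<beta> \<le> g \<and>
    l \<le> 1 + 2 * (\<Sum>q\<in>prime_factors \<beta>. card {j \<in> {1..l}. \<exists>x>0. g * (t + j * u) = x ^ q})"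
proof -
  obtain p where p: "prime p" "p dvd g" using g prime_factor_nat[of g] by auto
  define \<beta> where "\<beta> = multiplicity p g"
  have \<beta>: "\<beta> > 0" using p g by (simp add: \<beta>_def prime_multiplicity_gt_zero_iff)
  have "2 ^ \<beta> \<le> p ^ \<beta>" using prime_ge_2_nat[OF p(1)] by (intro power_mono) auto
  also have "p ^ \<beta> \<le> g" using g by (intro dvd_imp_le) (auto simp: \<beta>_def multiplicity_dvd)
  finally have g_ge: "2 ^ \<beta> \<le> g" .
  define Good where "Good = {j \<in> {1..l}. \<not> p dvd t + j * u}"
  define Bad where "Bad = {j \<in> {1..l}. p dvd t + j * u}"
  have "card (Suc ` Bad) \<le> card (insert (Suc l) Good)"
  proof (rule card_mono)
    show "Suc ` Bad \<subseteq> insert (Suc l) Good"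
    proof
      fix i assume "i \<in> Suc ` Bad"
      then obtain j where j: "i = Suc j" "j \<in> {1..l}" "p dvd t + j * u" by (auto simp: Bad_def)
      have "\<not> p dvd t + Suc j * u"
      proof
        assume "p dvd t + Suc j * u"
        then have "p dvd (t + j * u) + u" by (simp add: add_ac)
        then have "p dvd u" using j(3) by (simp add: dvd_add_right_iff)
        moreover from this have "p dvd t" using j(3) by (simp add: dvd_add_left_iff)
        ultimately have "is_unit p" using cop by (meson coprime_common_divisor)
        then show False using p(1) by auto
      qed
      then show "i \<in> insert (Suc l) Good" using j by (auto simp: Good_def)
    qed
  qed (simp add: Good_def)
  also have "\<dots> \<le> card Good + 1" by (simp add: Good_def)
  finally have "card Bad \<le> card Good + 1" by (simp add: card_image)
  moreover have "card Good + card Bad = l"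
  proof -
    have "card (Good \<union> Bad) = card Good + card Bad" by (intro card_Un_disjoint) (auto simp: Good_def Bad_def)
    moreover have "Good \<union> Bad = {1..l}" by (auto simp: Good_def Bad_def)
    ultimately show ?thesis by simp
  qed
  ultimately have l_le: "l \<le> 1 + 2 * card Good" by linarith
  have "Good \<subseteq> (\<Union>q\<in>prime_factors \<beta>. {j \<in> {1..l}. \<exists>x>0. g * (t + j * u) = x ^ q})"
  proof
    fix j assume j: "j \<in> Good"
    then have jl: "j \<in> {1..l}" and nd: "\<not> p dvd t + j * u" by (auto simp: Good_def)
    obtain q x where q: "prime q" "x > 0" "g * (t + j * u) = x ^ q"
      using perfect_power_prime_exponent[OF pp[OF jl]] by metis
    have "multiplicity p (g * (t + j * u)) = multiplicity p g + multiplicity p (t + j * u)"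
      using p(1) g t by (intro prime_elem_multiplicity_mult_distrib) auto
    then have "\<beta> = multiplicity p (x ^ q)"
      using nd unfolding q(3) by (simp add: \<beta>_def not_dvd_imp_multiplicity_0)
    also have "\<dots> = q * multiplicity p x"
      using p(1) q(2) by (intro prime_elem_multiplicity_power_distrib) auto
    finally have "q dvd \<beta>" by simp
    then have "q \<in> prime_factors \<beta>" using q(1) \<beta> by (simp add: in_prime_factors_iff)
    then show "j \<in> (\<Union>q\<in>prime_factors \<beta>. {j \<in> {1..l}. \<exists>x>0. g * (t + j * u) = x ^ q})"
      using q(2,3) jl by auto
  qed
  then have "card Good \<le> card (\<Union>q\<in>prime_factors \<beta>. {j \<in> {1..l}. \<exists>x>0. g * (t + j * u) = x ^ q})"
    by (intro card_mono) auto
  also have "\<dots> \<le> (\<Sum>q\<in>prime_factors \<beta>. card {j \<in> {1..l}. \<exists>x>0. g * (t + j * u) = x ^ q})"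
    by (rule card_UN_le) simp
  finally show ?thesis using \<beta> g_ge l_le by (intro exI[of _ \<beta>]) linarith
qed

text \<open>With gcd 1 there is no prime of \<open>g\<close> to restrict the exponents, but a
  perfect power itself has radical at most its square root. Hence \<open>five_terms_bound\<close>
  bounds \<open>a\<close> by \<open>h\<close>, and a prime p > h yields a nonpower among p^2
  terms.\<close>

lemma coprime_progression_bound:
  assumes ABC_conjecture
  obtains l0 where "\<And>a0 a l :: nat. \<lbrakk>a0 > 0; a > 0; coprime a0 a;
    \<And>j. j \<in> {1..l} \<Longrightarrow> a0 + j * a \<in> perfect_powers\<rbrakk> \<Longrightarrow> l \<le> l0"
proof -
  obtain h :: real where h: "\<And>I t u. \<lbrakk>I \<subseteq> {1..5}; card I = 5; t > 0; u > 0; coprime t u;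
    \<forall>i\<in>I. nrad (t + i * u) \<le> real 5 * sqrt (real (t + i * u))\<rbrakk> \<Longrightarrow> real u \<le> h"
    using five_terms_bound[OF assms, of 5] by blast
  obtain p :: nat where p: "prime p" "p > nat \<lceil>h\<rceil>" using bigger_prime by blast
  show thesis
  proof (rule that[of "5 + p\<^sup>2"])
    fix a0 a l :: nat
    assume a: "a0 > 0" "a > 0" "coprime a0 a" and pp: "\<And>j. j \<in> {1..l} \<Longrightarrow> a0 + j * a \<in> perfect_powers"
    show "l \<le> 5 + p\<^sup>2"
    proof (rule ccontr)
      assume l: "\<not> l \<le> 5 + p\<^sup>2"
      have "real a \<le> h"
      proof (rule h[of "{1..5}" a0 a])
        show "\<forall>i\<in>{1..5}. nrad (a0 + i * a) \<le> real 5 * sqrt (real (a0 + i * a))"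
        proof
          fix i :: nat assume "i \<in> {1..5}"
          then have "a0 + i * a \<in> perfect_powers" using l by (intro pp) auto
          then obtain x m where x: "x > 0" "m \<ge> 2" "a0 + i * a = x ^ m" by (auto simp: perfect_powers_def)
          have "nrad (a0 + i * a) = nrad x" unfolding x(3) using x(2) by (intro nrad_power) simp
          also have "\<dots> \<le> real x" using x(1) by (rule nrad_le)
          also have "real x \<le> sqrt (real (a0 + i * a))"
          proof (rule real_le_rsqrt)
            have "x ^ 2 \<le> x ^ m" using x by (intro power_increasing) auto
            then have "real (x ^ 2) \<le> real (a0 + i * a)" unfolding x(3) by (rule of_nat_mono)
            then show "(real x)\<^sup>2 \<le> real (a0 + i * a)" by simp
          qed
          also have "\<dots> \<le> real 5 * sqrt (real (a0 + i * a))" by simp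
          finally show "nrad (a0 + i * a) \<le> real 5 * sqrt (real (a0 + i * a))" .
        qed
      qed (use a in auto)
      then have "a < p" using p(2) by linarith
      then have "\<not> p dvd a" using a(2) by (auto dest: dvd_imp_le)
      then obtain j where "j \<in> {1..p\<^sup>2}" "a0 + j * a \<notin> perfect_powers"
        using progression_has_nonpower[OF p(1)] by blast
      then show False using pp[of j] l by auto
    qed
  qed
qed

theorem progression_bound:
  assumes ABC_conjecture
  obtains C :: real where "C > 0" "\<And>N a0 a l :: nat. \<lbrakk>N \<ge> 16; a0 > 0; a > 0;
    \<And>j. j \<in> {1..l} \<Longrightarrow> a0 + j * a \<in> {1..N} \<inter> perfect_powers\<rbrakk> \<Longrightarrow>
    real l \<le> C * (ln (ln (real N)) / ln (ln (ln (real N))))"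
proof -
  obtain l0 where l0: "\<And>a0 a l :: nat. \<lbrakk>a0 > 0; a > 0; coprime a0 a;
    \<And>j. j \<in> {1..l} \<Longrightarrow> a0 + j * a \<in> perfect_powers\<rbrakk> \<Longrightarrow> l \<le> l0"
    using coprime_progression_bound[OF assms] by blast
  obtain y0 where y0: "\<And>q a0 a b. q > y0 \<Longrightarrow> a > 0 \<Longrightarrow>
    card {j \<in> {b + 1..b + q ^ 2}. \<exists>x>0. a0 + j * a = x ^ q} \<le> (2::nat)"
    using large_exponent_sparse[OF assms] by blast
  \<comment> \<open>For y \<ge> 64 the exponents above y cover at most l/32 indices plus 2 for each
    exponent. With m = 64 y each of the at most y others covers 4 l/m = l/(16 y), up to a constant.
    Doubled by \<open>valuation_exponents\<close>, this is 3/16 of l, which is absorbed on the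
    left.\<close>
  define y where "y = max y0 64"
  have y64: "y \<ge> 64" by (simp add: y_def)
  define m where "m = 64 * y"
  obtain h0 :: real where h0: "\<And>I t u. \<lbrakk>I \<subseteq> {1..m}; card I = 5; t > 0; u > 0; coprime t u;
    \<forall>i\<in>I. nrad (t + i * u) \<le> real m * sqrt (real (t + i * u))\<rbrakk> \<Longrightarrow> real u \<le> h0"
    using five_terms_bound[OF assms, of m] by blast
  define h where "h = max h0 0"
  \<comment> \<open>The quotient c1 / y dominates both additive constants in \<open>small\<close>: 4
    from the windows, and 1 + 4 y h from the estimate sqrt (h l) \<le> l/(16 y) + 4 y h of the
    arithmetic-geometric mean.\<close>
  define c1 where "c1 = 4 * real y + real y + 4 * real y ^ 2 * h"
  define C where "C = 5 * 7 + (3 * c1 + 2) + real l0 + 1"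
  have h_nonneg: "h \<ge> 0" by (simp add: h_def)
  have c1: "c1 \<ge> 0" using h_nonneg by (simp add: c1_def)
  show thesis
  proof (rule that[of C])
    show "C > 0" using c1 by (simp add: C_def)
    fix N a0 a l :: nat
    assume N: "N \<ge> 16" and a: "a0 > 0" "a > 0"
      and pp: "\<And>j. j \<in> {1..l} \<Longrightarrow> a0 + j * a \<in> {1..N} \<inter> perfect_powers"
    define L where "L = ln (ln (real N))"
    have L: "L > 1" unfolding L_def using N by (rule ln_ln_gt_1)
    have lnL: "ln L > 0" "ln L \<le> L" using L ln_le_minus_one[of L] by auto
    have one: "1 \<le> L / ln L" using lnL by simp
    define g where "g = gcd a0 a"
    have g: "g > 0" using a by (simp add: g_def)
    have "\<exists>t u. a0 = t * gcd a0 a \<and> a = u * gcd a0 a \<and> coprime t u"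
      by (rule gcd_coprime_exists) (use a in auto)
    then obtain t u where "a0 = t * g" "a = u * g" "coprime t u" unfolding g_def by blast
    then have tu: "a0 = g * t" "a = g * u" "coprime t u" by (simp_all only: mult.commute)
    have pos: "t > 0" "u > 0" using a tu by auto
    have tm: "a0 + j * a = g * (t + j * u)" for j unfolding tu by (simp add: algebra_simps)
    have "real l \<le> C * (L / ln L)"
    proof (cases "g = 1")
      case True
      then have "coprime a0 a" by (simp add: g_def coprime_iff_gcd_eq_1)
      then have "real l \<le> real l0" using l0[OF a] pp by auto
      also have "\<dots> \<le> C * 1" using c1 by (simp add: C_def)
      also have "\<dots> \<le> C * (L / ln L)" using one c1 by (intro mult_left_mono) (auto simp: C_def)
      finally show ?thesis .
    next
      case False
      then have g1: "g > 1" using g by simp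
      define J where "J q = {j \<in> {1..l}. \<exists>x>0. g * (t + j * u) = x ^ q}" for q
      have "\<exists>\<beta>>0. 2 ^ \<beta> \<le> g \<and> l \<le> 1 + 2 * (\<Sum>q\<in>prime_factors \<beta>. card {j \<in> {1..l}. \<exists>x>0. g * (t + j * u) = x ^ q})"
        by (rule valuation_exponents[OF pos tu(3) g1]) (use pp in \<open>simp add: tm\<close>)
      then obtain \<beta> where \<beta>: "\<beta> > 0" "2 ^ \<beta> \<le> g" "l \<le> 1 + 2 * (\<Sum>q\<in>prime_factors \<beta>. card (J q))"
        unfolding J_def by blast
      define Q where "Q = prime_factors \<beta>"
      have finQ: "finite Q" by (simp add: Q_def)
      have Q2: "q \<ge> 2" if "q \<in> Q" for q using that by (auto simp: Q_def in_prime_factors_iff prime_ge_2_nat)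
      show ?thesis
      proof (cases "l = 0")
        case True
        then show ?thesis using c1 L lnL by (simp add: C_def)
      next
        case False
        have "g \<le> N"
        proof -
          have "a0 + 1 * a \<le> N" using pp[of 1] False by auto
          moreover have "g \<le> a0" unfolding g_def using a by (intro gcd_le1_nat) auto
          ultimately show ?thesis by linarith
        qed
        have "real \<beta> \<le> 2 * ln (real N)"
        proof -
          have "2 ^ \<beta> \<le> N" using \<beta>(2) \<open>g \<le> N\<close> by linarith
          then have "real (2 ^ \<beta>) \<le> real N" by (rule of_nat_mono)
          then have "ln (2 ^ \<beta>) \<le> ln (real N)" by (subst ln_le_cancel_iff) (use N in auto)
          then have "real \<beta> * ln 2 \<le> ln (real N)" by (simp add: ln_realpow)
          moreover have "real \<beta> * (1/2) \<le> real \<beta> * ln 2" using ln2_ge_half by (intro mult_left_mono) auto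
          ultimately show ?thesis by simp
        qed
        then have r: "real (card Q) \<le> 7 * (L / ln L)"
          unfolding L_def Q_def using prime_factors_count[OF N \<beta>(1)] by blast
        have large: "real (card (J q)) \<le> 2 * (real l / real (q ^ 2) + 1)" if "q > y" for q
          unfolding J_def
        proof (rule card_le_of_windows[of _ _ 2, simplified of_nat_numeral])
          fix b
          show "card {j \<in> {b + 1..b + q ^ 2}. \<exists>x>0. g * (t + j * u) = x ^ q} \<le> 2"
            unfolding tm[symmetric] using that a by (intro y0) (auto simp: y_def)
        qed (use that in auto)
        have large_sum: "(\<Sum>q\<in>{q \<in> Q. q > y}. real (card (J q))) \<le> 2 * real (card Q) + real l / 32"
        proof -
          have "(\<Sum>q\<in>{q \<in> Q. q > y}. real (card (J q)))
              \<le> (\<Sum>q\<in>{q \<in> Q. q > y}. 2 + 2 * real l * (1 / (real q)\<^sup>2))"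
            by (intro sum_mono order.trans[OF large]) auto
          also have "\<dots> = 2 * real (card {q \<in> Q. q > y}) + 2 * real l * (\<Sum>q\<in>{q \<in> Q. q > y}. 1 / (real q)\<^sup>2)"
            by (simp add: sum.distrib sum_distrib_left)
          also have "(\<Sum>q\<in>{q \<in> Q. q > y}. 1 / (real q)\<^sup>2) \<le> 1 / 64"
          proof -
            define M where "M = Max (insert y Q)"
            have M: "y \<le> M" "\<And>q. q \<in> Q \<Longrightarrow> q \<le> M" using finQ by (auto simp: M_def)
            have "(\<Sum>q\<in>{q \<in> Q. q > y}. 1 / (real q)\<^sup>2) \<le> (\<Sum>q=y+1..M. 1 / (real q)\<^sup>2)"
              using M by (intro sum_mono2) auto
            also have "\<dots> \<le> 1 / real y - 1 / real M"
              using M y64 by (intro sum_inverse_squares_le) auto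
            also have "\<dots> \<le> 1 / real y" by simp
            also have "\<dots> \<le> 1 / 64" using y64 by (intro divide_left_mono) auto
            finally show ?thesis .
          qed
          also have "real (card {q \<in> Q. q > y}) \<le> real (card Q)"
            using finQ by (intro of_nat_mono card_mono) auto
          finally show ?thesis by (simp add: mult_left_mono)
        qed
        have small: "real (card (J q)) \<le> real l / (16 * real y) + c1 / real y" if q: "q \<in> Q" "q \<le> y" for q
        proof (cases "real u > h")
          case True
          have "real (card (J q)) \<le> real 4 * (real l / real m + 1)"
            unfolding J_def
          proof (rule card_le_of_windows)
            show "m > 0" using y64 by (simp add: m_def)
            show "card {j \<in> {b + 1..b + m}. \<exists>x>0. g * (t + j * u) = x ^ q} \<le> 4" for b
              by (rule same_exponent_window[OF h0 g pos tu(3) Q2[OF q(1)]]) (use True in \<open>auto simp: h_def\<close>)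
          qed
          also have "\<dots> = real l / (16 * real y) + 4" by (simp add: m_def)
          also have "4 \<le> c1 / real y" using y64 h_nonneg by (simp add: c1_def field_simps)
          finally show ?thesis by simp
        next
          case False
          then have "real u \<le> h" by simp
          then have "real (card (J q)) \<le> 1 + sqrt (h * real l)"
            unfolding J_def by (rule same_exponent_count[OF g pos Q2[OF q(1)]])
          also have "sqrt (h * real l) \<le> real l / (16 * real y) + 4 * real y * h"
          proof (rule real_le_lsqrt)
            have "0 \<le> (real l / (16 * real y) - 4 * real y * h)\<^sup>2" by simp
            also have "\<dots> = (real l / (16 * real y) + 4 * real y * h)\<^sup>2 - h * real l"
              using y64 by (simp add: power2_eq_square algebra_simps)
            finally show "h * real l \<le> (real l / (16 * real y) + 4 * real y * h)\<^sup>2" by simp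
          qed (use h_nonneg y64 in auto)
          also have "1 + (real l / (16 * real y) + 4 * real y * h) \<le> real l / (16 * real y) + c1 / real y"
            using y64 by (simp add: c1_def field_simps power2_eq_square)
          finally show ?thesis by simp
        qed
        have small_sum: "(\<Sum>q\<in>{q \<in> Q. \<not> q > y}. real (card (J q))) \<le> real l / 16 + c1"
        proof -
          have "(\<Sum>q\<in>{q \<in> Q. \<not> q > y}. real (card (J q))) \<le> (\<Sum>q\<in>{q \<in> Q. \<not> q > y}. real l / (16 * real y) + c1 / real y)"
            by (intro sum_mono small) auto
          also have "\<dots> = real (card {q \<in> Q. \<not> q > y}) * (real l / (16 * real y) + c1 / real y)" by simp
          also have "\<dots> \<le> real y * (real l / (16 * real y) + c1 / real y)"
          proof (intro mult_right_mono of_nat_mono)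
            have "{q \<in> Q. \<not> q > y} \<subseteq> {1..y}" using Q2 by force
            then have "card {q \<in> Q. \<not> q > y} \<le> card {1..y}" by (intro card_mono) auto
            then show "card {q \<in> Q. \<not> q > y} \<le> y" by simp
          qed (use c1 in auto)
          also have "\<dots> = real l / 16 + c1" using y64 by (simp add: field_simps)
          finally show ?thesis .
        qed
        have "real l \<le> real (1 + 2 * (\<Sum>q\<in>Q. card (J q)))" unfolding Q_def using \<beta>(3) by (rule of_nat_mono)
        also have "\<dots> = 1 + 2 * (\<Sum>q\<in>Q. real (card (J q)))" by simp
        also have "(\<Sum>q\<in>Q. real (card (J q))) = (\<Sum>q\<in>{q \<in> Q. q > y}. real (card (J q))) + (\<Sum>q\<in>{q \<in> Q. \<not> q > y}. real (card (J q)))"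
        proof -
          have "Q = {q \<in> Q. q > y} \<union> {q \<in> Q. \<not> q > y}" by auto
          then show ?thesis using finQ by (subst sum.union_disjoint[symmetric]) auto
        qed
        finally have split: "real l \<le> 1 + 2 * ((\<Sum>q\<in>{q \<in> Q. q > y}. real (card (J q))) + (\<Sum>q\<in>{q \<in> Q. \<not> q > y}. real (card (J q))))" .
        have "x \<le> 5 * r + (3 * c1 + 2)"
          if "x \<le> 1 + 2 * (S + S')" "S \<le> 2 * r + x / 32" "S' \<le> x / 16 + c1" "r \<ge> 0" for x r S S' :: real
          using that c1 by argo
        from this[OF split large_sum small_sum]
        have "real l \<le> 5 * real (card Q) + (3 * c1 + 2)" by simp
        also have "\<dots> \<le> 5 * (7 * (L / ln L)) + (3 * c1 + 2) * (L / ln L)"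
        proof (intro add_mono mult_left_mono r)
          have "(3 * c1 + 2) * 1 \<le> (3 * c1 + 2) * (L / ln L)" using one c1 by (intro mult_left_mono) auto
          then show "3 * c1 + 2 \<le> (3 * c1 + 2) * (L / ln L)" by simp
        qed auto
        also have "\<dots> = (5 * 7 + (3 * c1 + 2)) * (L / ln L)" by (simp only: distrib_right mult.assoc)
        also have "\<dots> \<le> C * (L / ln L)" using L lnL by (intro mult_right_mono) (auto simp: C_def)
        finally show ?thesis .
      qed
    qed
    then show "real l \<le> C * (ln (ln (real N)) / ln (ln (ln (real N))))" by (simp only: L_def)
  qed
qed

section \<open>Hilbert cubes\<close>

definition subsums :: "(nat \<Rightarrow> nat) \<Rightarrow> nat set \<Rightarrow> nat set" where
  "subsums a I = (\<lambda>T. \<Sum>i\<in>T. a i) ` Pow I"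

lemma subsums_mono: "I \<subseteq> I' \<Longrightarrow> subsums a I \<subseteq> subsums a I'"
  unfolding subsums_def by (intro image_mono Pow_mono)

lemma subsums_insert:
  assumes "finite I" "i \<notin> I"
  shows "subsums a (insert i I) = subsums a I \<union> (\<lambda>x. x + a i) ` subsums a I"
proof -
  have "(\<lambda>T. \<Sum>i\<in>T. a i) ` insert i ` Pow I = (\<lambda>x. x + a i) ` (\<lambda>T. \<Sum>i\<in>T. a i) ` Pow I"
    unfolding image_image
  proof (rule image_cong)
    fix T assume "T \<in> Pow I"
    then have "finite T" "i \<notin> T" using assms finite_subset by auto
    then show "(\<Sum>i\<in>insert i T. a i) = (\<Sum>i\<in>T. a i) + a i" by simp
  qed simp
  then show ?thesis unfolding subsums_def Pow_insert image_Un by simp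
qed

text \<open>The new elements of the union are the right ends of the \<open>a\<close>-chains of \<open>A\<close>, and each such
  end is reached by at most \<open>K\<close> elements of \<open>A\<close>.\<close>

lemma card_shift_union_ge:
  fixes A :: "nat set"
  assumes A: "finite A" and a: "a > 0"
    and chain: "\<And>x n. (\<And>i. i < n \<Longrightarrow> x + i * a \<in> A) \<Longrightarrow> n \<le> K"
  shows "card A * (K + 1) \<le> K * card (A \<union> (\<lambda>x. x + a) ` A)"
proof -
  define End where "End = {x \<in> A. x + a \<notin> A}"
  have "A \<subseteq> (\<lambda>(e, i). e - i * a) ` (End \<times> {..<K})"
  proof
    fix x assume x: "x \<in> A"
    have "\<exists>n. x + n * a \<notin> A"
    proof (rule ccontr)
      assume "\<nexists>n. x + n * a \<notin> A"
      then have "Suc K \<le> K" by (intro chain[of "Suc K" x]) auto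
      then show False by simp
    qed
    define n where "n = (LEAST n. x + n * a \<notin> A)"
    have n: "x + n * a \<notin> A" unfolding n_def using \<open>\<exists>n. x + n * a \<notin> A\<close> by (rule LeastI_ex)
    have less: "x + i * a \<in> A" if "i < n" for i using not_less_Least[of i] that unfolding n_def by blast
    have "n \<noteq> 0" using n x by (cases n) auto
    then obtain i where i: "n = Suc i" by (cases n) auto
    have "i < K" using chain[of n x] less i by auto
    moreover have "x + i * a \<in> End" using less[of i] n i by (simp add: End_def add_ac)
    moreover have "x = (x + i * a) - i * a" by simp
    ultimately show "x \<in> (\<lambda>(e, i). e - i * a) ` (End \<times> {..<K})" by force
  qed
  moreover have finE: "finite End" using A by (simp add: End_def)
  ultimately have "card A \<le> card (End \<times> {..<K})" by (intro surj_card_le) auto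
  then have "card A \<le> card End * K" by (simp add: card_cartesian_product)
  moreover have "card (A \<union> (\<lambda>x. x + a) ` A) \<ge> card A + card End"
  proof -
    have "card (A \<union> (\<lambda>x. x + a) ` End) = card A + card ((\<lambda>x. x + a) ` End)"
      using A finE by (intro card_Un_disjoint) (auto simp: End_def)
    also have "card ((\<lambda>x. x + a) ` End) = card End" by (intro card_image) auto
    finally have "card A + card End = card (A \<union> (\<lambda>x. x + a) ` End)" by simp
    also have "\<dots> \<le> card (A \<union> (\<lambda>x. x + a) ` A)" using A by (intro card_mono) (auto simp: End_def)
    finally show ?thesis .
  qed
  then have "K * (card A + card End) \<le> K * card (A \<union> (\<lambda>x. x + a) ` A)" by (rule mult_le_mono2)
  ultimately show ?thesis by (simp add: algebra_simps)
qed

text \<open>Each generator contributes the factor 1 + 1/K of \<open>card_shift_union_ge\<close>,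
  here cleared of denominators. Chains in the sums over a subset of \<open>I\<close> are chains in
  the sums over \<open>I\<close>, so one \<open>K\<close> serves throughout.\<close>

lemma card_subsums_ge:
  assumes "finite I" and a: "\<And>i. i \<in> I \<Longrightarrow> a i > 0"
    and chain: "\<And>x n i. i \<in> I \<Longrightarrow> (\<And>j. j < n \<Longrightarrow> x + j * a i \<in> subsums a I) \<Longrightarrow> n \<le> K"
  shows "(K + 1) ^ card I \<le> K ^ card I * card (subsums a I)"
proof -
  have "(K + 1) ^ card T \<le> K ^ card T * card (subsums a T)" if "T \<subseteq> I" for T
    using finite_subset[OF that \<open>finite I\<close>] that
  proof (induction T rule: finite_induct)
    case empty
    then show ?case by (simp add: subsums_def)
  next
    case (insert i T)
    have fin: "finite (subsums a T)" using insert by (simp add: subsums_def)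
    have "card (subsums a T) * (K + 1) \<le> K * card (subsums a (insert i T))"
      unfolding subsums_insert[OF insert(1,2)]
    proof (rule card_shift_union_ge[OF fin])
      show "a i > 0" using a insert by simp
      fix x n assume *: "\<And>j. j < n \<Longrightarrow> x + j * a i \<in> subsums a T"
      show "n \<le> K"
      proof (rule chain[of i n x])
        show "x + j * a i \<in> subsums a I" if "j < n" for j
          using *[OF that] subsums_mono[of T I a] insert by auto
      qed (use insert in simp)
    qed
    then have "K ^ card T * (card (subsums a T) * (K + 1)) \<le> K ^ card T * (K * card (subsums a (insert i T)))"
      by (rule mult_le_mono2)
    moreover have "(K + 1) ^ card T * (K + 1) \<le> K ^ card T * card (subsums a T) * (K + 1)"
      using insert by (intro mult_le_mono1) auto
    ultimately have "(K + 1) ^ card T * (K + 1) \<le> K ^ card T * (K * card (subsums a (insert i T)))"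
      by (simp only: mult.assoc)
    then show ?case using insert(1,2) by (simp add: mult_ac)
  qed
  then show ?thesis by blast
qed

lemma translated_subsums_bound:
  assumes ABC_conjecture
  obtains C :: real where "C > 0" "\<And>N a0 d a. \<lbrakk>N \<ge> 16; a0 > 0; \<And>i. i \<in> {1..d} \<Longrightarrow> a i > 0;
    \<And>x. x \<in> subsums a {1..d} \<Longrightarrow> a0 + x \<in> {1..N} \<inter> perfect_powers\<rbrakk> \<Longrightarrow>
    real d \<le> C * ((ln (ln (real N)))\<^sup>2 / ln (ln (ln (real N))))"
proof -
  obtain C0 :: real where C0: "C0 > 0" "\<And>N a0 a l :: nat. \<lbrakk>N \<ge> 16; a0 > 0; a > 0;
    \<And>j. j \<in> {1..l} \<Longrightarrow> a0 + j * a \<in> {1..N} \<inter> perfect_powers\<rbrakk> \<Longrightarrow>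
    real l \<le> C0 * (ln (ln (real N)) / ln (ln (ln (real N))))"
    using progression_bound[OF assms] by blast
  define c :: real where "c = 64 * 40000 ^ 8"
  have c: "c \<ge> 1" by (simp add: c_def)
  define D where "D = (C0 + 2) * (ln c + 25)"
  have D: "D > 0" using C0(1) c by (simp add: D_def add_nonneg_pos)
  show thesis
  proof (rule that[of "2 * D + 1"])
    show "2 * D + 1 > 0" using D by simp
    fix N a0 d and a :: "nat \<Rightarrow> nat"
    assume N: "N \<ge> 16" and a0: "a0 > 0" and a: "\<And>i. i \<in> {1..d} \<Longrightarrow> a i > 0"
      and pp: "\<And>x. x \<in> subsums a {1..d} \<Longrightarrow> a0 + x \<in> {1..N} \<inter> perfect_powers"
    define L where "L = ln (ln (real N))"
    have L: "L > 1" unfolding L_def using N by (rule ln_ln_gt_1)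
    have lnL: "ln L > 0" "ln L \<le> L" using L ln_le_minus_one[of L] by auto
    define \<kappa> where "\<kappa> = C0 * (L / ln L)"
    define K where "K = nat \<lfloor>\<kappa>\<rfloor> + 1"
    have \<kappa>0: "\<kappa> \<ge> 0" using C0(1) L lnL by (simp add: \<kappa>_def)
    have K: "K \<ge> 1" "real K \<le> \<kappa> + 1" using \<kappa>0 by (auto simp: K_def)
    have chain: "n \<le> K" if I: "I \<subseteq> {1..d}" "i \<in> I"
      and mem: "\<And>j. j < n \<Longrightarrow> x + j * a i \<in> subsums a I" for I i n x
    proof -
      \<comment> \<open>The first element of the chain becomes the base point a0 + x of the
        progression, which leaves n - 1 terms; hence the 1 added in \<open>K\<close>.\<close>
      have "real (n - 1) \<le> \<kappa>" unfolding \<kappa>_def L_def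
      proof (rule C0(2)[OF N])
        show "a0 + x > 0" using a0 by simp
        show "a i > 0" using a I by auto
        fix j assume "j \<in> {1..n - 1}"
        then have "j < n" by auto
        then have "x + j * a i \<in> subsums a {1..d}" using mem[of j] subsums_mono[OF I(1), of a] by blast
        then have "a0 + (x + j * a i) \<in> {1..N} \<inter> perfect_powers" by (rule pp)
        then show "a0 + x + j * a i \<in> {1..N} \<inter> perfect_powers" by (simp only: add.assoc)
      qed
      then have "n - 1 \<le> nat \<lfloor>\<kappa>\<rfloor>" by (rule le_nat_floor)
      then show ?thesis unfolding K_def by linarith
    qed
    have grow: "(1 + 1 / real K) ^ card I \<le> real (card (subsums a I))" if I: "I \<subseteq> {1..d}" for I
    proof -
      have "(K + 1) ^ card I \<le> K ^ card I * card (subsums a I)"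
      proof (rule card_subsums_ge)
        show "finite I" using I by (rule finite_subset) simp
        show "a i > 0" if "i \<in> I" for i using a I that by auto
        show "n \<le> K" if "i \<in> I" "\<And>j. j < n \<Longrightarrow> x + j * a i \<in> subsums a I" for x n i
          using chain[OF I that] .
      qed
      then have "real ((K + 1) ^ card I) \<le> real (K ^ card I * card (subsums a I))" by (rule of_nat_mono)
      then have "(real K + 1) ^ card I \<le> real K ^ card I * real (card (subsums a I))" by (simp add: add.commute)
      then have "(real K + 1) ^ card I / real K ^ card I \<le> real (card (subsums a I))"
        using K(1) by (simp add: divide_le_eq mult.commute)
      also have "(real K + 1) ^ card I / real K ^ card I = (1 + 1 / real K) ^ card I"
        using K(1) by (simp add: power_divide[symmetric] add_divide_distrib)
      finally show ?thesis .
    qed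
    define e where "e = d div 2"
    define I1 I2 where "I1 = {1..e}" and "I2 = {e + 1..2 * e}"
    have I: "I1 \<subseteq> {1..d}" "I2 \<subseteq> {1..d}" "card I1 = e" "card I2 = e" "I1 \<inter> I2 = {}"
      by (auto simp: I1_def I2_def e_def)
    define S1 S2 where "S1 = (\<lambda>x. a0 + x) ` subsums a I1" and "S2 = subsums a I2"
    have fin: "finite S1" "finite S2" by (simp_all add: S1_def S2_def I1_def I2_def subsums_def)
    have card1: "(1 + 1 / real K) ^ e \<le> real (card S1)"
      using grow[OF I(1)] I(3) by (simp add: S1_def card_image)
    have card2: "(1 + 1 / real K) ^ e \<le> real (card S2)"
      using grow[OF I(2)] I(4) by (simp add: S2_def)
    \<comment> \<open>\<open>sumset_perfect_powers_bound\<close> wants sets of equal size, so both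
      halves are trimmed to the smaller size, which still has the lower bound (1 + 1/K)^e.\<close>
    define n where "n = min (card S1) (card S2)"
    have n: "(1 + 1 / real K) ^ e \<le> real n" using card1 card2 by (simp add: n_def)
    have n_le: "n \<le> card S1" "n \<le> card S2" by (simp_all add: n_def)
    obtain A where A: "A \<subseteq> S1" "card A = n" using obtain_subset_with_card_n[OF n_le(1)] by blast
    obtain B where B: "B \<subseteq> S2" "card B = n" using obtain_subset_with_card_n[OF n_le(2)] by blast
    have ge1: "1 \<le> (1 + 1 / real K) ^ e" by (rule one_le_power) simp
    have "real (card A) \<le> 64 * 40000 ^ 8 * ln (real N) ^ 25"
    proof (rule sumset_perfect_powers_bound)
      show "finite A" using A(1) fin(1) by (rule finite_subset)
      show "finite B" using B(1) fin(2) by (rule finite_subset)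
      have "n \<noteq> 0"
      proof
        assume "n = 0"
        then have "(1 + 1 / real K) ^ e \<le> 0" using n by (simp only: of_nat_0)
        then show False using ge1 by linarith
      qed
      then show "A \<noteq> {}" using A(2) by auto
      show "card B = card A" using A B by simp
      show "N \<ge> 16" by fact
      fix x y assume "x \<in> A" "y \<in> B"
      then have "x \<in> S1" "y \<in> S2" using A(1) B(1) by blast+
      then obtain T1 T2 where T: "T1 \<subseteq> I1" "x = a0 + (\<Sum>i\<in>T1. a i)" "T2 \<subseteq> I2" "y = (\<Sum>i\<in>T2. a i)"
        unfolding S1_def S2_def subsums_def by (elim imageE) (simp only: Pow_iff)
      have "(\<Sum>i\<in>T1 \<union> T2. a i) = (\<Sum>i\<in>T1. a i) + (\<Sum>i\<in>T2. a i)"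
      proof (rule sum.union_disjoint)
        show "finite T1" using T(1) by (rule finite_subset) (simp add: I1_def)
        show "finite T2" using T(3) by (rule finite_subset) (simp add: I2_def)
        show "T1 \<inter> T2 = {}" using T(1,3) I(5) by blast
      qed
      then have "x + y = a0 + (\<Sum>i\<in>T1 \<union> T2. a i)" using T by simp
      also have "\<dots> \<in> {1..N} \<inter> perfect_powers"
      proof (rule pp)
        have "T1 \<union> T2 \<subseteq> {1..d}" using T(1,3) I(1,2) by blast
        then show "(\<Sum>i\<in>T1 \<union> T2. a i) \<in> subsums a {1..d}" unfolding subsums_def by blast
      qed
      finally show "x + y \<in> {1..N} \<inter> perfect_powers" .
    qed
    then have upper: "(1 + 1 / real K) ^ e \<le> c * ln (real N) ^ 25"
      using n unfolding A(2) c_def by linarith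
    have lnN: "ln (real N) > 0" using N by simp
    have "ln ((1 + 1 / real K) ^ e) \<le> ln (c * ln (real N) ^ 25)"
      using ge1 upper by (subst ln_le_cancel_iff) linarith+
    then have "real e * ln (1 + 1 / real K) \<le> ln c + 25 * L"
      using lnN c K(1) by (simp add: ln_realpow ln_mult L_def add_pos_pos)
    moreover have "1 / (real K + 1) \<le> ln (1 + 1 / real K)"
    proof -
      have "ln (real K / (real K + 1)) \<le> real K / (real K + 1) - 1" using K(1) by (intro ln_le_minus_one) auto
      also have "\<dots> = - (1 / (real K + 1))" by (simp add: field_simps)
      also have "ln (real K / (real K + 1)) = - ln (1 + 1 / real K)"
        using K(1) by (simp add: ln_div[symmetric] field_simps flip: ln_inverse)
      finally show ?thesis by simp
    qed
    then have "real e * (1 / (real K + 1)) \<le> real e * ln (1 + 1 / real K)" by (intro mult_left_mono) auto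
    ultimately have "real e * (1 / (real K + 1)) \<le> ln c + 25 * L" by linarith
    then have "real e \<le> (real K + 1) * (ln c + 25 * L)" by (simp add: field_simps)
    also have "\<dots> \<le> ((C0 + 2) * (L / ln L)) * ((ln c + 25) * L)"
    proof (rule mult_mono)
      have "1 \<le> L / ln L" using lnL by simp
      moreover have "(C0 + 2) * (L / ln L) = \<kappa> + 2 * (L / ln L)" by (simp only: distrib_right \<kappa>_def)
      ultimately show "real K + 1 \<le> (C0 + 2) * (L / ln L)" using K(2) by linarith
      have "ln c * 1 \<le> ln c * L" using L c by (intro mult_left_mono) auto
      then show "ln c + 25 * L \<le> (ln c + 25) * L" by (simp add: distrib_right)
    qed (use C0(1) L lnL c in auto)
    also have "\<dots> = D * (L\<^sup>2 / ln L)" by (simp add: D_def power2_eq_square)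
    finally have e_le: "real e \<le> D * (L\<^sup>2 / ln L)" .
    have "1 \<le> L\<^sup>2 / ln L"
    proof -
      have "ln L \<le> L * 1" using lnL by simp
      also have "\<dots> \<le> L * L" using L by (intro mult_left_mono) auto
      finally show ?thesis using lnL by (simp add: power2_eq_square)
    qed
    moreover have "real d \<le> 2 * real e + 1" unfolding e_def by linarith
    ultimately have "real d \<le> 2 * (D * (L\<^sup>2 / ln L)) + 1 * (L\<^sup>2 / ln L)" using e_le by linarith
    then show "real d \<le> (2 * D + 1) * ((ln (ln (real N)))\<^sup>2 / ln (ln (ln (real N))))"
      unfolding L_def by (simp only: distrib_right mult.assoc)
  qed
qed

section \<open>From subset sums to Hilbert cubes\<close>

lemma subsums_in_hilbert_cube:
  assumes "a0 > 0" "x \<in> subsums a {1..d}"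
  shows "a0 + x \<in> hilbert_cube a0 d a"
proof -
  obtain T where T: "T \<subseteq> {1..d}" "x = (\<Sum>i\<in>T. a i)" using assms(2) by (auto simp: subsums_def)
  have "x = (\<Sum>i=1..d. if i \<in> T then a i else 0)"
    unfolding T(2) using T(1) by (intro sum.mono_neutral_cong_left) auto
  then have "x \<in> (\<Sum>i=1..d. {0, a i})"
    unfolding set_sum_alt[OF finite_atLeastAtMost] by (intro CollectI exI conjI) auto
  then show ?thesis using assms(1) unfolding hilbert_cube_def by (auto intro: set_plus_intro)
qed

lemma sum_in_hilbert_cube_0:
  assumes "T \<subseteq> {1..d}" "T \<noteq> {}"
  shows "(\<Sum>i\<in>T. a i) \<in> hilbert_cube 0 d a"
proof -
  define \<epsilon> :: "nat \<Rightarrow> nat" where "\<epsilon> i = (if i \<in> T then 1 else 0)" for i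
  have "(\<Sum>i\<in>T. a i) = (\<Sum>i=1..d. \<epsilon> i * a i)"
    using assms(1) by (intro sum.mono_neutral_cong_left) (auto simp: \<epsilon>_def)
  moreover have "(\<Sum>i=1..d. \<epsilon> i) > 0"
  proof -
    obtain i where "i \<in> T" using assms by blast
    then show ?thesis using assms(1) by (intro sum_pos2[of _ i]) (auto simp: \<epsilon>_def)
  qed
  ultimately show ?thesis unfolding hilbert_cube_def by (auto simp: \<epsilon>_def intro!: exI[of _ \<epsilon>])
qed

text \<open>For a0 = 0 each generator is itself an element of the cube and therefore positive. The
  generator \<open>a d\<close> then takes the role of \<open>a0\<close> for the remaining d - 1, and
  the lost dimension is absorbed because (L^2) / ln L \<ge> 1.\<close>

lemma hilbert_cube_bound:
  assumes ABC_conjecture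
  obtains C :: real where "C > 0" "\<And>N a0 d a. \<lbrakk>N \<ge> 16; a0 > 0 \<Longrightarrow> \<forall>i\<in>{1..d}. a i > 0;
    hilbert_cube a0 d a \<subseteq> {1..N} \<inter> perfect_powers\<rbrakk> \<Longrightarrow>
    real d \<le> C * ((ln (ln (real N)))\<^sup>2 / ln (ln (ln (real N))))"
proof -
  obtain C :: real where C: "C > 0" "\<And>N a0 d a. \<lbrakk>N \<ge> 16; a0 > 0; \<And>i. i \<in> {1..d} \<Longrightarrow> a i > 0;
    \<And>x. x \<in> subsums a {1..d} \<Longrightarrow> a0 + x \<in> {1..N} \<inter> perfect_powers\<rbrakk> \<Longrightarrow>
    real d \<le> C * ((ln (ln (real N)))\<^sup>2 / ln (ln (ln (real N))))"
    using translated_subsums_bound[OF assms] by blast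
  show thesis
  proof (rule that[of "C + 1"])
    show "C + 1 > 0" using C(1) by simp
    fix N a0 d and a :: "nat \<Rightarrow> nat"
    assume N: "N \<ge> 16" and a: "a0 > 0 \<Longrightarrow> \<forall>i\<in>{1..d}. a i > 0"
      and sub: "hilbert_cube a0 d a \<subseteq> {1..N} \<inter> perfect_powers"
    define L where "L = ln (ln (real N))"
    have L: "L > 1" unfolding L_def using N by (rule ln_ln_gt_1)
    have lnL: "ln L > 0" "ln L \<le> L" using L ln_le_minus_one[of L] by auto
    have one: "1 \<le> L\<^sup>2 / ln L"
    proof -
      have "ln L \<le> L * 1" using lnL by simp
      also have "\<dots> \<le> L * L" using L by (intro mult_left_mono) auto
      finally show ?thesis using lnL by (simp add: power2_eq_square)
    qed
    have "real d \<le> C * (L\<^sup>2 / ln L) + 1 * (L\<^sup>2 / ln L)"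
    proof (cases "a0 > 0")
      case True
      have "real d \<le> C * (L\<^sup>2 / ln L)" unfolding L_def
        by (rule C(2)[OF N True, of d a]) (use a[OF True] sub subsums_in_hilbert_cube[OF True] in blast)+
      then show ?thesis using one by linarith
    next
      case False
      then have a0: "a0 = 0" by simp
      show ?thesis
      proof (cases "d = 0")
        case True
        have "0 \<le> C * (L\<^sup>2 / ln L)" using C(1) one by (intro mult_nonneg_nonneg) linarith+
        then show ?thesis using True one by linarith
      next
        case False
        have pos: "a i > 0" if "i \<in> {1..d}" for i
        proof -
          have "(\<Sum>i\<in>{i}. a i) \<in> hilbert_cube 0 d a" by (rule sum_in_hilbert_cube_0) (use that in auto)
          then show ?thesis using sub unfolding a0 by auto
        qed
        have "real (d - 1) \<le> C * (L\<^sup>2 / ln L)" unfolding L_def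
        proof (rule C(2)[OF N])
          show "a d > 0" using pos[of d] False by auto
          show "a i > 0" if "i \<in> {1..d - 1}" for i using pos[of i] that by auto
          fix x assume "x \<in> subsums a {1..d - 1}"
          then obtain T where T: "T \<subseteq> {1..d - 1}" "x = (\<Sum>i\<in>T. a i)" by (auto simp: subsums_def)
          have "d \<notin> T" using T(1) False by auto
          then have "a d + x = (\<Sum>i\<in>insert d T. a i)"
            unfolding T(2) using finite_subset[OF T(1)] by simp
          also have "\<dots> \<in> hilbert_cube 0 d a"
          proof (rule sum_in_hilbert_cube_0)
            have "{1..d - 1} \<subseteq> {1..d}" "d \<in> {1..d}" using False by auto
            then show "insert d T \<subseteq> {1..d}" using T(1) by blast
          qed simp
          finally show "a d + x \<in> {1..N} \<inter> perfect_powers" using sub unfolding a0 by blast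
        qed
        then show ?thesis using one by linarith
      qed
    qed
    then show "real d \<le> (C + 1) * ((ln (ln (real N)))\<^sup>2 / ln (ln (ln (real N))))"
      unfolding L_def by (simp only: distrib_right)
  qed
qed

theorem theorem2p8:
  assumes "ABC_conjecture"
  shows
    "(\<exists>C::real. C > 0 \<and> (\<forall>(N::nat) (a0::nat) (p::nat) (d::nat) (a :: nat \<Rightarrow> nat).
        N \<ge> 16 \<and> prime p \<and> p dvd a0 \<and> (\<forall>i\<in>{1..d}. a i \<in> {1..N}) \<and>
        hilbert_cube a0 d a \<subseteq> {1..N} \<inter> perfect_powers \<longrightarrow>
        real d \<le> C * (real p + (ln (ln (real N)))\<^sup>2 / ln (ln (ln (real N))))))
   \<and> (\<exists>C::real. C > 0 \<and> (\<forall>(N::nat) (d::nat) (a :: nat \<Rightarrow> nat).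
        N \<ge> 16 \<and> hilbert_cube 0 d a \<subseteq> {1..N} \<inter> perfect_powers \<longrightarrow>
        real d \<le> C * ((ln (ln (real N)))\<^sup>2 / ln (ln (ln (real N))))))
   \<and> (\<exists>C::real. C > 0 \<and> (\<forall>(N::nat) (a0::nat) (d::nat) (a :: nat \<Rightarrow> nat).
        N \<ge> 16 \<and> (\<forall>i\<in>{1..d}. a i > 0) \<and>
        hilbert_cube a0 d a \<subseteq> {1..N} \<inter> perfect_powers \<longrightarrow>
        real d \<le> C * ((ln (ln (real N))) ^ 3 / ln (ln (ln (real N))))))
   \<and> (LPS_conjecture \<longrightarrow>
      (\<exists>C::real. C > 0 \<and> (\<forall>(N::nat) (a0::nat) (d::nat) (a :: nat \<Rightarrow> nat).
        N \<ge> 16 \<and> (\<forall>i\<in>{1..d}. a i > 0) \<and>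
        hilbert_cube a0 d a \<subseteq> {1..N} \<inter> perfect_powers \<longrightarrow>
        real d \<le> C * ((ln (ln (real N)))\<^sup>2 / ln (ln (ln (real N)))))))"
proof -
  obtain C :: real where C: "C > 0" "\<And>N a0 d a. \<lbrakk>N \<ge> 16; a0 > 0 \<Longrightarrow> \<forall>i\<in>{1..d}. a i > 0;
    hilbert_cube a0 d a \<subseteq> {1..N} \<inter> perfect_powers\<rbrakk> \<Longrightarrow>
    real d \<le> C * ((ln (ln (real N)))\<^sup>2 / ln (ln (ln (real N))))"
    using hilbert_cube_bound[OF assms] by blast
  have main: "real d \<le> C * ((ln (ln (real N)))\<^sup>2 / ln (ln (ln (real N))))"
    if "N \<ge> 16" "\<forall>i\<in>{1..d}. a i > 0" "hilbert_cube a0 d a \<subseteq> {1..N} \<inter> perfect_powers" for N a0 d a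
    using C(2)[OF that(1) _ that(3)] that(2) by blast
  show ?thesis
  \<comment> \<open>One constant serves all four clauses: adding p enlarges the bound of the first,
    and L > 1 gives L^2 \<le> L^3 for the third.\<close>
  proof (intro conjI impI exI[of _ C] allI C(1); elim conjE)
    fix N a0 p d and a :: "nat \<Rightarrow> nat"
    assume *: "N \<ge> 16" "\<forall>i\<in>{1..d}. a i \<in> {1..N}" "hilbert_cube a0 d a \<subseteq> {1..N} \<inter> perfect_powers"
    have "real d \<le> C * ((ln (ln (real N)))\<^sup>2 / ln (ln (ln (real N))))"
      by (rule main[OF *(1) _ *(3)]) (use *(2) in force)
    also have "\<dots> \<le> C * (real p + (ln (ln (real N)))\<^sup>2 / ln (ln (ln (real N))))"
      using C(1) by (intro mult_left_mono) auto
    finally show "real d \<le> C * (real p + (ln (ln (real N)))\<^sup>2 / ln (ln (ln (real N))))" .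
  next
    fix N d and a :: "nat \<Rightarrow> nat"
    assume "N \<ge> 16" "hilbert_cube 0 d a \<subseteq> {1..N} \<inter> perfect_powers"
    then show "real d \<le> C * ((ln (ln (real N)))\<^sup>2 / ln (ln (ln (real N))))"
      by (intro C(2)) auto
  next
    fix N a0 d and a :: "nat \<Rightarrow> nat"
    assume *: "N \<ge> 16" "\<forall>i\<in>{1..d}. a i > 0" "hilbert_cube a0 d a \<subseteq> {1..N} \<inter> perfect_powers"
    define L where "L = ln (ln (real N))"
    have L: "L > 1" unfolding L_def using *(1) by (rule ln_ln_gt_1)
    have "real d \<le> C * (L\<^sup>2 / ln L)" unfolding L_def by (rule main[OF *])
    also have "\<dots> \<le> C * (L ^ 3 / ln L)"
      using C(1) L by (intro mult_left_mono divide_right_mono power_increasing) auto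
    finally show "real d \<le> C * ((ln (ln (real N))) ^ 3 / ln (ln (ln (real N))))" unfolding L_def .
  next
    fix N a0 d and a :: "nat \<Rightarrow> nat"
    assume "N \<ge> 16" "\<forall>i\<in>{1..d}. a i > 0" "hilbert_cube a0 d a \<subseteq> {1..N} \<inter> perfect_powers"
    then show "real d \<le> C * ((ln (ln (real N)))\<^sup>2 / ln (ln (ln (real N))))" by (rule main)
  qed
qed

end
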